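(* Let $d\ge 3$. There exists $\gamma>0$ with the following property: for every positive integer $n$ such that $n+d$ is even, there exists a $\gamma$-dense set of $n$ points in general position in $\mathbb{R}^d$ with $n^{d-1}e^{\Omega(\sqrt{\log n})}$ halving hyperplanes. Explicitly: for every integer $d\ge 3$ there exist $\gamma>0$, $c>0$ and $n_0$ (depending only on $d$) such that for every positive integer $n$ with $n+d$ even there is a $\gamma$-dense set $P_n\subset\mathbb{R}^d$ of $n$ points in general position such that, whenever $n\ge n_0$, the set $P_n$ has at least $n^{d-1}e^{c\sqrt{\log n}}$ halving hyperplanes.
   Context: A set of points in $\mathbb{R}^d$ is in general position if no $d+1$ of its points are on a hyperplane. For a set $P$ of $n$ points in $\mathbb{R}^d$ in general position, a hyperplane determined by $d$ points of $P$ is a halving hyperplane of $P$ if it has exactly $(n-d)/2$ points of $P$ on each of its two (open) sides. For $\gamma>0$, a set $P$ of $n$ points in $\mathbb{R}^d$ is $\gamma$-dense if the ratio of the largest and smallest distances determined by (pairs of distinct points of) $P$ is at most $\gamma\sqrt[d]{n}$ (a one-point set is regarded as $\gamma$-dense for every $\gamma$). *)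

theory Defs
  imports "HOL-Analysis.Analysis"
begin

definition hyperplane :: "'a::euclidean_space set \<Rightarrow> bool" where
  "hyperplane H \<longleftrightarrow> (\<exists>a b. a \<noteq> 0 \<and> H = {x. a \<bullet> x = b})"

definition general_position :: "'a::euclidean_space set \<Rightarrow> bool" where
  "general_position P \<longleftrightarrow>
     (\<forall>S. S \<subseteq> P \<and> card S = DIM('a) + 1 \<longrightarrow> \<not> (\<exists>H. hyperplane H \<and> S \<subseteq> H))"

text \<open>
  A set \<open>S\<close> of \<open>DIM('a)\<close> points determines a hyperplane only if it is affinely
  independent, and the hyperplane is then its affine hull. In general position the
  independence is automatic once \<open>P\<close> has more than \<open>DIM('a)\<close> points.
\<close>

definition determined_hyperplane :: "'a::euclidean_space set \<Rightarrow> 'a set \<Rightarrow> bool" where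
  "determined_hyperplane P H \<longleftrightarrow>
     (\<exists>S. S \<subseteq> P \<and> card S = DIM('a) \<and> \<not> affine_dependent S \<and> H = affine hull S)"

text \<open>
  The two sides do not depend on the equation chosen for \<open>H\<close>, up to swapping them.
  The equations are between reals, so nothing is rounded or truncated.
\<close>

definition halving_hyperplane :: "'a::euclidean_space set \<Rightarrow> 'a set \<Rightarrow> bool" where
  "halving_hyperplane P H \<longleftrightarrow>
     determined_hyperplane P H \<and>
     (\<exists>a b. a \<noteq> 0 \<and> H = {x. a \<bullet> x = b} \<and>
        real (card {x \<in> P. a \<bullet> x < b}) = (real (card P) - real DIM('a)) / 2 \<and>
        real (card {x \<in> P. a \<bullet> x > b}) = (real (card P) - real DIM('a)) / 2)"

definition distances :: "'a::metric_space set \<Rightarrow> real set" where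
  "distances P = {dist x y | x y. x \<in> P \<and> y \<in> P \<and> x \<noteq> y}"

text \<open>
  The guard \<open>card P \<ge> 2\<close> makes one-point sets dense for every \<open>\<gamma>\<close>; there
  \<open>distances P\<close> is empty and \<open>Max\<close> and \<open>Min\<close> would be unspecified.
\<close>

definition gamma_dense :: "real \<Rightarrow> 'a::euclidean_space set \<Rightarrow> bool" where
  "gamma_dense \<gamma> P \<longleftrightarrow>
     finite P \<and>
     (card P \<ge> 2 \<longrightarrow>
        Max (distances P) / Min (distances P) \<le> \<gamma> * root DIM('a) (real (card P)))"

end

theory Submission
  imports Defs
begin

text \<open>
  Every point of a planar set is replaced by a vertical arithmetic progression of \<open>a\<close> points.
  For a halving line through \<open>u\<close> and \<open>z\<close>, the \<open>a\<close> lines joining opposite members of the two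
  progressions meet in one point; a new point placed just below it forms a halving line with
  each of the \<open>2 a\<close> progression points, and an antipodal companion keeps it neutral for all
  other lines. With \<open>a\<close> four times the old degree, each step multiplies the number of halving
  lines per point by \<open>4/3\<close>, so \<open>n\<close> points have \<open>n exp(\<Omega>(sqrt(log n)))\<close> halving lines. The spacings
  can be chosen such that the points may be moved by \<open>n^(-O(1))\<close> in the horizontal direction
  (along suitable slopes) without losing a halving line.

  Flattened copies of such a set (\<^emph>\<open>rows\<close>) are placed near lines through the origin, a balancing
  set on the opposite ray, and points \<open>b\<close> with near-antipodes \<open>-b\<close> fill up the rest. The
  hyperplane through two points of a row and \<open>d - 2\<close> of the points \<open>b\<close> passes close to the
  origin, hence it halves all other rows and all other pairs \<open>b, -b\<close>. By robustness,
  translates of a row interleave to an evenly spaced sequence, which makes the set dense.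
\<close>


section \<open>A planar set with many halving lines and polynomial robustness\<close>

text \<open>Once the rows are flat, distances depend only on the abscissas of the planar set: its
  ordinates may be as fine as one likes, its abscissas must become evenly spaced. The recursion
  gives all members of a progression the same abscissa, so they must be movable. A purely horizontal
  move would throw a point off its lines; hence it moves along a slope \<sigma> that all lines
  through it share up to a small error. With degree D = 8^m, step m multiplies the number of points
  by 6 D and divides the admissible move by a constant times D^2. Both quantities are therefore
  exp(\<Theta>(m^2)), so the move is polynomial in the number of points, while the halving lines per
  point gain (4/3)^m. This is the source of exp(c sqrt(log n)). In space, a constant fraction of the
  n points lies in rows, and every halving pair of a row is combined with \<Theta>(n^(d-2)) choices
  of points b, which gives n^(d-1) (4/3)^m. No quantitative estimate is needed for the flattening:
  it concerns finitely many strict inequalities and takes place for \<delta> tending to 0 from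
  above, followed by a generic perturbation.\<close>

datatype idx = Lft | Rgt | Cl idx nat | Mid idx idx | Anti idx idx

section \<open>Slopes, boxes and elementary estimates\<close>

definition slope :: "('i \<Rightarrow> real) \<Rightarrow> ('i \<Rightarrow> real) \<Rightarrow> 'i \<Rightarrow> 'i \<Rightarrow> real" where
  "slope x y u z = (y u - y z) / (x u - x z)"

definition meets :: "('i \<Rightarrow> real) \<Rightarrow> ('i \<Rightarrow> real) \<Rightarrow> ('i \<Rightarrow> real) \<Rightarrow> ('i \<Rightarrow> real) \<Rightarrow> real
    \<Rightarrow> real \<Rightarrow> real \<Rightarrow> 'i \<Rightarrow> bool" where
  "meets x y \<sigma> w r m b p \<longleftrightarrow>
     (\<exists>h t. \<bar>h\<bar> \<le> r \<and> \<bar>t\<bar> \<le> w p \<and> y p + \<sigma> p * h + t = m * (x p + h) + b)"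

text \<open>A box must contain the whole cluster that replaces its point in the next step. At a fine
  vertex the cluster follows lines whose slopes are within \<open>B * s p\<close> of
  \<open>\<sigma> p\<close> over a horizontal distance below \<open>r\<close>, which explains
  \<open>B * r * s p\<close>.\<close>

definition width :: "'i set \<Rightarrow> ('i \<Rightarrow> real) \<Rightarrow> ('i \<Rightarrow> real) \<Rightarrow> real \<Rightarrow> real \<Rightarrow> 'i \<Rightarrow> real" where
  "width V g s r B p = (if p \<in> V then 3/100 * g p else B * r * s p)"

lemma slope_mult: "x u \<noteq> x z \<Longrightarrow> slope x y u z * (x u - x z) = y u - y z"
  by (simp add: slope_def)

lemma sgn_dominant:
  fixes A X h e :: real
  assumes "\<bar>h\<bar> \<le> \<bar>X\<bar> / 2" "\<bar>e\<bar> < \<bar>A\<bar> * \<bar>X\<bar> / 2"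
  shows "sgn (A * (X + h) + e) = sgn (A * X)" "A * X \<noteq> 0"
proof -
  have "A \<noteq> 0" "X \<noteq> 0" using assms by auto
  thus "A * X \<noteq> 0" by simp
  have "\<bar>A * h\<bar> \<le> \<bar>A\<bar> * (\<bar>X\<bar> / 2)" unfolding abs_mult using assms by (intro mult_left_mono) auto
  hence "\<bar>A * h + e\<bar> < \<bar>A * X\<bar>" using assms(2) abs_triangle_ineq[of "A * h" e] abs_mult[of A X] by simp
  hence "sgn (A * X + (A * h + e)) = sgn (A * X)" by (auto simp: sgn_if)
  thus "sgn (A * (X + h) + e) = sgn (A * X)" by (simp add: algebra_simps)
qed

lemma sum_step_sign:
  fixes K n :: nat
  assumes "K \<le> n"
  shows "(\<Sum>k<n. if k < K then -1 else 1 :: real) = real n - 2 * real K"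
proof -
  have "(\<Sum>k<n. if k < K then -1 else 1 :: real) = (\<Sum>k<n. 1 - (if k < K then 2 else 0))"
    by (intro sum.cong) auto
  also have "\<dots> = real n - (\<Sum>k<n. if k < K then 2 else 0)" by (simp add: sum_subtractf)
  also have "(\<Sum>k<n. if k < K then 2 else 0 :: real) = (\<Sum>k<K. 2)"
    using assms by (intro sum.mono_neutral_cong_right) auto
  finally show ?thesis by simp
qed

lemma solve_signed:
  fixes S d C \<mu> e :: real
  assumes "S * d = C * \<mu> + e" "d \<noteq> 0" "sgn d = \<sigma>" "\<mu> > 0"
  shows "S = \<sigma> * (C + e / \<mu>) * (\<mu> / \<bar>d\<bar>)"
proof -
  have "S = (C * \<mu> + e) / d" using assms by (simp add: field_simps)
  also have "C * \<mu> + e = (C + e / \<mu>) * \<mu>" using assms by (simp add: field_simps)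
  also have "(C + e / \<mu>) * \<mu> / d = \<sigma> * (C + e / \<mu>) * (\<mu> / \<bar>d\<bar>)"
    using assms(2-4) by (cases "d > 0") (auto simp: field_simps)
  finally show ?thesis .
qed

text \<open>
  The box of \<open>p\<close> consists of the points \<open>(x p + h, y p + \<sigma> p * h + t)\<close> with \<open>\<bar>h\<bar> \<le> r\<close> and \<open>\<bar>t\<bar> \<le> width p\<close>;
  the points of a configuration may be moved freely in their boxes. Halving lines join the coarse
  vertices \<open>V\<close> to the fine vertices \<open>Z\<close>. The lines through \<open>z \<in> Z\<close> have slopes of order \<open>s z\<close> apart, and
  \<open>scale\<close> says that they are of order \<open>g u\<close> apart when they arrive at \<open>u \<in> V\<close>.
\<close>

locale halving_config =
  fixes V Z :: "idx set" and E :: "(idx \<times> idx) set"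
    and x y \<sigma> g s :: "idx \<Rightarrow> real" and r B :: real and D :: nat
  assumes finV: "finite V" and finZ: "finite Z" and disj: "V \<inter> Z = {}" and EVZ: "E \<subseteq> V \<times> Z"
    and deg: "\<And>z. z \<in> Z \<Longrightarrow> card {u. (u, z) \<in> E} = D"
    and D1: "D \<ge> 1" and rpos: "r > 0" and B1: "B \<ge> 1"
    and gpos: "\<And>u. u \<in> V \<Longrightarrow> g u > 0" and spos: "\<And>z. z \<in> Z \<Longrightarrow> s z > 0"
    and xr: "\<And>p. p \<in> V \<union> Z \<Longrightarrow> \<bar>x p\<bar> + r \<le> 2"
    and len: "\<And>u z. (u, z) \<in> E \<Longrightarrow> 4 * r \<le> \<bar>x u - x z\<bar>"
    and scale: "\<And>u z. (u, z) \<in> E \<Longrightarrow> g u = s z * \<bar>x u - x z\<bar>"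
    and slV: "\<And>u z. (u, z) \<in> E \<Longrightarrow> r * \<bar>slope x y u z - \<sigma> u\<bar> \<le> g u"
    and slZ: "\<And>u z. (u, z) \<in> E \<Longrightarrow> \<bar>slope x y u z - \<sigma> z\<bar> \<le> B * s z"
    and sep: "\<And>u u' z. (u, z) \<in> E \<Longrightarrow> (u', z) \<in> E \<Longrightarrow> u \<noteq> u' \<Longrightarrow>
                s z / 4 \<le> \<bar>slope x y u z - slope x y u' z\<bar>"
    and robust: "\<And>u z. (u, z) \<in> E \<Longrightarrow> \<exists>\<epsilon> :: idx \<Rightarrow> real.
        sum \<epsilon> (V \<union> Z) = 0 \<and> \<epsilon> u = 0 \<and> \<epsilon> z = 0 \<and> (\<forall>p \<in> V \<union> Z - {u, z}. \<epsilon> p \<noteq> 0) \<and>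
        (\<forall>m b. meets x y \<sigma> (width V g s r B) r m b u \<longrightarrow> meets x y \<sigma> (width V g s r B) r m b z \<longrightarrow>
          (\<forall>p \<in> V \<union> Z - {u, z}. \<forall>h t. \<bar>h\<bar> \<le> r \<longrightarrow> \<bar>t\<bar> \<le> width V g s r B p \<longrightarrow>
             sgn (y p + \<sigma> p * h + t - (m * (x p + h) + b)) = \<epsilon> p))"

text \<open>\<alpha> and \<beta> tell by how many spacings a line passes below the point of height
  \<open>c * \<mu>u\<close> at one end and below its mirror point \<open>- c * \<mu>z\<close> at the
  other end. The height above the old line at the meeting point is the mean of \<open>qz\<close> and
  \<open>qu\<close> with weights \<open>1 - \<rho>\<close> and \<open>\<rho>\<close>; there the
  terms with \<open>c\<close> cancel, since \<open>\<rho> * \<mu>u = (1 - \<rho>) * \<mu>z\<close>.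
  So lowering the meeting point by a quarter spacing fixes \<alpha> + \<beta> near 1/4.\<close>

lemma fan_arith:
  fixes \<rho> \<mu>u \<mu>z c \<alpha> \<beta> e qm a M l qu qz :: real
  assumes \<rho>: "0 < \<rho>" "\<rho> \<le> 1/9" and \<mu>: "\<mu>z > 0" "\<rho> * \<mu>u = (1 - \<rho>) * \<mu>z"
    and qu: "qu = qz + M * l"
    and qm: "qz + M * (\<rho> * l) = - \<mu>z / 4 + e" and e: "\<bar>e\<bar> \<le> 3/100 * \<mu>z"
  defines "\<alpha> \<equiv> c - qu / \<mu>u" and "\<beta> \<equiv> - c - qz / \<mu>z"
  shows "22/100 \<le> \<alpha> + \<beta>" "\<alpha> + \<beta> \<le> 35/100"
proof -
  have \<mu>u: "\<mu>u = (1 - \<rho>) * \<mu>z / \<rho>" using \<rho> \<mu> by (simp add: field_simps)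
  hence \<mu>u0: "\<mu>u > 0" using \<rho> \<mu> by simp
  have 1: "(1 - \<rho>) * qz + \<rho> * qu = - \<mu>z / 4 + e" using qm qu by (simp add: algebra_simps)
  have "qu = (c - \<alpha>) * \<mu>u" "qz = (- c - \<beta>) * \<mu>z"
    unfolding \<alpha>_def \<beta>_def using \<mu>u0 \<mu> by simp_all
  hence "(1 - \<rho>) * ((- c - \<beta>) * \<mu>z) + (c - \<alpha>) * (\<rho> * \<mu>u) = - \<mu>z / 4 + e" using 1
    by (metis mult.left_commute)
  hence "(1 - \<rho>) * \<mu>z * (\<alpha> + \<beta>) = \<mu>z / 4 - e" unfolding \<mu>(2) by (simp add: algebra_simps)
  hence 2: "\<alpha> + \<beta> = (\<mu>z / 4 - e) / ((1 - \<rho>) * \<mu>z)" using \<rho> \<mu> by (simp add: field_simps)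
  have d: "8/9 * \<mu>z \<le> (1 - \<rho>) * \<mu>z" "(1 - \<rho>) * \<mu>z \<le> \<mu>z" "(1 - \<rho>) * \<mu>z > 0" using \<rho> \<mu> by auto
  show "22/100 \<le> \<alpha> + \<beta>" unfolding 2 pos_le_divide_eq[OF d(3)] using d e unfolding abs_le_iff by linarith
  show "\<alpha> + \<beta> \<le> 35/100" unfolding 2 pos_divide_le_eq[OF d(3)] using d e \<mu> unfolding abs_le_iff by linarith
qed


text \<open>The horizontal moves \<open>h\<close> and \<open>h'\<close> multiply the unknown slope
  \<open>M\<close> itself. Together they are at most 1/100 of the lever arm
  \<open>\<bar>d\<bar>\<close>, so their contribution is absorbed on the left.\<close>

lemma slope_dev_bound:
  fixes M d C \<mu> e h h' r' A :: real
  assumes eq: "M * d = C * \<mu> + e - M * h + M * h'" and h: "\<bar>h\<bar> \<le> r'" "\<bar>h'\<bar> \<le> r'"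
    and r': "2 * r' \<le> \<bar>d\<bar> / 100" and e: "\<bar>e\<bar> \<le> 2/5 * \<mu>" and C: "\<bar>C\<bar> \<le> (A - 1) / 2"
    and \<mu>: "\<mu> > 0" and d: "\<bar>d\<bar> > 0"
  shows "\<bar>M\<bar> \<le> A * (\<mu> / \<bar>d\<bar>)"
proof -
  have "\<bar>M\<bar> * \<bar>d\<bar> = \<bar>C * \<mu> + e - M * h + M * h'\<bar>" using eq by (metis abs_mult)
  also have "\<dots> \<le> \<bar>C * \<mu>\<bar> + \<bar>e\<bar> + \<bar>M * h\<bar> + \<bar>M * h'\<bar>" by linarith
  also have "\<bar>C * \<mu>\<bar> \<le> (A - 1) / 2 * \<mu>" unfolding abs_mult using C \<mu> by (simp add: mult_right_mono)
  also have "\<bar>M * h\<bar> \<le> \<bar>M\<bar> * r'" unfolding abs_mult using h by (simp add: mult_left_mono)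
  also have "\<bar>M * h'\<bar> \<le> \<bar>M\<bar> * r'" unfolding abs_mult using h by (simp add: mult_left_mono)
  finally have "\<bar>M\<bar> * \<bar>d\<bar> \<le> (A - 1) / 2 * \<mu> + 2/5 * \<mu> + \<bar>M\<bar> * (2 * r')" using e by linarith
  also have "\<bar>M\<bar> * (2 * r') \<le> \<bar>M\<bar> * (\<bar>d\<bar> / 100)" using r' by (intro mult_left_mono) auto
  finally have 1: "99/100 * (\<bar>M\<bar> * \<bar>d\<bar>) \<le> A * \<mu> / 2 - \<mu> / 10" by (simp add: algebra_simps diff_divide_distrib)
  have A: "A \<ge> 1" using order_trans[OF abs_ge_zero C] by simp
  have "A * \<mu> \<ge> 0" using A \<mu> by simp
  hence "\<bar>M\<bar> * \<bar>d\<bar> \<le> A * \<mu>" using 1 \<mu> by linarith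
  thus ?thesis using d by (simp add: field_simps)
qed

section \<open>One step of the planar construction\<close>

locale halving_step = halving_config +
  fixes a :: nat
  assumes aD: "a = 4 * D" and Ba: "B \<le> real a"
begin

text \<open>
  The vertical spacing is \<open>\<mu> p\<close> in the progression replacing \<open>p\<close>. The lines of the fan at \<open>(u, z)\<close>
  meet where the distances to \<open>u\<close> and \<open>z\<close> are in the ratio \<open>\<mu> u : \<mu> z = \<bar>x u - x z\<bar> : hr\<close>, i.e. at
  \<open>off u z\<close> from \<open>z\<close>. Lowering the meeting point by \<open>\<mu> z / 4\<close> makes each of the two lines through it
  that used to coincide pass just below the far progression point.
\<close>

definition "\<kappa> = 1 / (100 * real a)"
definition "hr = r / 2"
definition "off u z = (x u - x z) * (hr / (\<bar>x u - x z\<bar> + hr))"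
definition "\<mu> p = (if p \<in> V then \<kappa> * g p else \<kappa> * s p * hr)"
definition "c k = real k - real D - (real a - 1) / 2"

primrec x' :: "idx \<Rightarrow> real" where
  "x' Lft = 0" | "x' Rgt = 0" | "x' (Cl p k) = x p"
| "x' (Mid u z) = x z + off u z" | "x' (Anti u z) = x z - off u z"

text \<open>Near \<open>z\<close>, a line of the fan at \<open>(u, z)\<close> stays within
  \<open>3 * a * \<mu> z\<close> of the old line (\<open>line_near\<close>). Lowering
  \<open>Anti u z\<close> by \<open>4 * a * \<mu> z\<close> thus puts it below every line of its own
  fan. This is still only \<open>s z * hr / 25\<close>, too little to change its side with respect
  to the other fans at \<open>z\<close>.\<close>

primrec y' :: "idx \<Rightarrow> real" where
  "y' Lft = 0" | "y' Rgt = 0" | "y' (Cl p k) = y p + c k * \<mu> p"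
| "y' (Mid u z) = y z + slope x y u z * off u z - \<mu> z / 4"
| "y' (Anti u z) = y z - slope x y u z * off u z - 4 * a * \<mu> z"

primrec \<sigma>' :: "idx \<Rightarrow> real" where
  "\<sigma>' Lft = 0" | "\<sigma>' Rgt = 0" | "\<sigma>' (Cl p k) = \<sigma> p"
| "\<sigma>' (Mid u z) = slope x y u z" | "\<sigma>' (Anti u z) = slope x y u z"

primrec g' :: "idx \<Rightarrow> real" where
  "g' Lft = 0" | "g' Rgt = 0" | "g' (Cl p k) = \<mu> p" | "g' (Mid u z) = 0" | "g' (Anti u z) = \<mu> z"

text \<open>The slope subtended at \<open>Mid u z\<close> by one spacing of the progression at
  \<open>z\<close>; by \<open>s'_rest\<close> one spacing at \<open>u\<close> subtends the same
  slope.\<close>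

primrec s' :: "idx \<Rightarrow> real" where
  "s' Lft = 0" | "s' Rgt = 0" | "s' (Cl p k) = 0"
| "s' (Mid u z) = \<mu> z / \<bar>off u z\<bar>" | "s' (Anti u z) = 0"

text \<open>A coarse vertex is replaced by \<open>a + 2 * D\<close> points, a fine one by
  \<open>a\<close> points together with its \<open>D\<close> points \<open>Mid\<close> and
  \<open>D\<close> points \<open>Anti\<close>. All old points thus get the same weight
  \<open>a + 2 * D\<close>, which preserves a zero sum of signs. Both index ranges are symmetric
  about the zero of \<open>c\<close>. Only the points \<open>Mid\<close> are fine in the next
  step.\<close>

definition "V' = (\<lambda>(u, k). Cl u k) ` (V \<times> {..<a + 2 * D})
   \<union> (\<lambda>(z, k). Cl z k) ` (Z \<times> {D..<D + a}) \<union> (\<lambda>(u, z). Anti u z) ` E"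
definition "Z' = (\<lambda>(u, z). Mid u z) ` E"
definition "E' = (\<lambda>((u, z), k). (Cl u k, Mid u z)) ` (E \<times> {D..<D + a})
   \<union> (\<lambda>((u, z), k). (Cl z k, Mid u z)) ` (E \<times> {D..<D + a})"
definition "r' = \<kappa> * r / (1000 * real a)"
abbreviation "w \<equiv> width V g s r B"
abbreviation "w' \<equiv> width V' g' s' r' (real a)"
abbreviation "sl \<equiv> slope x y"

lemma a4: "real a \<ge> 4" using aD D1 by simp
lemma \<kappa>0: "\<kappa> > 0" and hr0: "hr > 0" using a4 rpos by (auto simp: \<kappa>_def hr_def)
lemma \<kappa>a: "\<kappa> * real a = 1/100" using a4 by (simp add: \<kappa>_def)
lemma \<kappa>le: "\<kappa> \<le> 1/400" using a4 by (simp add: \<kappa>_def field_simps)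
lemma r'0: "r' > 0" using \<kappa>0 rpos a4 by (simp add: r'_def)
lemma r'a: "r' * real a = \<kappa> * r / 1000" using a4 by (simp add: r'_def)
lemma r'\<kappa>: "r' \<le> \<kappa> * r / 4000" unfolding r'_def using a4 \<kappa>0 rpos by (intro divide_left_mono) auto
lemma r'r: "r' \<le> r / 1000000"
proof -
  have "\<kappa> * r \<le> 1/400 * r" using \<kappa>le rpos by (intro mult_right_mono) auto
  thus ?thesis using r'\<kappa> rpos by linarith
qed

lemma cmirror: "K < 2 * D + a \<Longrightarrow> c (2 * D + a - 1 - K) = - c K"
  by (simp add: c_def of_nat_diff field_simps)
lemma c_abs: "D \<le> K \<Longrightarrow> K < D + a \<Longrightarrow> \<bar>c K\<bar> \<le> (real a - 1) / 2"
  by (auto simp: c_def abs_le_iff field_simps)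
lemma c_abs': "K < 2 * D + a \<Longrightarrow> \<bar>c K\<bar> \<le> 3/4 * real a"
  unfolding c_def abs_le_iff using aD D1 by (auto simp: field_simps)
lemma c_less: "k < K \<Longrightarrow> c k \<le> c K - 1" by (simp add: c_def)

lemma w'_Cl: "p \<in> V \<Longrightarrow> k < a + 2 * D \<Longrightarrow> w' (Cl p k) = 3/100 * \<mu> p"
    "p \<in> Z \<Longrightarrow> D \<le> k \<Longrightarrow> k < D + a \<Longrightarrow> w' (Cl p k) = 3/100 * \<mu> p"
    "(u, z) \<in> E \<Longrightarrow> w' (Anti u z) = 3/100 * \<mu> z"
    "w' (Mid u z) = real a * r' * s' (Mid u z)"
  by (force simp: width_def V'_def)+

context
  fixes u z assumes e: "(u, z) \<in> E"
begin

lemma uV: "u \<in> V" "z \<in> Z" "u \<notin> Z" "z \<notin> V" "u \<noteq> z" using e EVZ disj by auto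
lemma \<mu>u: "\<mu> u = \<kappa> * s z * \<bar>x u - x z\<bar>" using uV scale[OF e] by (simp add: \<mu>_def)
lemma \<mu>z: "\<mu> z = \<kappa> * s z * hr" using uV by (simp add: \<mu>_def)
lemma length_ge: "8 * hr \<le> \<bar>x u - x z\<bar>" using len[OF e] by (simp add: hr_def)

definition "\<rho> = hr / (\<bar>x u - x z\<bar> + hr)"

lemma \<rho>: "0 < \<rho>" "\<rho> \<le> 1/9" using length_ge hr0 by (auto simp: \<rho>_def field_simps)
lemma off\<rho>: "off u z = \<rho> * (x u - x z)" by (simp add: off_def \<rho>_def)
lemma \<mu>0: "\<mu> u > 0" "\<mu> z > 0" using \<mu>u \<mu>z \<kappa>0 hr0 spos[OF uV(2)] length_ge by auto
text \<open>This makes the fan concurrent: raising the end at \<open>u\<close> by some number of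
  spacings and lowering the end at \<open>z\<close> by the same number does not move the point at
  the fraction \<rho> of the way from \<open>z\<close> to \<open>u\<close>.\<close>

lemma \<mu>\<rho>: "\<rho> * \<mu> u = (1 - \<rho>) * \<mu> z"
proof -
  have "\<bar>x u - x z\<bar> + hr > 0" using hr0 by simp
  thus ?thesis unfolding \<mu>u \<mu>z \<rho>_def by (simp add: field_simps)
qed
lemma \<mu>8: "8 * \<mu> z \<le> \<mu> u"
proof -
  have "\<rho> * \<mu> u \<ge> 8/9 * \<mu> z" unfolding \<mu>\<rho> using \<rho> \<mu>0 by (intro mult_right_mono) auto
  moreover have "\<rho> * \<mu> u \<le> 1/9 * \<mu> u" using \<rho> \<mu>0 by (intro mult_right_mono) auto
  ultimately show ?thesis by linarith
qed
lemma off_abs: "8/9 * hr \<le> \<bar>off u z\<bar>" "\<bar>off u z\<bar> \<le> hr"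
proof -
  have p: "\<bar>x u - x z\<bar> + hr > 0" using hr0 by simp
  have "\<bar>off u z\<bar> = hr * (\<bar>x u - x z\<bar> / (\<bar>x u - x z\<bar> + hr))" using p hr0 by (simp add: off_def abs_mult)
  moreover have "8/9 \<le> \<bar>x u - x z\<bar> / (\<bar>x u - x z\<bar> + hr)" "\<bar>x u - x z\<bar> / (\<bar>x u - x z\<bar> + hr) \<le> 1"
    using p length_ge hr0 by (auto simp: field_simps)
  ultimately show "8/9 * hr \<le> \<bar>off u z\<bar>" "\<bar>off u z\<bar> \<le> hr"
    using mult_left_mono[of "8/9" "\<bar>x u - x z\<bar> / (\<bar>x u - x z\<bar> + hr)" hr]
      mult_left_mono[of "\<bar>x u - x z\<bar> / (\<bar>x u - x z\<bar> + hr)" 1 hr] hr0 by linarith+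
qed
lemma off0: "\<bar>off u z\<bar> > 0" using off_abs hr0 by linarith
lemma s'0: "s' (Mid u z) > 0" using off0 \<mu>0 by simp
lemma rest: "\<bar>x u - x z - off u z\<bar> = (1 - \<rho>) * \<bar>x u - x z\<bar>"
proof -
  have "x u - x z - off u z = (1 - \<rho>) * (x u - x z)" by (simp add: off\<rho> algebra_simps)
  thus ?thesis using \<rho> by (simp add: abs_mult)
qed
lemma rest_ge: "\<bar>x u - x z - off u z\<bar> \<ge> 7 * hr"
proof -
  have "8/9 * (8 * hr) \<le> (1 - \<rho>) * \<bar>x u - x z\<bar>" using \<rho> length_ge hr0 by (intro mult_mono) auto
  thus ?thesis using rest hr0 by linarith
qed
text \<open>Seen from the meeting point, the spacings at both ends subtend equal angles. Hence a
  single scale \<open>s'\<close> serves both halves of the fan, as \<open>scale\<close> demands in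
  the next step.\<close>

lemma s'_rest: "s' (Mid u z) = \<mu> u / \<bar>x u - x z - off u z\<bar>"
proof -
  have "\<bar>x u - x z\<bar> > 0" using length_ge hr0 by linarith
  moreover have "\<mu> z * ((1 - \<rho>) * \<bar>x u - x z\<bar>) = \<mu> u * (\<rho> * \<bar>x u - x z\<bar>)"
    using arg_cong[OF \<mu>\<rho>, of "\<lambda>t. t * \<bar>x u - x z\<bar>"] by (simp only: mult_ac)
  ultimately have "\<mu> z / (\<rho> * \<bar>x u - x z\<bar>) = \<mu> u / ((1 - \<rho>) * \<bar>x u - x z\<bar>)"
    using \<rho> by (subst frac_eq_eq) auto
  thus ?thesis unfolding rest using \<rho> by (simp add: off\<rho> abs_mult)
qed
lemma slope_eq: "sl u z * (x u - x z) = y u - y z" using length_ge hr0 by (auto simp: slope_def)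

lemma w'_Mid: "w' (Mid u z) \<le> \<mu> z / 100" and r'as': "r' * (real a * s' (Mid u z)) \<le> \<mu> z / 100"
proof -
  have "r' * (real a * s' (Mid u z)) = (r' * real a) / \<bar>off u z\<bar> * \<mu> z" by simp
  also have "\<dots> = (\<kappa> * r / 1000) / \<bar>off u z\<bar> * \<mu> z" unfolding r'a ..
  also have "(\<kappa> * r / 1000) / \<bar>off u z\<bar> \<le> 1 / 100"
  proof -
    have "\<kappa> * r \<le> 1/400 * r" using \<kappa>le rpos by (intro mult_right_mono) auto
    hence "\<kappa> * r / 1000 \<le> 1/100 * \<bar>off u z\<bar>" using off_abs rpos unfolding hr_def by linarith
    thus ?thesis using off0 by (simp only: pos_divide_le_eq)
  qed
  hence "(\<kappa> * r / 1000) / \<bar>off u z\<bar> * \<mu> z \<le> 1/100 * \<mu> z" using \<mu>0 by (intro mult_right_mono) auto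
  finally show "r' * (real a * s' (Mid u z)) \<le> \<mu> z / 100" by simp
  thus "w' (Mid u z) \<le> \<mu> z / 100" by (simp only: w'_Cl mult_ac)
qed

lemma Mh_bound: "\<bar>M\<bar> \<le> real a * s' (Mid u z) \<Longrightarrow> \<bar>h\<bar> \<le> r' \<Longrightarrow> \<bar>M * h\<bar> \<le> \<mu> z / 100"
proof -
  assume M: "\<bar>M\<bar> \<le> real a * s' (Mid u z)" and h: "\<bar>h\<bar> \<le> r'"
  have "\<bar>M * h\<bar> \<le> (real a * s' (Mid u z)) * r'" unfolding abs_mult
    using M h less_imp_le[OF s'0] by (intro mult_mono mult_nonneg_nonneg) auto
  thus ?thesis using r'as' by (simp only: mult_ac)
qed

lemma r'slV: "r' * \<bar>sl u z - \<sigma> u\<bar> \<le> \<mu> u / 1000"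
proof -
  have "\<kappa> * r > 0" using \<kappa>0 rpos by simp
  hence "r' \<le> \<kappa> * r / 1000" using r'\<kappa> by linarith
  hence "r' * \<bar>sl u z - \<sigma> u\<bar> \<le> \<kappa> * r / 1000 * \<bar>sl u z - \<sigma> u\<bar>" by (intro mult_right_mono) auto
  also have "\<dots> = \<kappa> / 1000 * (r * \<bar>sl u z - \<sigma> u\<bar>)" by simp
  also have "\<dots> \<le> \<kappa> / 1000 * g u" using slV[OF e] \<kappa>0 by (intro mult_left_mono) auto
  finally show ?thesis using uV by (simp add: \<mu>_def)
qed

lemma r'slZ: "r' * \<bar>sl u z - \<sigma> z\<bar> \<le> \<mu> z / 100"
proof -
  have s0: "s z > 0" using spos uV by simp
  have "r' * \<bar>sl u z - \<sigma> z\<bar> \<le> r' * (B * s z)" using slZ[OF e] r'0 by (intro mult_left_mono) auto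
  also have "\<dots> \<le> r' * (real a * s z)" using Ba s0 r'0 by (intro mult_left_mono mult_right_mono) auto
  also have "\<dots> = \<kappa> * r / 1000 * s z" using r'a by (simp add: mult.assoc[symmetric])
  also have "\<dots> = \<mu> z / 500" by (simp add: \<mu>z hr_def)
  finally show ?thesis using \<mu>0 by simp
qed

lemma mid_eq:
  assumes mid: "meets x' y' \<sigma>' w' r' m b (Mid u z)"
  obtains h t where "\<bar>h\<bar> \<le> r'" "\<bar>t\<bar> \<le> \<mu> z / 100"
    "m * x z + b - y z + (m - sl u z) * off u z = - \<mu> z / 4 + t - (m - sl u z) * h"
proof -
  from mid obtain h t where h: "\<bar>h\<bar> \<le> r'" "\<bar>t\<bar> \<le> w' (Mid u z)"
    "y' (Mid u z) + \<sigma>' (Mid u z) * h + t = m * (x' (Mid u z) + h) + b" unfolding meets_def by blast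
  show thesis by (rule that[of h t]) (use h w'_Mid in \<open>auto simp: algebra_simps\<close>)
qed

text \<open>Hitting the box of \<open>p\<close> makes the defect at that end at most 1/20 in
  modulus. By \<open>fan_arith\<close> both defects add up to between 22/100 and 35/100, so the line
  passes at least 17/100 of a spacing below the mirror point at the other end. The gap between
  17/100 and the box heights is what makes the step robust.\<close>

lemma fan_line:
  assumes K: "D \<le> K" "K < D + a" and mid: "meets x' y' \<sigma>' w' r' m b (Mid u z)"
    and hit: "p = Cl u K \<or> p = Cl z (2 * D + a - 1 - K)" "meets x' y' \<sigma>' w' r' m b p"
  obtains \<alpha> \<beta> where "m * x u + b - y u = (c K - \<alpha>) * \<mu> u" "m * x z + b - y z = (- c K - \<beta>) * \<mu> z"
    "\<bar>m - sl u z\<bar> \<le> real a * s' (Mid u z)"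
    "-1/20 \<le> \<alpha>" "\<alpha> \<le> 2/5" "-1/20 \<le> \<beta>" "\<beta> \<le> 2/5" "p \<noteq> Cl u K \<Longrightarrow> \<alpha> \<ge> 17/100" "p = Cl u K \<Longrightarrow> \<beta> \<ge> 17/100"
proof -
  \<comment> \<open>All heights are measured from the old line through \<open>u\<close> and
    \<open>z\<close>, or from its ends: \<open>M\<close> is the excess of slope, \<open>qu\<close>
    and \<open>qz\<close> are the excesses at both ends.\<close>
  define M where "M = m - sl u z"
  define qu where "qu = m * x u + b - y u"
  define qz where "qz = m * x z + b - y z"
  have qu: "qu = qz + M * (x u - x z)" using slope_eq by (simp add: qu_def qz_def M_def algebra_simps)
  obtain h' t' where h': "\<bar>h'\<bar> \<le> r'" "\<bar>t'\<bar> \<le> \<mu> z / 100"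
    "qz + M * off u z = - \<mu> z / 4 + t' - M * h'"
    using mid_eq[OF mid] unfolding M_def qz_def by metis
  have r'off: "2 * r' \<le> \<bar>off u z\<bar> / 100" "2 * r' \<le> \<bar>x u - x z - off u z\<bar> / 100"
    using off_abs rest_ge r'r rpos by (auto simp: hr_def)
  have cK: "\<bar>c K\<bar> \<le> (real a - 1) / 2" using c_abs K by simp
  have neq: "p = Cl u K \<longleftrightarrow> p \<noteq> Cl z (2 * D + a - 1 - K)" using hit uV by auto
  have main: "\<bar>M\<bar> \<le> real a * s' (Mid u z) \<and>
      (if p = Cl u K then \<bar>qu - c K * \<mu> u\<bar> \<le> \<mu> u / 20 else \<bar>qz + c K * \<mu> z\<bar> \<le> \<mu> z / 20)"
  proof (cases "p = Cl u K")
    case True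
    from hit(2) True obtain h t where h: "\<bar>h\<bar> \<le> r'" "\<bar>t\<bar> \<le> w' (Cl u K)"
      "y u + c K * \<mu> u + \<sigma> u * h + t = m * (x u + h) + b" unfolding meets_def by auto
    have t: "\<bar>t\<bar> \<le> 3/100 * \<mu> u" using h w'_Cl(1)[of u K] K uV by simp
    have d: "\<bar>(\<sigma> u - sl u z) * h\<bar> \<le> \<mu> u / 1000"
    proof -
      have "\<bar>(\<sigma> u - sl u z) * h\<bar> = \<bar>h\<bar> * \<bar>sl u z - \<sigma> u\<bar>" by (simp add: abs_mult abs_minus_commute)
      also have "\<dots> \<le> r' * \<bar>sl u z - \<sigma> u\<bar>" using h by (intro mult_right_mono) auto
      finally show ?thesis using r'slV by linarith
    qed
    have q: "qu = c K * \<mu> u + t + (\<sigma> u - sl u z) * h - M * h"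
      using h(3) by (simp add: qu_def M_def algebra_simps)
    \<comment> \<open>Comparing the incidence at \<open>u\<close> with that at the meeting point
      isolates \<open>M\<close>; the moves bring \<open>M\<close> back on the right-hand
      side.\<close>
    have "M * (x u - x z - off u z) = c K * \<mu> u + (t + (\<sigma> u - sl u z) * h + \<mu> z / 4 - t') - M * h + M * h'"
      using qu h'(3) q by (simp add: algebra_simps)
    hence M: "\<bar>M\<bar> \<le> real a * (\<mu> u / \<bar>x u - x z - off u z\<bar>)"
    proof (rule slope_dev_bound[where r' = r'])
      show "\<bar>t + (\<sigma> u - sl u z) * h + \<mu> z / 4 - t'\<bar> \<le> 2 / 5 * \<mu> u"
        using t d h'(2) \<mu>8 \<mu>0 unfolding abs_le_iff by linarith
    qed (use h h' r'off cK \<mu>0 rest_ge hr0 in auto)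
    hence M: "\<bar>M\<bar> \<le> real a * s' (Mid u z)" unfolding s'_rest .
    have "\<bar>M * h\<bar> \<le> \<mu> z / 100" using Mh_bound[OF M h(1)] .
    thus ?thesis using M True q t d \<mu>8 \<mu>0 unfolding abs_le_iff by auto
  next
    case False
    with hit(2) neq obtain h t where h: "\<bar>h\<bar> \<le> r'" "\<bar>t\<bar> \<le> w' (Cl z (2 * D + a - 1 - K))"
      "y z + c (2 * D + a - 1 - K) * \<mu> z + \<sigma> z * h + t = m * (x z + h) + b" unfolding meets_def by auto
    have "D \<le> 2 * D + a - 1 - K" "2 * D + a - 1 - K < D + a" using K D1 by arith+
    hence t: "\<bar>t\<bar> \<le> 3/100 * \<mu> z" using h(2) w'_Cl(2)[of z "2 * D + a - 1 - K"] uV by simp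
    have d: "\<bar>(\<sigma> z - sl u z) * h\<bar> \<le> \<mu> z / 100"
    proof -
      have "\<bar>(\<sigma> z - sl u z) * h\<bar> = \<bar>h\<bar> * \<bar>sl u z - \<sigma> z\<bar>" by (simp add: abs_mult abs_minus_commute)
      also have "\<dots> \<le> r' * \<bar>sl u z - \<sigma> z\<bar>" using h by (intro mult_right_mono) auto
      finally show ?thesis using r'slZ by linarith
    qed
    have cm: "c (2 * D + a - 1 - K) = - c K" using cmirror K by simp
    have q: "qz = - c K * \<mu> z + t + (\<sigma> z - sl u z) * h - M * h"
      using h(3) unfolding cm by (simp add: qz_def M_def algebra_simps)
    have "M * (- off u z) = (- c K) * \<mu> z + (t + (\<sigma> z - sl u z) * h + \<mu> z / 4 - t') - M * h + M * h'"
      using h'(3) q by (simp add: algebra_simps)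
    hence M: "\<bar>M\<bar> \<le> real a * (\<mu> z / \<bar>- off u z\<bar>)"
    proof (rule slope_dev_bound[where r' = r'])
      show "\<bar>t + (\<sigma> z - sl u z) * h + \<mu> z / 4 - t'\<bar> \<le> 2 / 5 * \<mu> z"
        using t d h'(2) \<mu>0 unfolding abs_le_iff by linarith
    qed (use h h' r'off cK \<mu>0 off0 in auto)
    hence M: "\<bar>M\<bar> \<le> real a * s' (Mid u z)" by simp
    have "\<bar>M * h\<bar> \<le> \<mu> z / 100" using Mh_bound[OF M h(1)] .
    thus ?thesis using M False q t d \<mu>0 unfolding abs_le_iff by auto
  qed
  have Mh': "\<bar>M * h'\<bar> \<le> \<mu> z / 100" using Mh_bound main h' by blast
  define \<alpha> where "\<alpha> = c K - qu / \<mu> u"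
  define \<beta> where "\<beta> = - c K - qz / \<mu> z"
  have sum: "22/100 \<le> \<alpha> + \<beta>" "\<alpha> + \<beta> \<le> 35/100" unfolding \<alpha>_def \<beta>_def
    using fan_arith[OF \<rho> \<mu>0(2) \<mu>\<rho> qu, of "t' - M * h'" "c K"] h'(2,3) Mh' off\<rho>
    unfolding abs_le_iff by auto
  have q: "qu = (c K - \<alpha>) * \<mu> u" "qz = (- c K - \<beta>) * \<mu> z" using \<mu>0 by (auto simp: \<alpha>_def \<beta>_def)
  have A: "p = Cl u K \<Longrightarrow> \<bar>\<alpha>\<bar> \<le> 1/20"
  proof -
    assume "p = Cl u K"
    hence "\<bar>\<alpha>\<bar> * \<mu> u \<le> 1/20 * \<mu> u" using main q \<mu>0 by (simp add: abs_mult algebra_simps)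
    thus ?thesis using \<mu>0 by (simp only: mult_le_cancel_right_pos)
  qed
  have Bb: "p \<noteq> Cl u K \<Longrightarrow> \<bar>\<beta>\<bar> \<le> 1/20"
  proof -
    assume "p \<noteq> Cl u K"
    hence "\<bar>\<beta>\<bar> * \<mu> z \<le> 1/20 * \<mu> z" using main q \<mu>0 by (simp add: abs_mult algebra_simps)
    thus ?thesis using \<mu>0 by (simp only: mult_le_cancel_right_pos)
  qed
  have rng: "-1/20 \<le> \<alpha> \<and> \<alpha> \<le> 2/5 \<and> -1/20 \<le> \<beta> \<and> \<beta> \<le> 2/5"
    using A Bb sum unfolding abs_le_iff by (cases "p = Cl u K") auto
  show thesis
    by (rule that[of \<alpha> \<beta>]) (use q main A Bb sum rng in \<open>auto simp: qu_def qz_def M_def abs_le_iff\<close>)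
qed

lemma \<mu>z_s: "real a * \<mu> z = s z * hr / 100"
proof -
  have "real a * \<mu> z = (\<kappa> * real a) * (s z * hr)" by (simp add: \<mu>z)
  thus ?thesis by (simp add: \<kappa>a)
qed

lemma \<mu>_le_a: "\<mu> z \<le> real a * \<mu> z"
  using mult_right_mono[of 1 "real a" "\<mu> z"] a4 \<mu>0 by auto

lemma \<mu>u_g: "real a * \<mu> u = g u / 100"
proof -
  have "real a * \<mu> u = (\<kappa> * real a) * g u" using uV by (simp add: \<mu>_def)
  thus ?thesis by (simp add: \<kappa>a)
qed

text \<open>Over the cluster of \<open>z\<close>, a line of the fan is indistinguishable from the
  old line at the scale \<open>s z * hr\<close> on which different fans at \<open>z\<close>
  separate, because \<open>a * \<mu> z\<close> is only \<open>s z * hr / 100\<close>.\<close>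

lemma line_near:
  assumes M: "\<bar>m - sl u z\<bar> \<le> real a * s' (Mid u z)" and qz: "m * x z + b - y z = (- c K - \<beta>) * \<mu> z"
    and K: "D \<le> K" "K < D + a" and \<beta>: "-1/20 \<le> \<beta>" "\<beta> \<le> 2/5" and X: "\<bar>X\<bar> \<le> 101/100 * hr"
  shows "\<bar>m * (x z + X) + b - (y z + sl u z * X)\<bar> \<le> 3 * real a * \<mu> z"
proof -
  have "\<bar>c K\<bar> \<le> (real a - 1) / 2" using c_abs K by simp
  hence "\<bar>- c K - \<beta>\<bar> \<le> real a / 2" using \<beta> unfolding abs_le_iff by (auto simp: field_simps)
  hence 1: "\<bar>(- c K - \<beta>) * \<mu> z\<bar> \<le> real a / 2 * \<mu> z" unfolding abs_mult using \<mu>0 by (simp add: mult_right_mono)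
  have "s' (Mid u z) * \<bar>X\<bar> \<le> 2 * \<mu> z"
  proof -
    have "\<bar>X\<bar> \<le> 2 * \<bar>off u z\<bar>" using X off_abs hr0 by linarith
    hence "\<mu> z * \<bar>X\<bar> \<le> \<mu> z * (2 * \<bar>off u z\<bar>)" using \<mu>0 by (intro mult_left_mono) auto
    thus ?thesis using off0 by (simp add: field_simps)
  qed
  hence "real a * (s' (Mid u z) * \<bar>X\<bar>) \<le> real a * (2 * \<mu> z)" by (intro mult_left_mono) auto
  moreover have "\<bar>(m - sl u z) * X\<bar> \<le> real a * s' (Mid u z) * \<bar>X\<bar>" unfolding abs_mult using M by (intro mult_right_mono) auto
  ultimately have 2: "\<bar>(m - sl u z) * X\<bar> \<le> 2 * real a * \<mu> z" by (simp only: mult_ac)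
  have "m * (x z + X) + b - (y z + sl u z * X) = (- c K - \<beta>) * \<mu> z + (m - sl u z) * X"
    using qz by (simp add: algebra_simps)
  moreover have "real a * \<mu> z > 0" using a4 \<mu>0 by simp
  ultimately show ?thesis using 1 2 by linarith
qed

lemma s'rest: "sgn (x u - x z - off u z) = sgn (off u z)"
proof -
  have "x u - x z - off u z = (1 - \<rho>) * (x u - x z)" "off u z = \<rho> * (x u - x z)"
    by (simp_all add: off\<rho> algebra_simps)
  thus ?thesis using \<rho> by (simp add: sgn_mult)
qed

text \<open>In units of \<open>s'\<close> and up to a common sign, the slopes of the fan are
  \<open>c k\<close> plus a tiny positive number for the points at \<open>u\<close>, and
  \<open>- c k - 1/4\<close> for those at \<open>z\<close> (\<open>slope_Z\<close>). Without the
  lowering, the slope of index \<open>k\<close> at \<open>u\<close> would equal that of the mirror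
  index at \<open>z\<close>.\<close>

lemma slope_U: "slope x' y' (Cl u k) (Mid u z) - sl u z = sgn (off u z) * (c k + \<mu> z / (4 * \<mu> u)) * s' (Mid u z)"
proof -
  have n: "x u - x z - off u z \<noteq> 0" using rest_ge hr0 by auto
  have "(slope x' y' (Cl u k) (Mid u z) - sl u z) * (x u - x z - off u z) = c k * \<mu> u + \<mu> z / 4"
    using slope_eq slope_mult[of x' "Cl u k" "Mid u z" y'] n by (simp add: algebra_simps)
  from solve_signed[OF this n s'rest \<mu>0(1)] show ?thesis unfolding s'_rest by simp
qed

lemma slope_Z: "slope x' y' (Cl z k) (Mid u z) - sl u z = - sgn (off u z) * (c k + 1 / 4) * s' (Mid u z)"
proof -
  have n: "off u z \<noteq> 0" using off0 by auto
  have "(slope x' y' (Cl z k) (Mid u z) - sl u z) * (- off u z) = c k * \<mu> z + \<mu> z / 4"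
    using slope_mult[of x' "Cl z k" "Mid u z" y'] n by (simp add: algebra_simps)
  from solve_signed[OF this _ sgn_minus \<mu>0(2)] n \<mu>0 show ?thesis by simp
qed

lemma slope_bounds:
  assumes "D \<le> k" "k < D + a"
  shows "\<bar>slope x' y' (Cl u k) (Mid u z) - sl u z\<bar> \<le> real a * s' (Mid u z)"
    "\<bar>slope x' y' (Cl z k) (Mid u z) - sl u z\<bar> \<le> real a * s' (Mid u z)"
proof -
  have c: "\<bar>c k\<bar> \<le> (real a - 1) / 2" using c_abs assms by simp
  have \<tau>: "0 < \<mu> z / (4 * \<mu> u)" "\<mu> z / (4 * \<mu> u) \<le> 1/32" using \<mu>0 \<mu>8 by (auto simp: field_simps)
  have 1: "\<bar>c k + \<mu> z / (4 * \<mu> u)\<bar> \<le> real a" "\<bar>c k + 1/4\<bar> \<le> real a" using c \<tau> unfolding abs_le_iff by auto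
  have sgn1: "\<bar>sgn (off u z)\<bar> = 1" using off0 by (simp add: abs_sgn_eq)
  show "\<bar>slope x' y' (Cl u k) (Mid u z) - sl u z\<bar> \<le> real a * s' (Mid u z)"
    unfolding slope_U abs_mult sgn1 using 1 s'0 by (simp only: mult_1 abs_of_pos mult_right_mono less_imp_le)
  show "\<bar>slope x' y' (Cl z k) (Mid u z) - sl u z\<bar> \<le> real a * s' (Mid u z)"
    unfolding slope_Z abs_mult abs_minus sgn1 using 1 s'0 by (simp only: mult_1 abs_of_pos mult_right_mono less_imp_le)
qed

lemma slope_sep:
  assumes P: "P \<in> {Cl u k, Cl z k}" and Q: "Q \<in> {Cl u l, Cl z l}" and ne: "P \<noteq> Q"
    and k: "D \<le> k" "k < D + a" and l: "D \<le> l" "l < D + a"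
  shows "s' (Mid u z) / 4 \<le> \<bar>slope x' y' P (Mid u z) - slope x' y' Q (Mid u z)\<bar>"
proof -
  define \<tau> where "\<tau> = \<mu> z / (4 * \<mu> u)"
  have \<tau>: "0 < \<tau>" "\<tau> \<le> 1/32" using \<mu>0 \<mu>8 by (auto simp: \<tau>_def field_simps)
  have kl: "k < l \<Longrightarrow> c k \<le> c l - 1" "l < k \<Longrightarrow> c l \<le> c k - 1" for k l using c_less by auto
  \<comment> \<open>Slopes from different ends differ by \<open>c k + c l\<close> plus a number
    between 1/4 and 9/32. As \<open>c k + c l\<close> is an integer, although \<open>c k\<close>
    itself is a half-integer for even \<open>a\<close>, the difference is at least 1/4 in
    modulus.\<close>
  have int: "c i + c j \<ge> 0 \<or> c i + c j \<le> -1" for i j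
  proof -
    have "c i + c j = of_int (int i + int j - 2 * int D - int a + 1)" by (simp add: c_def)
    moreover have "N \<ge> 0 \<or> N \<le> -1" for N :: int by linarith
    ultimately show ?thesis by (metis of_int_0_le_iff of_int_le_iff of_int_minus of_int_1)
  qed
  define w where "w P = (if P = Cl u k then c k + \<tau> else if P = Cl u l then c l + \<tau> else
       if P = Cl z k then - c k - 1/4 else - c l - 1/4)" for P
  have wU: "slope x' y' (Cl u j) (Mid u z) - sl u z = sgn (off u z) * (c j + \<tau>) * s' (Mid u z)" for j
    using slope_U unfolding \<tau>_def .
  have wZ: "slope x' y' (Cl z j) (Mid u z) - sl u z = sgn (off u z) * (- c j - 1/4) * s' (Mid u z)" for j
    using slope_Z[of j] by (simp add: algebra_simps)
  have w: "slope x' y' R (Mid u z) - sl u z = sgn (off u z) * w R * s' (Mid u z)" if "R = P \<or> R = Q" for R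
    using that P Q uV(5) by (auto simp: w_def wU wZ)
  have sgn1: "\<bar>sgn (off u z)\<bar> = 1" using off0 by (simp add: abs_sgn_eq)
  have "1/4 \<le> \<bar>w P - w Q\<bar>"
    using P Q ne \<tau> kl[of k l] kl[of l k] int[of k l] int[of k k] int[of l l] int[of l k] uV(5) unfolding w_def
    by (cases k l rule: linorder_cases) (auto split: if_splits)
  hence "1/4 * s' (Mid u z) \<le> \<bar>w P - w Q\<bar> * s' (Mid u z)" by (rule mult_right_mono[OF _ less_imp_le[OF s'0]])
  also have "\<dots> = \<bar>sgn (off u z) * (w P - w Q) * s' (Mid u z)\<bar>" unfolding abs_mult sgn1 using s'0 by (simp only: abs_of_pos mult_1)
  also have "sgn (off u z) * (w P - w Q) * s' (Mid u z) = slope x' y' P (Mid u z) - slope x' y' Q (Mid u z)"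
    using w[of P] w[of Q] by (simp add: algebra_simps)
  finally show ?thesis by simp
qed

end

section \<open>The side of a new line on which each new point lies\<close>

primrec parent :: "idx \<Rightarrow> idx" where
  "parent Lft = Lft" | "parent Rgt = Rgt" | "parent (Cl p k) = p" | "parent (Mid u z) = z" | "parent (Anti u z) = z"

text \<open>The box of a new point lies in the box of the point it came from. A line that hits new
  boxes therefore hits old ones, and all clusters away from \<open>u\<close> and \<open>z\<close>
  inherit the old signs without further estimates.\<close>

lemma box_nested:
  assumes p': "p' \<in> V' \<union> Z'" and h: "\<bar>h\<bar> \<le> r'" and t: "\<bar>t\<bar> \<le> w' p'"
  obtains h2 t2 where "\<bar>h2\<bar> \<le> r" "\<bar>t2\<bar> \<le> w (parent p')" "x' p' + h = x (parent p') + h2"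
    "y' p' + \<sigma>' p' * h + t = y (parent p') + \<sigma> (parent p') * h2 + t2"
proof -
  have hr': "\<bar>h\<bar> \<le> r" using h r'r rpos by linarith
  consider (CV) p k where "p \<in> V" "k < a + 2 * D" "p' = Cl p k"
    | (CZ) p k where "p \<in> Z" "D \<le> k" "k < D + a" "p' = Cl p k"
    | (A) u z where "(u, z) \<in> E" "p' = Anti u z"
    | (M) u z where "(u, z) \<in> E" "p' = Mid u z"
    using p' unfolding V'_def Z'_def by auto
  thus thesis
  proof cases
    case CV
    have g: "g p > 0" using gpos CV by simp
    have \<mu>: "\<mu> p = \<kappa> * g p" using CV by (simp add: \<mu>_def)
    have \<mu>p: "\<mu> p > 0" using \<mu> g \<kappa>0 by simp
    have "real a * \<mu> p = (\<kappa> * real a) * g p" using \<mu> by simp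
    hence a\<mu>: "real a * \<mu> p = g p / 100" by (simp add: \<kappa>a)
    have "\<bar>c k * \<mu> p\<bar> \<le> 3/4 * real a * \<mu> p" unfolding abs_mult
      using c_abs'[of k] CV \<mu>p by (simp add: mult_right_mono add.commute)
    moreover have "\<bar>t\<bar> \<le> 3/100 * \<mu> p" using t CV w'_Cl(1) by simp
    moreover have "\<mu> p \<le> real a * \<mu> p" using a4 \<mu>p by simp
    ultimately have "\<bar>c k * \<mu> p + t\<bar> \<le> 3/100 * g p" using a\<mu> g unfolding abs_le_iff by linarith
    thus ?thesis by (intro that[of h "c k * \<mu> p + t"]) (use hr' CV in \<open>auto simp: width_def\<close>)
  next
    case CZ
    have pV: "p \<notin> V" using CZ disj by auto
    have s0: "s p > 0" using spos CZ by simp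
    have \<mu>: "\<mu> p = \<kappa> * s p * hr" using pV by (simp add: \<mu>_def)
    have \<mu>p: "\<mu> p > 0" using \<mu> s0 \<kappa>0 hr0 by simp
    have "real a * \<mu> p = (\<kappa> * real a) * (s p * hr)" using \<mu> by simp
    hence a\<mu>: "real a * \<mu> p = s p * r / 200" by (simp add: \<kappa>a hr_def)
    have "\<bar>c k * \<mu> p\<bar> \<le> 3/4 * real a * \<mu> p" unfolding abs_mult
      using c_abs'[of k] CZ \<mu>p by (simp add: mult_right_mono add.commute)
    moreover have "\<bar>t\<bar> \<le> 3/100 * \<mu> p" using t CZ w'_Cl(2) by simp
    moreover have "\<mu> p \<le> real a * \<mu> p" using a4 \<mu>p by simp
    moreover have "s p * r \<le> B * (s p * r)" "s p * r > 0" using B1 s0 rpos by auto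
    ultimately have "\<bar>c k * \<mu> p + t\<bar> \<le> B * (s p * r)" using a\<mu> unfolding abs_le_iff by linarith
    thus ?thesis by (intro that[of h "c k * \<mu> p + t"]) (use hr' CZ pV in \<open>auto simp: width_def mult_ac\<close>)
  next
    case M
    note uV = uV[OF M(1)]
    have s0: "s z > 0" using spos uV by simp
    have e51: "(B * s z) * (51/100 * r) = 51/100 * (B * (s z * r))" by simp
    have oh: "\<bar>off u z + h\<bar> \<le> 51/100 * r" using off_abs[OF M(1)] h r'r rpos unfolding hr_def by linarith
    have "\<bar>(sl u z - \<sigma> z) * (off u z + h)\<bar> \<le> (B * s z) * (51/100 * r)"
      unfolding abs_mult using slZ[OF M(1)] oh B1 s0 by (intro mult_mono) auto
    moreover have "\<bar>t\<bar> \<le> \<mu> z / 100" using t M w'_Mid[OF M(1)] by simp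
    moreover have "\<mu> z \<le> s z * r / 200"
      using \<mu>z_s[OF M(1)] \<mu>_le_a[OF M(1)] unfolding hr_def by linarith
    moreover have "s z * r \<le> B * (s z * r)" "s z * r > 0" using B1 s0 rpos by auto
    ultimately have "\<bar>(sl u z - \<sigma> z) * (off u z + h) - \<mu> z / 4 + t\<bar> \<le> B * (s z * r)"
      using \<mu>0[OF M(1)] e51 unfolding abs_le_iff by linarith
    thus ?thesis by (intro that[of "off u z + h" "(sl u z - \<sigma> z) * (off u z + h) - \<mu> z / 4 + t"])
       (use oh M rpos uV in \<open>auto simp: width_def algebra_simps\<close>)
  next
    case A
    note uV = uV[OF A(1)]
    have s0: "s z > 0" using spos uV by simp
    have e51: "(B * s z) * (51/100 * r) = 51/100 * (B * (s z * r))" by simp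
    have oh: "\<bar>- off u z + h\<bar> \<le> 51/100 * r" using off_abs[OF A(1)] h r'r rpos unfolding hr_def by linarith
    have "\<bar>(sl u z - \<sigma> z) * (- off u z + h)\<bar> \<le> (B * s z) * (51/100 * r)"
      unfolding abs_mult using slZ[OF A(1)] oh B1 s0 by (intro mult_mono) auto
    moreover have "\<bar>t\<bar> \<le> 3/100 * \<mu> z" using t A w'_Cl(3) by simp
    moreover have "\<mu> z \<le> s z * r / 200"
      using \<mu>z_s[OF A(1)] \<mu>_le_a[OF A(1)] unfolding hr_def by linarith
    moreover have "real a * \<mu> z = s z * r / 200" using \<mu>z_s[OF A(1)] by (simp add: hr_def)
    moreover have "s z * r \<le> B * (s z * r)" "s z * r > 0" using B1 s0 rpos by auto
    ultimately have "\<bar>(sl u z - \<sigma> z) * (- off u z + h) - 4 * (real a * \<mu> z) + t\<bar> \<le> B * (s z * r)"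
      using \<mu>0[OF A(1)] e51 unfolding abs_le_iff by linarith
    thus ?thesis by (intro that[of "- off u z + h" "(sl u z - \<sigma> z) * (- off u z + h) - 4 * (real a * \<mu> z) + t"])
       (use oh A rpos uV in \<open>auto simp: width_def algebra_simps\<close>)
  qed
qed


definition new_sign :: "idx \<Rightarrow> idx \<Rightarrow> nat \<Rightarrow> idx \<Rightarrow> (idx \<Rightarrow> real) \<Rightarrow> idx \<Rightarrow> real" where
  "new_sign u z K q \<epsilon> p' = (case p' of
     Cl p k \<Rightarrow> if p' = q then 0 else if p = u then (if k < K then -1 else 1)
        else if p = z then (if k < 2 * D + a - 1 - K then -1 else 1) else \<epsilon> p
   | Mid u1 z1 \<Rightarrow> if z1 \<noteq> z then \<epsilon> z1 else if u1 = u then 0 else sgn ((sl u1 z - sl u z) * off u1 z)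
   | Anti u1 z1 \<Rightarrow> if z1 \<noteq> z then \<epsilon> z1 else if u1 = u then -1 else - sgn ((sl u1 z - sl u z) * off u1 z)
   | _ \<Rightarrow> 0)"

lemma finE: "finite E" using EVZ finV finZ by (meson finite_SigmaI finite_subset)

lemma sum_E: "(\<Sum>(u, z)\<in>E. f u z) = (\<Sum>z\<in>Z. \<Sum>u\<in>{u. (u, z) \<in> E}. f u z)" for f :: "idx \<Rightarrow> idx \<Rightarrow> real"
proof -
  have fin: "finite {u. (u, z) \<in> E}" for z
    using finE by (intro finite_subset[OF _ finite_imageI[OF finE, of fst]]) force+
  have "(\<Sum>z\<in>Z. \<Sum>u\<in>{u. (u, z) \<in> E}. f u z) = (\<Sum>(z, u)\<in>(SIGMA z:Z. {u. (u, z) \<in> E}). f u z)"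
    using finZ fin by (intro sum.Sigma) auto
  also have "\<dots> = (\<Sum>(u, z)\<in>E. f u z)"
    by (rule sum.reindex_bij_witness[of _ "\<lambda>(u, z). (z, u)" "\<lambda>(z, u). (u, z)"]) (use EVZ in auto)
  finally show ?thesis ..
qed

lemma sum_new: "sum f (V' \<union> Z') = (\<Sum>p\<in>V. \<Sum>k<a + 2 * D. f (Cl p k)) + (\<Sum>p\<in>Z. \<Sum>k\<in>{D..<D + a}. f (Cl p k))
    + (\<Sum>z\<in>Z. \<Sum>u\<in>{u. (u, z) \<in> E}. f (Anti u z) + f (Mid u z))" for f :: "idx \<Rightarrow> real"
proof -
  have "sum f (V' \<union> Z') = sum f ((\<lambda>(u, k). Cl u k) ` (V \<times> {..<a + 2 * D})) + sum f ((\<lambda>(z, k). Cl z k) ` (Z \<times> {D..<D + a}))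
      + sum f ((\<lambda>(u, z). Anti u z) ` E) + sum f ((\<lambda>(u, z). Mid u z) ` E)"
    unfolding V'_def Z'_def using finV finZ finE disj
    by (subst sum.union_disjoint, force, force, force)+ simp
  also have "sum f ((\<lambda>(u, k). Cl u k) ` (V \<times> {..<a + 2 * D})) = (\<Sum>p\<in>V. \<Sum>k<a + 2 * D. f (Cl p k))"
    by (subst sum.reindex) (auto simp: inj_on_def sum.cartesian_product case_prod_unfold)
  also have "sum f ((\<lambda>(u, k). Cl u k) ` (Z \<times> {D..<D + a})) = (\<Sum>p\<in>Z. \<Sum>k\<in>{D..<D + a}. f (Cl p k))"
    by (subst sum.reindex) (auto simp: inj_on_def sum.cartesian_product case_prod_unfold)
  also have "sum f ((\<lambda>(u, z). Anti u z) ` E) = (\<Sum>(u, z)\<in>E. f (Anti u z))"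
    by (subst sum.reindex) (auto simp: inj_on_def case_prod_unfold)
  also have "sum f ((\<lambda>(u, z). Mid u z) ` E) = (\<Sum>(u, z)\<in>E. f (Mid u z))"
    by (subst sum.reindex) (auto simp: inj_on_def case_prod_unfold)
  finally show ?thesis unfolding sum_E by (simp add: sum.distrib add.assoc)
qed

lemma card_new: "card (V' \<union> Z') = 6 * D * card (V \<union> Z)"
proof -
  have "real (card (V' \<union> Z')) = sum (\<lambda>_. 1) (V' \<union> Z')" by simp
  also have "\<dots> = real (6 * D * card (V \<union> Z))"
    unfolding sum_new using deg finV finZ disj by (simp add: aD card_Un_disjoint algebra_simps)
  finally show ?thesis using of_nat_eq_iff by blast
qed

lemma card_E': "card E' = 8 * D * card E"
proof -
  have "card E' = card (E \<times> {D..<D + a}) + card (E \<times> {D..<D + a})"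
    unfolding E'_def using finE EVZ disj
    by (subst card_Un_disjoint, force, force, force)
       (subst card_image, force simp: inj_on_def, subst card_image, auto simp: inj_on_def)
  thus ?thesis using finE by (simp add: aD)
qed

text \<open>Away from \<open>u\<close> and \<open>z\<close>, each cluster contributes
  \<open>a + 2 * D\<close> times the old sign. At \<open>z\<close>, the points \<open>Mid\<close>
  and \<open>Anti\<close> of every other fan cancel. The progressions at \<open>u\<close> and
  \<open>z\<close> together contribute 1, since the indices \<open>K\<close> and
  \<open>2 * D + a - 1 - K\<close> sum to \<open>2 * D + a - 1\<close> and one of their points is on
  the line; \<open>Anti u z\<close> below the line compensates this.\<close>

lemma new_sign_sum:
  assumes e: "(u, z) \<in> E" and K: "D \<le> K" "K < D + a" and q: "q \<in> {Cl u K, Cl z (2 * D + a - 1 - K)}"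
    and \<epsilon>: "sum \<epsilon> (V \<union> Z) = 0" "\<epsilon> u = 0" "\<epsilon> z = 0"
  shows "sum (new_sign u z K q \<epsilon>) (V' \<union> Z') = 0"
proof -
  note uV = uV[OF e]
  define K2 where "K2 = 2 * D + a - 1 - K"
  have K2: "D \<le> K2" "K2 < D + a" using K D1 by (auto simp: K2_def)
  have KK2: "real K + real K2 = 2 * real D + real a - 1" using K D1 by (simp add: K2_def of_nat_diff)
  have q: "q = Cl u K \<or> q = Cl z K2" using q by (simp add: K2_def)
  have K2_Suc: "2 * D + a - Suc K = K2" by (simp add: K2_def)
  let ?f = "new_sign u z K q \<epsilon>"
  have fin: "finite {u. (u, z) \<in> E}" for z
    using finE by (intro finite_subset[OF _ finite_imageI[OF finE, of fst]]) force+
  have U: "(\<Sum>k<a + 2 * D. ?f (Cl u k)) = real a + 2 * real D - 2 * real K - (if q = Cl u K then 1 else 0)"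
  proof -
    have "(\<Sum>k<a + 2 * D. ?f (Cl u k)) = (\<Sum>k<a + 2 * D. (if k < K then -1 else 1) - (if k = K then (if q = Cl u K then 1 else 0) else 0))"
      using q uV by (intro sum.cong) (auto simp: new_sign_def)
    also have "\<dots> = real (a + 2 * D) - 2 * real K - (if q = Cl u K then 1 else 0)"
      using K by (subst sum_subtractf, subst sum_step_sign) auto
    finally show ?thesis by simp
  qed
  have W: "(\<Sum>k\<in>{D..<D + a}. ?f (Cl z k)) = real a + 2 * real D - 2 * real K2 - (if q = Cl u K then 0 else 1)"
  proof -
    have "(\<Sum>k\<in>{D..<D + a}. ?f (Cl z k)) = (\<Sum>k\<in>{D..<D + a}. (if k < K2 then -1 else 1) - (if k = K2 then (if q = Cl u K then 0 else 1) else 0))"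
      using q uV K2_Suc by (intro sum.cong) (auto simp: new_sign_def)
    also have "\<dots> = (\<Sum>k\<in>{D..<D + a}. (if k < K2 then -1 else 1)) - (if q = Cl u K then 0 else 1)"
      using K2 by (subst sum_subtractf) auto
    also have "(\<Sum>k\<in>{D..<D + a}. (if k < K2 then -1 else 1 :: real)) = (\<Sum>k<a. (if k < K2 - D then -1 else 1))"
      by (rule sum.reindex_bij_witness[of _ "\<lambda>k. k + D" "\<lambda>k. k - D"]) (use K2 in auto)
    also have "\<dots> = real a - 2 * real (K2 - D)" using K2 by (subst sum_step_sign) auto
    finally show ?thesis using K2 by (simp add: of_nat_diff)
  qed
  have N: "(\<Sum>u1\<in>{u. (u, z) \<in> E}. ?f (Anti u1 z) + ?f (Mid u1 z)) = -1"
  proof -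
    have "(\<Sum>u1\<in>{u. (u, z) \<in> E}. ?f (Anti u1 z) + ?f (Mid u1 z)) = (\<Sum>u1\<in>{u. (u, z) \<in> E}. if u1 = u then -1 else 0)"
      by (intro sum.cong) (auto simp: new_sign_def)
    also have "\<dots> = -1" using e fin by simp
    finally show ?thesis .
  qed
  have "(\<Sum>p\<in>V. \<Sum>k<a + 2 * D. ?f (Cl p k)) = (\<Sum>k<a + 2 * D. ?f (Cl u k)) + (\<Sum>p\<in>V - {u}. \<Sum>k<a + 2 * D. ?f (Cl p k))"
    using finV uV by (intro sum.remove) auto
  also have "(\<Sum>p\<in>V - {u}. \<Sum>k<a + 2 * D. ?f (Cl p k)) = (\<Sum>p\<in>V - {u}. real (a + 2 * D) * \<epsilon> p)"
  proof (intro sum.cong refl)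
    fix p assume p: "p \<in> V - {u}"
    have "?f (Cl p k) = \<epsilon> p" for k using p q uV by (auto simp: new_sign_def)
    thus "(\<Sum>k<a + 2 * D. ?f (Cl p k)) = real (a + 2 * D) * \<epsilon> p" by simp
  qed
  also have "\<dots> = real (a + 2 * D) * sum \<epsilon> V" using finV uV \<epsilon> by (simp add: sum_diff1 sum_distrib_left[symmetric])
  finally have 1: "(\<Sum>p\<in>V. \<Sum>k<a + 2 * D. ?f (Cl p k)) = (\<Sum>k<a + 2 * D. ?f (Cl u k)) + real (a + 2 * D) * sum \<epsilon> V" .
  have "(\<Sum>p\<in>Z. \<Sum>k\<in>{D..<D + a}. ?f (Cl p k)) = (\<Sum>k\<in>{D..<D + a}. ?f (Cl z k)) + (\<Sum>p\<in>Z - {z}. \<Sum>k\<in>{D..<D + a}. ?f (Cl p k))"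
    using finZ uV by (intro sum.remove) auto
  also have "(\<Sum>p\<in>Z - {z}. \<Sum>k\<in>{D..<D + a}. ?f (Cl p k)) = (\<Sum>p\<in>Z - {z}. real a * \<epsilon> p)"
  proof (intro sum.cong refl)
    fix p assume p: "p \<in> Z - {z}"
    have "?f (Cl p k) = \<epsilon> p" for k using p q uV by (auto simp: new_sign_def)
    thus "(\<Sum>k\<in>{D..<D + a}. ?f (Cl p k)) = real a * \<epsilon> p" by simp
  qed
  also have "\<dots> = real a * sum \<epsilon> Z" using finZ uV \<epsilon> by (simp add: sum_diff1 sum_distrib_left[symmetric])
  finally have 2: "(\<Sum>p\<in>Z. \<Sum>k\<in>{D..<D + a}. ?f (Cl p k)) = (\<Sum>k\<in>{D..<D + a}. ?f (Cl z k)) + real a * sum \<epsilon> Z" .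
  have "(\<Sum>w\<in>Z. \<Sum>u1\<in>{u. (u, w) \<in> E}. ?f (Anti u1 w) + ?f (Mid u1 w)) =
     (\<Sum>u1\<in>{u. (u, z) \<in> E}. ?f (Anti u1 z) + ?f (Mid u1 z)) + (\<Sum>w\<in>Z - {z}. \<Sum>u1\<in>{u. (u, w) \<in> E}. ?f (Anti u1 w) + ?f (Mid u1 w))"
    using finZ uV by (intro sum.remove) auto
  also have "(\<Sum>w\<in>Z - {z}. \<Sum>u1\<in>{u. (u, w) \<in> E}. ?f (Anti u1 w) + ?f (Mid u1 w)) = (\<Sum>w\<in>Z - {z}. 2 * real D * \<epsilon> w)"
    using deg by (intro sum.cong refl) (auto simp: new_sign_def)
  also have "\<dots> = 2 * real D * sum \<epsilon> Z" using finZ uV \<epsilon> by (simp add: sum_diff1 sum_distrib_left[symmetric])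
  finally have 3: "(\<Sum>w\<in>Z. \<Sum>u1\<in>{u. (u, w) \<in> E}. ?f (Anti u1 w) + ?f (Mid u1 w)) = -1 + 2 * real D * sum \<epsilon> Z"
    unfolding N .
  have "sum \<epsilon> V = - sum \<epsilon> Z" using \<epsilon>(1) finV finZ disj by (simp add: sum.union_disjoint)
  thus ?thesis unfolding sum_new 1 2 3 U W using KK2 by (simp add: algebra_simps)
qed


text \<open>Three mechanisms fix the signs: nesting of boxes for clusters away from \<open>u\<close>
  and \<open>z\<close>, the defects of \<open>fan_line\<close> within the two progressions, and
  separation of slopes for the points \<open>Mid\<close> and \<open>Anti\<close> of the other fans
  at \<open>z\<close>.\<close>

lemma new_sign_correct:
  assumes e: "(u, z) \<in> E" and K: "D \<le> K" "K < D + a"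
    and q: "q = Cl u K \<or> q = Cl z (2 * D + a - 1 - K)"
    and \<epsilon>: "\<And>m b p h t. meets x y \<sigma> w r m b u \<Longrightarrow> meets x y \<sigma> w r m b z \<Longrightarrow> p \<in> V \<union> Z - {u, z} \<Longrightarrow>
        \<bar>h\<bar> \<le> r \<Longrightarrow> \<bar>t\<bar> \<le> w p \<Longrightarrow> sgn (y p + \<sigma> p * h + t - (m * (x p + h) + b)) = \<epsilon> p"
    and mq: "meets x' y' \<sigma>' w' r' m b q" and mm: "meets x' y' \<sigma>' w' r' m b (Mid u z)"
    and p': "p' \<in> V' \<union> Z' - {q, Mid u z}" and h: "\<bar>h\<bar> \<le> r'" and t: "\<bar>t\<bar> \<le> w' p'"
  shows "sgn (y' p' + \<sigma>' p' * h + t - (m * (x' p' + h) + b)) = new_sign u z K q \<epsilon> p'"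
proof -
  note uV = uV[OF e]
  note \<mu>0 = \<mu>0[OF e]
  obtain \<alpha> \<beta> where qu: "m * x u + b - y u = (c K - \<alpha>) * \<mu> u" and qz: "m * x z + b - y z = (- c K - \<beta>) * \<mu> z"
    and M: "\<bar>m - sl u z\<bar> \<le> real a * s' (Mid u z)" and \<alpha>: "-1/20 \<le> \<alpha>" "\<alpha> \<le> 2/5" and \<beta>: "-1/20 \<le> \<beta>" "\<beta> \<le> 2/5"
    and own: "q \<noteq> Cl u K \<Longrightarrow> \<alpha> \<ge> 17/100" "q = Cl u K \<Longrightarrow> \<beta> \<ge> 17/100"
    using fan_line[OF e K mm q mq] by metis
  have ck: "\<bar>c K\<bar> \<le> (real a - 1) / 2" using c_abs K by simp
  have q': "q \<in> V' \<union> Z'"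
  proof -
    have "2 * D + a - 1 - K < D + a" "D \<le> 2 * D + a - 1 - K" using K D1 by auto
    thus ?thesis using q uV K unfolding V'_def by fastforce
  qed
  have m': "Mid u z \<in> V' \<union> Z'" using e unfolding Z'_def by force
  have trans: "meets x y \<sigma> w r m b (parent P)" if P: "P \<in> V' \<union> Z'" "meets x' y' \<sigma>' w' r' m b P" for P
  proof -
    from P(2) obtain h t where "\<bar>h\<bar> \<le> r'" "\<bar>t\<bar> \<le> w' P" and eq: "y' P + \<sigma>' P * h + t = m * (x' P + h) + b"
      unfolding meets_def by blast
    from box_nested[OF P(1) this(1,2)] obtain h2 t2 where "\<bar>h2\<bar> \<le> r" "\<bar>t2\<bar> \<le> w (parent P)" "x' P + h = x (parent P) + h2"
      "y' P + \<sigma>' P * h + t = y (parent P) + \<sigma> (parent P) * h2 + t2" by metis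
    thus ?thesis using eq unfolding meets_def by metis
  qed
  have mz: "meets x y \<sigma> w r m b z" using trans[OF m' mm] by simp
  \<comment> \<open>If \<open>q\<close> belongs to the progression of \<open>z\<close>, no new box
    near \<open>u\<close> is known to be met. The bound on \<alpha> shows that the line passes
    \<open>x u\<close> within \<open>a * \<mu> u = g u / 100\<close> of \<open>y u\<close>, inside
    the old box.\<close>
  have mu: "meets x y \<sigma> w r m b u"
  proof -
    have "\<bar>c K - \<alpha>\<bar> \<le> real a" using ck \<alpha> a4 unfolding abs_le_iff by (auto simp: field_simps)
    hence "\<bar>(c K - \<alpha>) * \<mu> u\<bar> \<le> real a * \<mu> u" unfolding abs_mult using \<mu>0 by (simp add: mult_right_mono)
    also have "\<dots> \<le> w u" using \<mu>u_g[OF e] uV gpos[OF uV(1)] by (simp add: width_def)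
    finally show ?thesis unfolding meets_def
      by (intro exI[of _ 0] exI[of _ "(c K - \<alpha>) * \<mu> u"]) (use qu rpos in auto)
  qed
  have other: ?thesis if parent: "parent p' \<noteq> u" "parent p' \<noteq> z" "new_sign u z K q \<epsilon> p' = \<epsilon> (parent p')"
  proof -
    have pp: "p' \<in> V' \<union> Z'" using p' by auto
    have "parent p' \<in> V \<union> Z" using pp EVZ unfolding V'_def Z'_def by auto
    moreover obtain h2 t2 where "\<bar>h2\<bar> \<le> r" "\<bar>t2\<bar> \<le> w (parent p')" "x' p' + h = x (parent p') + h2"
      "y' p' + \<sigma>' p' * h + t = y (parent p') + \<sigma> (parent p') * h2 + t2" using box_nested[OF pp h t] by metis
    ultimately show ?thesis using \<epsilon>[OF mu mz, of "parent p'" h2 t2] parent by simp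
  qed
  have Mh: "\<bar>(m - sl u z) * h\<bar> \<le> \<mu> z / 100" using Mh_bound[OF e M h] .
  define far where "far X = m * (x z + X) + b - (y z + sl u z * X)" for X
  have far: "\<bar>far X\<bar> \<le> 3 * real a * \<mu> z" if "\<bar>X\<bar> \<le> 101/100 * hr" for X
    unfolding far_def using line_near[OF e M qz K \<beta> that] .
  have r'hr: "r' \<le> hr / 100000" using r'r rpos unfolding hr_def by linarith
  have a\<mu>: "real a * \<mu> z = s z * hr / 100" using \<mu>z_s[OF e] .
  have \<mu>a: "\<mu> z \<le> real a * \<mu> z" using \<mu>_le_a[OF e] .
  have shr: "s z * hr > 0" using spos uV hr0 by simp
  \<comment> \<open>Slopes of different fans differ by at least \<open>s z / 4\<close>, acting over
    at least \<open>8/9 * hr\<close>. Half of this product is \<open>s z * hr / 9\<close>, whereas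
    the error \<open>8 * a * \<mu> z\<close> is \<open>8/100 * s z * hr\<close>.\<close>
  have dom: "sgn ((sl v z - sl u z) * (X + h) + f) = sgn ((sl v z - sl u z) * X)"
    if v: "(v, z) \<in> E" "v \<noteq> u" and X: "\<bar>X\<bar> = \<bar>off v z\<bar>" and f: "\<bar>f\<bar> \<le> 8 * (real a * \<mu> z)" for v X f
  proof (rule sgn_dominant)
    show "\<bar>h\<bar> \<le> \<bar>X\<bar> / 2" using X off_abs[OF v(1)] h r'hr hr0 by linarith
    have "s z / 4 * (8/9 * hr) \<le> \<bar>sl v z - sl u z\<bar> * \<bar>X\<bar>"
      using sep[OF v(1) e v(2)] off_abs[OF v(1)] X hr0 spos[OF uV(2)] by (intro mult_mono) auto
    thus "\<bar>f\<bar> < \<bar>sl v z - sl u z\<bar> * \<bar>X\<bar> / 2" using f a\<mu> shr by linarith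
  qed
  consider (CV) p k where "p \<in> V" "k < a + 2 * D" "p' = Cl p k"
    | (CZ) p k where "p \<in> Z" "D \<le> k" "k < D + a" "p' = Cl p k"
    | (A) u1 z1 where "(u1, z1) \<in> E" "p' = Anti u1 z1"
    | (M) u1 z1 where "(u1, z1) \<in> E" "p' = Mid u1 z1"
    using p' unfolding V'_def Z'_def by (auto, blast+)
  thus ?thesis
  proof cases
    case CV
    show ?thesis
    proof (cases "p = u")
      case False
      moreover have "p \<noteq> z" using CV uV by auto
      ultimately show ?thesis using CV p' by (intro other) (auto simp: new_sign_def)
    next
      case True
      have tt: "\<bar>t\<bar> \<le> 3/100 * \<mu> u" using t CV w'_Cl(1)[of u k] True by simp
      have "\<bar>(\<sigma> u - sl u z) * h\<bar> = \<bar>h\<bar> * \<bar>sl u z - \<sigma> u\<bar>" by (simp add: abs_mult abs_minus_commute)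
      also have "\<dots> \<le> r' * \<bar>sl u z - \<sigma> u\<bar>" using h by (intro mult_right_mono) auto
      finally have "\<bar>(\<sigma> u - sl u z) * h\<bar> \<le> \<mu> u / 1000" using r'slV[OF e] by linarith
      hence err: "\<bar>t + (\<sigma> u - sl u z) * h - (m - sl u z) * h\<bar> \<le> 1/25 * \<mu> u"
        using tt Mh \<mu>8[OF e] \<mu>0 unfolding abs_le_iff by linarith
      have eq: "y' p' + \<sigma>' p' * h + t - (m * (x' p' + h) + b) =
          (c k - c K + \<alpha>) * \<mu> u + (t + (\<sigma> u - sl u z) * h - (m - sl u z) * h)"
        using CV True qu by (simp add: algebra_simps)
      consider "k < K" | "k = K" | "K < k" by linarith
      thus ?thesis
      proof cases
        case 1
        hence "c k - c K + \<alpha> \<le> -3/5" using c_less[of k K] \<alpha> by linarith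
        hence "(c k - c K + \<alpha>) * \<mu> u \<le> -3/5 * \<mu> u" using \<mu>0 by (intro mult_right_mono) auto
        hence "y' p' + \<sigma>' p' * h + t - (m * (x' p' + h) + b) < 0" unfolding eq using err \<mu>0 by linarith
        thus ?thesis using CV True 1 p' q uV by (auto simp: new_sign_def)
      next
        case 2
        \<comment> \<open>Here the line hits the mirror point at \<open>z\<close>, so the defect at
          this end is at least 17/100, more than the total error of 1/25 spacing: the
          \<open>K\<close>-th point is above the line.\<close>
        hence qn: "q \<noteq> Cl u K" using p' CV True by auto
        hence "c k - c K + \<alpha> \<ge> 17/100" using own 2 by simp
        hence "(c k - c K + \<alpha>) * \<mu> u \<ge> 17/100 * \<mu> u" using \<mu>0 by (intro mult_right_mono) auto
        hence "y' p' + \<sigma>' p' * h + t - (m * (x' p' + h) + b) > 0" unfolding eq using err \<mu>0 by linarith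
        thus ?thesis using CV True 2 p' qn uV by (auto simp: new_sign_def)
      next
        case 3
        hence "c k - c K + \<alpha> \<ge> 17/100" using c_less[of K k] \<alpha> by linarith
        hence "(c k - c K + \<alpha>) * \<mu> u \<ge> 17/100 * \<mu> u" using \<mu>0 by (intro mult_right_mono) auto
        hence "y' p' + \<sigma>' p' * h + t - (m * (x' p' + h) + b) > 0" unfolding eq using err \<mu>0 by linarith
        thus ?thesis using CV True 3 p' q uV by (auto simp: new_sign_def)
      qed
    qed
  next
    case CZ
    define K2 where "K2 = 2 * D + a - 1 - K"
    have cK2: "c K2 = - c K" unfolding K2_def using cmirror K by simp
    have qK2: "q = Cl u K \<or> q = Cl z K2" using q by (simp add: K2_def)
    show ?thesis
    proof (cases "p = z")
      case False
      moreover have "p \<noteq> u" using CZ uV by auto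
      ultimately show ?thesis using CZ p' by (intro other) (auto simp: new_sign_def)
    next
      case True
      have tt: "\<bar>t\<bar> \<le> 3/100 * \<mu> z" using t CZ w'_Cl(2)[of z k] True by simp
      have "\<bar>(\<sigma> z - sl u z) * h\<bar> = \<bar>h\<bar> * \<bar>sl u z - \<sigma> z\<bar>" by (simp add: abs_mult abs_minus_commute)
      also have "\<dots> \<le> r' * \<bar>sl u z - \<sigma> z\<bar>" using h by (intro mult_right_mono) auto
      finally have "\<bar>(\<sigma> z - sl u z) * h\<bar> \<le> \<mu> z / 100" using r'slZ[OF e] by linarith
      hence err: "\<bar>t + (\<sigma> z - sl u z) * h - (m - sl u z) * h\<bar> \<le> 1/20 * \<mu> z"
        using tt Mh \<mu>0 unfolding abs_le_iff by linarith
      have eq: "y' p' + \<sigma>' p' * h + t - (m * (x' p' + h) + b) =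
          (c k - c K2 + \<beta>) * \<mu> z + (t + (\<sigma> z - sl u z) * h - (m - sl u z) * h)"
        using CZ True qz by (simp add: cK2 algebra_simps)
      have sgk: "new_sign u z K q \<epsilon> p' = (if k < K2 then -1 else 1)"
        using CZ True p' uV unfolding new_sign_def K2_def by auto
      consider "k < K2" | "k = K2" | "K2 < k" by linarith
      thus ?thesis
      proof cases
        case 1
        hence "c k - c K2 + \<beta> \<le> -3/5" using c_less[of k K2] \<beta> by linarith
        hence "(c k - c K2 + \<beta>) * \<mu> z \<le> -3/5 * \<mu> z" using \<mu>0 by (intro mult_right_mono) auto
        hence "y' p' + \<sigma>' p' * h + t - (m * (x' p' + h) + b) < 0" unfolding eq using err \<mu>0 by linarith
        thus ?thesis using 1 sgk by auto
      next
        case 2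
        hence "q = Cl u K" using p' CZ True qK2 by auto
        hence "c k - c K2 + \<beta> \<ge> 17/100" using own 2 by simp
        hence "(c k - c K2 + \<beta>) * \<mu> z \<ge> 17/100 * \<mu> z" using \<mu>0 by (intro mult_right_mono) auto
        hence "y' p' + \<sigma>' p' * h + t - (m * (x' p' + h) + b) > 0" unfolding eq using err \<mu>0 by linarith
        thus ?thesis using 2 sgk by auto
      next
        case 3
        hence "c k - c K2 + \<beta> \<ge> 17/100" using c_less[of K2 k] \<beta> by linarith
        hence "(c k - c K2 + \<beta>) * \<mu> z \<ge> 17/100 * \<mu> z" using \<mu>0 by (intro mult_right_mono) auto
        hence "y' p' + \<sigma>' p' * h + t - (m * (x' p' + h) + b) > 0" unfolding eq using err \<mu>0 by linarith
        thus ?thesis using 3 sgk by auto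
      qed
    qed
  next
    case M
    note uV1 = halving_step.uV[OF halving_step_axioms M(1)]
    show ?thesis
    proof (cases "z1 = z")
      case False
      moreover have "z1 \<noteq> u" using uV1 uV by auto
      ultimately show ?thesis using M by (intro other) (auto simp: new_sign_def)
    next
      case True
      have e1: "(u1, z) \<in> E" using M True by simp
      have ne: "u1 \<noteq> u" using p' M True by auto
      have oh: "\<bar>off u1 z + h\<bar> \<le> 101/100 * hr" using off_abs[OF e1] h r'hr hr0 by linarith
      have tt: "\<bar>t\<bar> \<le> \<mu> z / 100" using t M True w'_Mid[OF e1] by simp
      have eq: "y' p' + \<sigma>' p' * h + t - (m * (x' p' + h) + b) =
          (sl u1 z - sl u z) * (off u1 z + h) + (t - \<mu> z / 4 - far (off u1 z + h))"
        using M True by (simp add: far_def algebra_simps)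
      have "\<bar>t - \<mu> z / 4 - far (off u1 z + h)\<bar> \<le> 8 * (real a * \<mu> z)"
        using far[OF oh] tt \<mu>a \<mu>0 unfolding abs_le_iff by linarith
      thus ?thesis unfolding eq using M True ne dom[OF e1 ne refl] by (simp add: new_sign_def)
    qed
  next
    case A
    note uV1 = halving_step.uV[OF halving_step_axioms A(1)]
    show ?thesis
    proof (cases "z1 = z")
      case False
      moreover have "z1 \<noteq> u" using uV1 uV by auto
      ultimately show ?thesis using A by (intro other) (auto simp: new_sign_def)
    next
      case True
      have e1: "(u1, z) \<in> E" using A True by simp
      have oh: "\<bar>- off u1 z + h\<bar> \<le> 101/100 * hr" using off_abs[OF e1] h r'hr hr0 by linarith
      have tt: "\<bar>t\<bar> \<le> 3/100 * \<mu> z" using t A True w'_Cl(3)[OF e1] by simp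
      have eq: "y' p' + \<sigma>' p' * h + t - (m * (x' p' + h) + b) =
          (sl u1 z - sl u z) * (- off u1 z + h) + (t - 4 * (real a * \<mu> z) - far (- off u1 z + h))"
        using A True by (simp add: far_def algebra_simps)
      have f: "\<bar>t - 4 * (real a * \<mu> z) - far (- off u1 z + h)\<bar> \<le> 8 * (real a * \<mu> z)"
        "t - 4 * (real a * \<mu> z) - far (- off u1 z + h) < 0"
        using far[OF oh] tt \<mu>a \<mu>0 unfolding abs_le_iff by linarith+
      show ?thesis
      proof (cases "u1 = u")
        case False
        thus ?thesis unfolding eq using A True dom[OF e1 False _ f(1), of "- off u1 z"]
          by (simp add: new_sign_def sgn_minus)
      next
        case u1: True
        show ?thesis unfolding eq using f(2) A True u1 by (simp add: new_sign_def)
      qed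
    qed
  qed
qed

lemma new_sign_nonzero:
  assumes e: "(u, z) \<in> E" and q: "q = Cl u K \<or> q = Cl z K2"
    and \<epsilon>: "\<And>p. p \<in> V \<union> Z - {u, z} \<Longrightarrow> \<epsilon> p \<noteq> 0" and p': "p' \<in> V' \<union> Z' - {q, Mid u z}"
  shows "new_sign u z K q \<epsilon> p' \<noteq> 0"
proof -
  note uV = uV[OF e]
  have n: "sgn ((sl v z - sl u z) * off v z) \<noteq> 0" if "(v, z) \<in> E" "v \<noteq> u" for v
    using sep[OF that(1) e that(2)] off0[OF that(1)] spos[OF uV(2)] by (auto simp: sgn_if)
  have E2: "(v, w) \<in> E \<Longrightarrow> w \<in> Z \<and> w \<noteq> u \<and> v \<in> V \<and> v \<noteq> z" for v w using EVZ disj uV by auto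
  show ?thesis using p' \<epsilon> n E2 unfolding V'_def Z'_def new_sign_def by (auto split: if_splits)
qed

lemma E'_cases:
  assumes "(q, P) \<in> E'"
  obtains u z K where "(u, z) \<in> E" "D \<le> K" "K < D + a" "P = Mid u z" "q = Cl u K \<or> q = Cl z (2 * D + a - 1 - K)"
proof -
  from assms consider (1) u z k where "(u, z) \<in> E" "D \<le> k" "k < D + a" "P = Mid u z" "q = Cl u k"
    | (2) u z k where "(u, z) \<in> E" "D \<le> k" "k < D + a" "P = Mid u z" "q = Cl z k"
    unfolding E'_def by auto
  thus thesis
  proof cases
    case 1 thus ?thesis using that by blast
  next
    case 2
    show ?thesis by (rule that[of u z "2 * D + a - 1 - k"]) (use 2 D1 in auto)
  qed
qed

text \<open>The new bound \<open>B\<close> is \<open>a\<close> because the slopes at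
  \<open>Mid u z\<close> deviate from the old slope by at most \<open>a\<close> units
  \<open>s'\<close>. The degree doubles \<open>a\<close>, since both progressions are joined to the
  meeting point.\<close>

theorem next_config: "halving_config V' Z' E' x' y' \<sigma>' g' s' r' (real a) (2 * a)"
proof
  have CE: "\<exists>u z k. (u, z) \<in> E \<and> D \<le> k \<and> k < D + a \<and> P = Mid u z \<and> (q = Cl u k \<or> q = Cl z k)" if "(q, P) \<in> E'" for q P
    using that unfolding E'_def by (auto, blast+)
  have \<mu>pos: "\<mu> p > 0" if "p \<in> V \<union> Z" for p using that gpos spos \<kappa>0 hr0 by (auto simp: \<mu>_def)
  show "finite V'" "finite Z'" using finV finZ finE by (auto simp: V'_def Z'_def)
  show "V' \<inter> Z' = {}" by (auto simp: V'_def Z'_def)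
  show "E' \<subseteq> V' \<times> Z'" using EVZ by (force simp: V'_def Z'_def E'_def)
  show "2 * a \<ge> 1" "r' > 0" "real a \<ge> 1" using a4 r'0 by auto
  show "card {q. (q, P) \<in> E'} = 2 * a" if "P \<in> Z'" for P
  proof -
    from that obtain u z where e: "(u, z) \<in> E" and P: "P = Mid u z" unfolding Z'_def by auto
    have I: "(Cl v k, Mid u z) \<in> E'" if "k \<in> {D..<D + a}" "v = u \<or> v = z" for v k
      using e that unfolding E'_def by force
    have "{q. (q, P) \<in> E'} = Cl u ` {D..<D + a} \<union> Cl z ` {D..<D + a}" using P I CE[of _ P] by force
    also have "card \<dots> = 2 * a" using uV[OF e]
      by (subst card_Un_disjoint) (auto simp: card_image inj_on_def)
    finally show ?thesis .
  qed
  show "g' p > 0" if "p \<in> V'" for p using that \<mu>pos EVZ unfolding V'_def by auto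
  show "s' p > 0" if "p \<in> Z'" for p using that s'0 unfolding Z'_def by auto
  show "\<bar>x' p\<bar> + r' \<le> 2" if p: "p \<in> V' \<union> Z'" for p
  proof -
    have rr: "r' \<le> r / 4" using r'r rpos by simp
    consider (C) q k where "q \<in> V \<union> Z" "p = Cl q k" | (M) u z where "(u, z) \<in> E" "p = Mid u z \<or> p = Anti u z"
      using p unfolding V'_def Z'_def by auto
    thus ?thesis
    proof cases
      case C thus ?thesis using xr[of q] rr rpos by auto
    next
      case M
      have "\<bar>x z\<bar> + r \<le> 2" using xr uV[OF M(1)] by auto
      thus ?thesis using M(2) off_abs[OF M(1)] rr rpos unfolding hr_def by auto
    qed
  qed
  show "4 * r' \<le> \<bar>x' q - x' P\<bar>" if "(q, P) \<in> E'" for q P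
  proof -
    from CE[OF that] obtain u z k where *: "(u, z) \<in> E" "P = Mid u z" "q = Cl u k \<or> q = Cl z k" by blast
    have "4 * r' \<le> hr / 4" using r'r rpos unfolding hr_def by linarith
    thus ?thesis using * rest_ge[OF *(1)] off_abs[OF *(1)] hr0 by (auto simp: algebra_simps)
  qed
  show "g' q = s' P * \<bar>x' q - x' P\<bar>" if "(q, P) \<in> E'" for q P
  proof -
    from CE[OF that] obtain u z k where *: "(u, z) \<in> E" "P = Mid u z" "q = Cl u k \<or> q = Cl z k" by blast
    have "x u - x z - off u z \<noteq> 0" using rest_ge[OF *(1)] hr0 by auto
    hence "\<mu> u = s' (Mid u z) * \<bar>x u - x z - off u z\<bar>" unfolding s'_rest[OF *(1)] by simp
    moreover have "\<mu> z = s' (Mid u z) * \<bar>- off u z\<bar>" using off0[OF *(1)] by simp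
    ultimately show ?thesis using *(2,3) by (auto simp: diff_diff_eq simp del: s'.simps)
  qed
  show "r' * \<bar>slope x' y' q P - \<sigma>' q\<bar> \<le> g' q" if "(q, P) \<in> E'" for q P
  proof -
    from CE[OF that] obtain u z k where *: "(u, z) \<in> E" "D \<le> k" "k < D + a" "P = Mid u z" "q = Cl u k \<or> q = Cl z k" by blast
    note \<mu>0 = \<mu>0[OF *(1)]
    have 1: "r' * \<bar>slope x' y' q P - sl u z\<bar> \<le> \<mu> z / 100"
    proof -
      have "\<bar>slope x' y' q P - sl u z\<bar> \<le> real a * s' (Mid u z)" using slope_bounds[OF *(1,2,3)] *(4,5) by metis
      hence "r' * \<bar>slope x' y' q P - sl u z\<bar> \<le> r' * (real a * s' (Mid u z))" using r'0 by (intro mult_left_mono) auto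
      thus ?thesis using r'as'[OF *(1)] by linarith
    qed
    have tri: "r' * \<bar>slope x' y' q P - \<sigma>' q\<bar> \<le> r' * \<bar>slope x' y' q P - sl u z\<bar> + r' * \<bar>sl u z - \<sigma>' q\<bar>"
      unfolding distrib_left[symmetric] using r'0 by (intro mult_left_mono) auto
    show ?thesis using *(5)
    proof
      assume "q = Cl u k"
      thus ?thesis using tri 1 r'slV[OF *(1)] \<mu>8[OF *(1)] \<mu>0 by simp
    next
      assume "q = Cl z k"
      thus ?thesis using tri 1 r'slZ[OF *(1)] \<mu>0 by simp
    qed
  qed
  show "\<bar>slope x' y' q P - \<sigma>' P\<bar> \<le> real a * s' P" if "(q, P) \<in> E'" for q P
  proof -
    from CE[OF that] obtain u z k where *: "(u, z) \<in> E" "D \<le> k" "k < D + a" "P = Mid u z" "q = Cl u k \<or> q = Cl z k" by blast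
    have "\<sigma>' P = sl u z" using *(4) by simp
    thus ?thesis using slope_bounds[OF *(1,2,3)] *(4,5) by metis
  qed
  show "s' P / 4 \<le> \<bar>slope x' y' q P - slope x' y' q2 P\<bar>" if E12: "(q, P) \<in> E'" "(q2, P) \<in> E'" "q \<noteq> q2" for q q2 P
  proof -
    from CE[OF E12(1)] obtain u z k where *: "(u, z) \<in> E" "D \<le> k" "k < D + a" "P = Mid u z" "q = Cl u k \<or> q = Cl z k" by blast
    from CE[OF E12(2)] *(4) obtain l where **: "D \<le> l" "l < D + a" "q2 = Cl u l \<or> q2 = Cl z l" by auto
    show ?thesis unfolding *(4) using *(5) **(3) by (intro slope_sep[OF *(1) _ _ E12(3) *(2,3) **(1,2)]) auto
  qed
  show "\<exists>\<epsilon>. sum \<epsilon> (V' \<union> Z') = 0 \<and> \<epsilon> q = 0 \<and> \<epsilon> P = 0 \<and> (\<forall>p\<in>V' \<union> Z' - {q, P}. \<epsilon> p \<noteq> 0) \<and>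
      (\<forall>m b. meets x' y' \<sigma>' w' r' m b q \<longrightarrow> meets x' y' \<sigma>' w' r' m b P \<longrightarrow>
        (\<forall>p\<in>V' \<union> Z' - {q, P}. \<forall>h t. \<bar>h\<bar> \<le> r' \<longrightarrow> \<bar>t\<bar> \<le> w' p \<longrightarrow>
           sgn (y' p + \<sigma>' p * h + t - (m * (x' p + h) + b)) = \<epsilon> p))"
    if "(q, P) \<in> E'" for q P
  proof -
    from E'_cases[OF that] obtain u z K where *: "(u, z) \<in> E" "D \<le> K" "K < D + a" "P = Mid u z"
      "q = Cl u K \<or> q = Cl z (2 * D + a - 1 - K)" by metis
    from robust[OF *(1)] obtain \<epsilon> where \<epsilon>: "sum \<epsilon> (V \<union> Z) = 0" "\<epsilon> u = 0" "\<epsilon> z = 0" "\<forall>p\<in>V \<union> Z - {u, z}. \<epsilon> p \<noteq> 0"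
      and rob: "\<And>m b p h t. meets x y \<sigma> w r m b u \<Longrightarrow> meets x y \<sigma> w r m b z \<Longrightarrow> p \<in> V \<union> Z - {u, z} \<Longrightarrow>
        \<bar>h\<bar> \<le> r \<Longrightarrow> \<bar>t\<bar> \<le> w p \<Longrightarrow> sgn (y p + \<sigma> p * h + t - (m * (x p + h) + b)) = \<epsilon> p" by metis
    show ?thesis unfolding *(4)
    proof (intro exI[of _ "new_sign u z K q \<epsilon>"] conjI allI ballI impI)
      show "sum (new_sign u z K q \<epsilon>) (V' \<union> Z') = 0" using new_sign_sum[OF *(1-3) _ \<epsilon>(1-3)] *(5) by blast
      show "new_sign u z K q \<epsilon> q = 0" "new_sign u z K q \<epsilon> (Mid u z) = 0" using *(5) by (auto simp: new_sign_def)
      show "new_sign u z K q \<epsilon> p \<noteq> 0" if "p \<in> V' \<union> Z' - {q, Mid u z}" for p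
        using new_sign_nonzero[OF *(1,5) _ that] \<epsilon>(4) by blast
      show "sgn (y' p + \<sigma>' p * h + t - (m * (x' p + h) + b)) = new_sign u z K q \<epsilon> p"
        if "meets x' y' \<sigma>' w' r' m b q" "meets x' y' \<sigma>' w' r' m b (Mid u z)"
          "p \<in> V' \<union> Z' - {q, Mid u z}" "\<bar>h\<bar> \<le> r'" "\<bar>t\<bar> \<le> w' p" for m b p h t
        using new_sign_correct[OF *(1-3,5) rob that] by blast
    qed
  qed
qed

end

section \<open>Iteration of the step from a single segment\<close>

lemma base_config:
  "halving_config {Lft} {Rgt} {(Lft, Rgt)} (\<lambda>p. if p = Lft then 1 else 0) (\<lambda>_. 0) (\<lambda>_. 0) (\<lambda>_. 1) (\<lambda>_. 1) (1/4) 1 1"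
  by unfold_locales (auto simp: slope_def intro: exI[of _ "\<lambda>_. 0"])

text \<open>The degree is \<open>8 ^ m\<close> and \<open>a = 4 * 8 ^ m\<close>. The factors 6 D and
  8 D are \<open>a + 2 * D\<close> and \<open>2 * a\<close>; the radius shrinks by the factor
  \<open>\<kappa> / (1000 * a)\<close>, whose inverse is 100000 a^2 = 1600000 * 64^m.\<close>

fun npts nedges :: "nat \<Rightarrow> nat" and rad bnd :: "nat \<Rightarrow> real" where
  "npts 0 = 2" | "npts (Suc m) = 6 * 8 ^ m * npts m"
| "nedges 0 = 1" | "nedges (Suc m) = 8 * 8 ^ m * nedges m"
| "rad 0 = 1/4" | "rad (Suc m) = rad m / (1600000 * 64 ^ m)"
| "bnd 0 = 1" | "bnd (Suc m) = 4 * 8 ^ m"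

lemma iterate:
  "\<exists>V Z E x y \<sigma> g s. halving_config V Z E x y \<sigma> g s (rad m) (bnd m) (8 ^ m) \<and>
     card (V \<union> Z) = npts m \<and> card E = nedges m"
proof (induction m)
  case 0
  have "halving_config {Lft} {Rgt} {(Lft, Rgt)} (\<lambda>p. if p = Lft then 1 else 0) (\<lambda>_. 0) (\<lambda>_. 0) (\<lambda>_. 1) (\<lambda>_. 1)
      (rad 0) (bnd 0) (8 ^ 0)" using base_config by simp
  moreover have "card ({Lft} \<union> {Rgt}) = npts 0" "card {(Lft, Rgt)} = nedges 0" by simp_all
  ultimately show ?case by blast
next
  case (Suc m)
  then obtain V Z E x y \<sigma> g s where C: "halving_config V Z E x y \<sigma> g s (rad m) (bnd m) (8 ^ m)"
    and card: "card (V \<union> Z) = npts m" "card E = nedges m" by blast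
  interpret halving_config V Z E x y \<sigma> g s "rad m" "bnd m" "8 ^ m" by fact
  have B: "bnd m \<le> real (4 * 8 ^ m)" by (cases m) auto
  interpret halving_step V Z E x y \<sigma> g s "rad m" "bnd m" "8 ^ m" "4 * 8 ^ m"
    by unfold_locales (use B in auto)
  have "r' = rad (Suc m)" unfolding r'_def \<kappa>_def by (simp add: power_mult_distrib[symmetric])
  moreover have "real (4 * 8 ^ m) = bnd (Suc m)" "2 * (4 * 8 ^ m) = (8 :: nat) ^ Suc m" by simp_all
  ultimately have "halving_config V' Z' E' x' y' \<sigma>' g' s' (rad (Suc m)) (bnd (Suc m)) (8 ^ Suc m)"
    using next_config by metis
  moreover have "card (V' \<union> Z') = npts (Suc m)" "card E' = nedges (Suc m)"
    using card_new card_E' card by auto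
  ultimately show ?case by blast
qed

section \<open>Planar sets with adjustable abscissas\<close>

definition halving_pair :: "nat \<Rightarrow> (nat \<Rightarrow> real) \<Rightarrow> (nat \<Rightarrow> real) \<Rightarrow> nat \<Rightarrow> nat \<Rightarrow> bool" where
  "halving_pair n X Y i j \<longleftrightarrow> X i \<noteq> X j \<and> (\<exists>\<alpha> \<beta>. Y i = \<alpha> * X i + \<beta> \<and> Y j = \<alpha> * X j + \<beta> \<and>
     (\<forall>l<n. l \<noteq> i \<longrightarrow> l \<noteq> j \<longrightarrow> Y l \<noteq> \<alpha> * X l + \<beta>) \<and> (\<Sum>l<n. sgn (Y l - (\<alpha> * X l + \<beta>))) = 0)"

text \<open>Only the abscissas change, so translated and scaled copies of a row can share their
  ordinates.\<close>

lemma halving_pair_affine: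
  assumes h: "halving_pair n X Y i j" and c: "c \<noteq> 0" and X': "\<And>l. l < n \<Longrightarrow> X' l = c * X l + d"
    and ij: "i < n" "j < n"
  shows "halving_pair n X' Y i j"
proof -
  from h obtain \<alpha> \<beta> where *: "X i \<noteq> X j" "Y i = \<alpha> * X i + \<beta>" "Y j = \<alpha> * X j + \<beta>"
     "\<forall>l<n. l \<noteq> i \<longrightarrow> l \<noteq> j \<longrightarrow> Y l \<noteq> \<alpha> * X l + \<beta>" "(\<Sum>l<n. sgn (Y l - (\<alpha> * X l + \<beta>))) = 0"
    unfolding halving_pair_def by blast
  have eq: "(\<alpha> / c) * X' l + (\<beta> - \<alpha> / c * d) = \<alpha> * X l + \<beta>" if "l < n" for l
    unfolding X'[OF that] using c by (simp add: field_simps)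
  have s: "(\<Sum>l<n. sgn (Y l - ((\<alpha> / c) * X' l + (\<beta> - \<alpha> / c * d)))) = 0"
  proof -
    have "(\<Sum>l<n. sgn (Y l - ((\<alpha> / c) * X' l + (\<beta> - \<alpha> / c * d)))) = (\<Sum>l<n. sgn (Y l - (\<alpha> * X l + \<beta>)))"
      by (intro sum.cong refl) (simp only: eq lessThan_iff)
    thus ?thesis using *(5) by simp
  qed
  show ?thesis unfolding halving_pair_def
    by (intro conjI exI[of _ "\<alpha> / c"] exI[of _ "\<beta> - \<alpha> / c * d"] s) (use * eq ij c X' in auto)
qed

text \<open>Here the boxes pay off: the abscissas are free within \<open>rad m\<close> and the
  ordinates follow along \<sigma>, with vertical deviation 0. The pairs in \<open>F\<close> do not
  depend on the choice of the abscissas.\<close>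

lemma planar_robust:
  obtains x y \<sigma> :: "nat \<Rightarrow> real" and F :: "(nat \<times> nat) set" where
    "F \<subseteq> {..<npts m} \<times> {..<npts m}" "card F = nedges m"
    "\<And>i j. (i, j) \<in> F \<Longrightarrow> i \<noteq> j \<and> (j, i) \<notin> F" "\<And>i. i < npts m \<Longrightarrow> \<bar>x i\<bar> \<le> 2"
    "\<And>X i j. (\<And>l. l < npts m \<Longrightarrow> \<bar>X l - x l\<bar> \<le> rad m) \<Longrightarrow> (i, j) \<in> F \<Longrightarrow>
        halving_pair (npts m) X (\<lambda>l. y l + \<sigma> l * (X l - x l)) i j"
proof -
  obtain V Z E x y \<sigma> g s where C: "halving_config V Z E x y \<sigma> g s (rad m) (bnd m) (8 ^ m)"
    and card: "card (V \<union> Z) = npts m" "card E = nedges m" using iterate by blast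
  interpret halving_config V Z E x y \<sigma> g s "rad m" "bnd m" "8 ^ m" by fact
  define n where "n = npts m"
  obtain f where f: "bij_betw f {..<n} (V \<union> Z)"
    using ex_bij_betw_nat_finite[of "V \<union> Z"] finV finZ card unfolding n_def atLeast0LessThan by auto
  define F where "F = {(i, j). i < n \<and> j < n \<and> (f i, f j) \<in> E}"
  have inj: "inj_on f {..<n}" and im: "f ` {..<n} = V \<union> Z" using f by (auto simp: bij_betw_def)
  have wpos: "width V g s (rad m) (bnd m) p \<ge> 0" if "p \<in> V \<union> Z" for p
    using that gpos[of p] spos[of p] B1 rpos by (auto simp: width_def)
  show thesis
  proof (rule that[where F = F and x = "\<lambda>i. x (f i)" and \<sigma> = "\<lambda>i. \<sigma> (f i)" and y = "\<lambda>i. y (f i)"])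
    show "F \<subseteq> {..<npts m} \<times> {..<npts m}" by (auto simp: F_def n_def)
    have "bij_betw (map_prod f f) F E" unfolding bij_betw_def
    proof
      show "inj_on (map_prod f f) F" using inj by (auto simp: inj_on_def F_def)
      show "map_prod f f ` F = E"
      proof
        show "E \<subseteq> map_prod f f ` F"
        proof
          fix e assume e: "e \<in> E"
          then obtain u z where uz: "e = (u, z)" "u \<in> V" "z \<in> Z" using EVZ by auto
          have "u \<in> f ` {..<n}" "z \<in> f ` {..<n}" using uz im by auto
          then obtain i j where "i < n" "j < n" "u = f i" "z = f j" by auto
          thus "e \<in> map_prod f f ` F" using e uz by (force simp: F_def)
        qed
      qed (auto simp: F_def)
    qed
    thus "card F = nedges m" using bij_betw_same_card card by metis
    show "i \<noteq> j \<and> (j, i) \<notin> F" if "(i, j) \<in> F" for i j using that EVZ disj by (auto simp: F_def)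
    show "\<bar>x (f i)\<bar> \<le> 2" if "i < npts m" for i
    proof -
      have "f i \<in> V \<union> Z" using im that unfolding n_def by blast
      from xr[OF this] rpos show ?thesis by linarith
    qed
  next
    fix X :: "nat \<Rightarrow> real" and i j :: nat
    assume X: "\<And>l. l < npts m \<Longrightarrow> \<bar>X l - x (f l)\<bar> \<le> rad m" and ij: "(i, j) \<in> F"
    from ij have ij: "i < n" "j < n" and e: "(f i, f j) \<in> E" by (auto simp: F_def)
    have X: "\<bar>X l - x (f l)\<bar> \<le> rad m" if "l < n" for l using X that by (simp add: n_def)
    define Y where "Y l = y (f l) + \<sigma> (f l) * (X l - x (f l))" for l
    have ne: "X i \<noteq> X j" using len[OF e] X[OF ij(1)] X[OF ij(2)] rpos by auto
    define \<alpha> where "\<alpha> = (Y i - Y j) / (X i - X j)"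
    define \<beta> where "\<beta> = Y j - \<alpha> * X j"
    have Yij: "Y i = \<alpha> * X i + \<beta>" "Y j = \<alpha> * X j + \<beta>"
    proof -
      have "\<alpha> * (X i - X j) = Y i - Y j" using ne by (simp add: \<alpha>_def)
      thus "Y i = \<alpha> * X i + \<beta>" by (simp add: \<beta>_def algebra_simps)
    qed (simp add: \<beta>_def)
    have meets: "meets x y \<sigma> (width V g s (rad m) (bnd m)) (rad m) \<alpha> \<beta> (f k)" if "k = i \<or> k = j" for k
      unfolding meets_def
      by (rule exI[of _ "X k - x (f k)"], rule exI[of _ 0])
         (use that X ij im wpos Yij in \<open>auto simp: Y_def\<close>)
    from robust[OF e] obtain \<epsilon> where \<epsilon>: "sum \<epsilon> (V \<union> Z) = 0" "\<epsilon> (f i) = 0" "\<epsilon> (f j) = 0" "\<forall>p\<in>V \<union> Z - {f i, f j}. \<epsilon> p \<noteq> 0"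
      and rob0: "\<forall>m' b. meets x y \<sigma> (width V g s (rad m) (bnd m)) (rad m) m' b (f i) \<longrightarrow>
         meets x y \<sigma> (width V g s (rad m) (bnd m)) (rad m) m' b (f j) \<longrightarrow>
         (\<forall>p \<in> V \<union> Z - {f i, f j}. \<forall>h t. \<bar>h\<bar> \<le> rad m \<longrightarrow> \<bar>t\<bar> \<le> width V g s (rad m) (bnd m) p \<longrightarrow>
             sgn (y p + \<sigma> p * h + t - (m' * (x p + h) + b)) = \<epsilon> p)"
      by (elim exE conjE)
    have rob: "sgn (y p + \<sigma> p * h + t - (\<alpha> * (x p + h) + \<beta>)) = \<epsilon> p"
      if "p \<in> V \<union> Z - {f i, f j}" "\<bar>h\<bar> \<le> rad m" "\<bar>t\<bar> \<le> width V g s (rad m) (bnd m) p" for p h t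
      using rob0[rule_format, OF meets[of i] meets[of j] that] by simp
    have sgn_Y: "sgn (Y l - (\<alpha> * X l + \<beta>)) = \<epsilon> (f l)" if l: "l < n" for l
    proof (cases "l = i \<or> l = j")
      case True thus ?thesis using Yij \<epsilon> by auto
    next
      case False
      hence "f l \<in> V \<union> Z - {f i, f j}" using l ij im inj by (auto simp: inj_on_def)
      from rob[OF this, of "X l - x (f l)" 0] show ?thesis using X[OF l] wpos[of "f l"] im l by (auto simp: Y_def)
    qed
    have s0: "(\<Sum>l<n. sgn (Y l - (\<alpha> * X l + \<beta>))) = 0"
    proof -
      have "(\<Sum>l<n. sgn (Y l - (\<alpha> * X l + \<beta>))) = (\<Sum>l<n. \<epsilon> (f l))" using sgn_Y by (intro sum.cong) auto
      also have "\<dots> = sum \<epsilon> (V \<union> Z)" using f by (rule sum.reindex_bij_betw)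
      finally show ?thesis using \<epsilon> by simp
    qed
    have nz: "Y l \<noteq> \<alpha> * X l + \<beta>" if l: "l < n" "l \<noteq> i" "l \<noteq> j" for l
    proof -
      have "f l \<in> V \<union> Z - {f i, f j}" using l ij im inj by (auto simp: inj_on_def)
      hence "\<epsilon> (f l) \<noteq> 0" using \<epsilon> by blast
      thus ?thesis using sgn_Y[OF l(1)] by auto
    qed
    show "halving_pair (npts m) X (\<lambda>l. y (f l) + \<sigma> (f l) * (X l - x (f l))) i j"
      unfolding halving_pair_def Y_def[symmetric] n_def[symmetric] using ne Yij nz s0 by blast
  qed
qed

lemma rad_pos: "rad m > 0" by (induction m) auto
lemma npts_pos: "npts m > 0" by (induction m) auto

definition nshift :: "nat \<Rightarrow> nat" where "nshift m = nat \<lfloor>4 / rad m\<rfloor> + 1"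

text \<open>
  Translating the planar set by the \<open>nshift m\<close> multiples of \<open>rad m\<close> puts at most \<open>npts m\<close> points
  into each window of width \<open>rad m\<close>, and robustness lets them be spread out evenly there.
\<close>

lemma row_packing:
  fixes M m :: nat
  assumes M: "M \<ge> 1"
  defines "R \<equiv> M * nshift m" and "n \<equiv> npts m"
  obtains X Y :: "nat \<Rightarrow> nat \<Rightarrow> real" and F :: "(nat \<times> nat) set" where
    "F \<subseteq> {..<n} \<times> {..<n}" "card F = nedges m" "\<And>i j. (i, j) \<in> F \<Longrightarrow> i \<noteq> j \<and> (j, i) \<notin> F"
    "\<And>t i. t < R \<Longrightarrow> i < n \<Longrightarrow> 1 \<le> X t i \<and> X t i \<le> 2"
    "\<And>t i t' i'. t < R \<Longrightarrow> i < n \<Longrightarrow> t' < R \<Longrightarrow> i' < n \<Longrightarrow> (t, i) \<noteq> (t', i') \<Longrightarrow>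
        1 / real (2 * R * n) \<le> \<bar>X t i - X t' i'\<bar>"
    "\<And>t i j. t < R \<Longrightarrow> (i, j) \<in> F \<Longrightarrow> halving_pair n (X t) (Y t) i j"
proof -
  obtain x y \<sigma> :: "nat \<Rightarrow> real" and F :: "(nat \<times> nat) set" where
    F: "F \<subseteq> {..<n} \<times> {..<n}" "card F = nedges m" "\<And>i j. (i, j) \<in> F \<Longrightarrow> i \<noteq> j \<and> (j, i) \<notin> F"
    and x2: "\<And>i. i < n \<Longrightarrow> \<bar>x i\<bar> \<le> 2"
    and hp: "\<And>X i j. (\<And>l. l < n \<Longrightarrow> \<bar>X l - x l\<bar> \<le> rad m) \<Longrightarrow> (i, j) \<in> F \<Longrightarrow>
        halving_pair n X (\<lambda>l. y l + \<sigma> l * (X l - x l)) i j"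
    by (rule planar_robust[of m, folded n_def]) blast
  define r where "r = rad m"
  define L where "L = nshift m"
  have r: "r > 0" using rad_pos r_def by simp
  have n: "n > 0" using npts_pos n_def by simp
  have L: "L \<ge> 1" by (simp add: L_def nshift_def)
  have RM: "R = M * L" by (simp add: R_def L_def)
  have R: "R > 0" using RM M L by simp
  \<comment> \<open>The line from -2 to 2 is cut into windows of width \<open>r\<close>;
    \<open>w i\<close> is the window of \<open>x i\<close>.\<close>
  define w where "w i = nat \<lfloor>(x i + 2) / r\<rfloor>" for i
  have w: "real (w i) \<le> (x i + 2) / r" "(x i + 2) / r < real (w i) + 1" "w i < L" if "i < n" for i
  proof -
    have p: "(x i + 2) / r \<ge> 0" using x2[OF that] r by auto
    thus "real (w i) \<le> (x i + 2) / r" "(x i + 2) / r < real (w i) + 1" unfolding w_def by linarith+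
    have "(x i + 2) / r \<le> 4 / r" using x2[OF that] r by (intro divide_right_mono) auto
    hence "w i \<le> nat \<lfloor>4 / r\<rfloor>" unfolding w_def by (intro nat_mono floor_mono)
    thus "w i < L" unfolding L_def nshift_def r_def by simp
  qed
  \<comment> \<open>Point \<open>i\<close> goes to the \<open>i\<close>-th of \<open>n\<close>
    equally spaced places in its own window, hence moves by at most \<open>r\<close>.\<close>
  define X0 where "X0 i = (real (w i) + real i / real n) * r - 2" for i
  have X0: "\<bar>X0 i - x i\<bar> \<le> r" if "i < n" for i
  proof -
    have i: "0 \<le> real i / real n" "real i / real n \<le> 1" using that n by auto
    have "real (w i) * r \<le> x i + 2" "x i + 2 < (real (w i) + 1) * r"
      using w[OF that] r by (auto simp: field_simps)
    moreover have "0 \<le> real i / real n * r" "real i / real n * r \<le> r"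
      using mult_right_mono[OF i(1), of r] mult_right_mono[OF i(2), of r] r by auto
    ultimately show ?thesis unfolding X0_def abs_le_iff distrib_right by linarith
  qed
  \<comment> \<open>Copy \<open>t\<close> is translated by \<open>t mod L\<close> windows within
    block \<open>t div L\<close>. As both \<open>t mod L\<close> and \<open>w i\<close> are below
    \<open>L\<close>, a block of \<open>2 * L\<close> windows suffices. No two points share a slot:
    the remainder modulo \<open>n\<close> reveals \<open>i\<close>, and then the window reveals the
    translation.\<close>
  define slot where "slot t i = (2 * L * (t div L) + t mod L + w i) * n + i" for t i
  define N where "N = 2 * R * n"
  have N: "N > 0" using R n by (simp add: N_def)
  have slotN: "slot t i < N" if "t < R" "i < n" for t i
  proof -
    have "t div L < M" using that RM L by (simp add: less_mult_imp_div_less)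
    hence "t div L + 1 \<le> M" by simp
    hence "2 * L * (t div L + 1) \<le> 2 * L * M" by (intro mult_left_mono) auto
    hence "2 * L * (t div L) + 2 * L \<le> 2 * L * M" by simp
    moreover have "t mod L < L" "w i < L" using L w that by auto
    ultimately have "2 * L * (t div L) + t mod L + w i + 1 \<le> 2 * L * M" by linarith
    hence "2 * L * (t div L) + t mod L + w i + 1 \<le> 2 * R" unfolding RM by (simp add: mult_ac)
    hence "(2 * L * (t div L) + t mod L + w i + 1) * n \<le> 2 * R * n" by (intro mult_right_mono) auto
    thus ?thesis using that unfolding slot_def N_def by (simp add: algebra_simps)
  qed
  have inj: "t = t' \<and> i = i'" if "slot t i = slot t' i'" "i < n" "i' < n" for t i t' i'
  proof -
    have "slot t i mod n = i" "slot t' i' mod n = i'" using that(2,3) unfolding slot_def by simp_all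
    hence i: "i = i'" using that(1) by simp
    have "2 * L * (t div L) + t mod L = 2 * L * (t' div L) + t' mod L"
      using that(1) n unfolding slot_def i by simp
    hence *: "t mod L + (2 * L) * (t div L) = t' mod L + (2 * L) * (t' div L)" by simp
    have "t mod L < 2 * L" "t' mod L < 2 * L" using L by (auto intro: less_le_trans[OF mod_less_divisor])
    hence "t mod L = t' mod L" using arg_cong[OF *, of "\<lambda>s. s mod (2 * L)"] by simp
    moreover from this have "t div L = t' div L" using * L by simp
    ultimately show ?thesis using i by (metis div_mult_mod_eq)
  qed
  define X where "X t i = 1 + real (slot t i) / real N" for t i
  show thesis
  proof (rule that[OF F, of X "\<lambda>_ l. y l + \<sigma> l * (X0 l - x l)"])
    show "1 \<le> X t i \<and> X t i \<le> 2" if "t < R" "i < n" for t i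
      using slotN[OF that] by (simp add: X_def)
    show "1 / real (2 * R * n) \<le> \<bar>X t i - X t' i'\<bar>"
      if "t < R" "i < n" "t' < R" "i' < n" "(t, i) \<noteq> (t', i')" for t i t' i'
    proof -
      have "slot t i \<noteq> slot t' i'" using inj that by blast
      hence "1 \<le> \<bar>real (slot t i) - real (slot t' i')\<bar>" by linarith
      hence "1 / real N \<le> \<bar>real (slot t i) - real (slot t' i')\<bar> / real N" by (intro divide_right_mono) auto
      also have "\<dots> = \<bar>X t i - X t' i'\<bar>" by (simp add: X_def diff_divide_distrib[symmetric])
      finally show ?thesis unfolding N_def .
    qed
    show "halving_pair n (X t) (\<lambda>l. y l + \<sigma> l * (X0 l - x l)) i j" if "t < R" "(i, j) \<in> F" for t i j
    proof (rule halving_pair_affine[OF hp[of X0]])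
      show "real n / (r * real N) \<noteq> 0" using n N r by simp
      fix l assume "l < n"
      \<comment> \<open>The final abscissas of one copy are a single affine function of
        \<open>X0\<close>, so its halving pairs survive.\<close>
      define T where "T = real (2 * L * (t div L) + t mod L)"
      show "X t l = real n / (r * real N) * X0 l + (1 + (real n * T + real n * 2 / r) / real N)"
        unfolding X_def slot_def X0_def T_def using n N r by (simp add: field_simps)
    qed (use X0 that F r_def in auto)
  qed
qed

section \<open>General position and stability of halving hyperplanes\<close>

text \<open>Unlike general position this says something about small sets as well, so that it can be
  maintained while points are added one at a time.\<close>

definition affinely_generic :: "'a::euclidean_space set \<Rightarrow> bool" where
  "affinely_generic Q \<longleftrightarrow> (\<forall>S\<subseteq>Q. finite S \<longrightarrow> card S \<le> DIM('a) + 1 \<longrightarrow> \<not> affine_dependent S)"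

lemma affinely_generic_insert:
  fixes x :: "'a::euclidean_space"
  assumes Q: "affinely_generic Q"
    and x: "\<And>S. S \<subseteq> Q \<Longrightarrow> finite S \<Longrightarrow> card S \<le> DIM('a) \<Longrightarrow> x \<notin> affine hull S"
  shows "affinely_generic (insert x Q)"
  unfolding affinely_generic_def
proof (intro allI impI)
  fix S assume S: "S \<subseteq> insert x Q" "finite S" "card S \<le> DIM('a) + 1"
  show "\<not> affine_dependent S"
  proof (cases "x \<in> S")
    case False
    thus ?thesis using Q S unfolding affinely_generic_def by blast
  next
    case True
    have T: "S - {x} \<subseteq> Q" "finite (S - {x})" "card (S - {x}) \<le> DIM('a)" using S True by auto
    have "\<not> affine_dependent (insert x (S - {x}))"
      using Q T x[OF T] unfolding affinely_generic_def by (intro affine_independent_insert) auto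
    thus ?thesis using True by (simp add: insert_absorb)
  qed
qed

text \<open>Affine hulls of at most \<open>DIM('a)\<close> points are null sets, and finitely many
  of them cannot cover a ball.\<close>

lemma near_point_avoiding_hulls:
  fixes p :: "'a::euclidean_space"
  assumes Q: "finite Q" and e: "e > 0"
  obtains x where "dist x p < e" "\<And>S. S \<subseteq> Q \<Longrightarrow> card S \<le> DIM('a) \<Longrightarrow> x \<notin> affine hull S"
proof -
  have "negligible (affine hull S)" if S: "S \<subseteq> Q" "card S \<le> DIM('a)" for S
  proof -
    have "finite S" using S Q finite_subset by blast
    hence "aff_dim S \<le> int (card S) - 1" by (rule aff_dim_le_card)
    hence "aff_dim (affine hull S) < int DIM('a)" using S by simp
    then obtain a b where "a \<noteq> 0" "affine hull S \<subseteq> {x. a \<bullet> x = b}" by (rule aff_lowdim_subset_hyperplane)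
    thus ?thesis using negligible_hyperplane negligible_subset by blast
  qed
  hence "negligible (\<Union>((\<lambda>S. affine hull S) ` {S. S \<subseteq> Q \<and> card S \<le> DIM('a)}))"
    using Q by (intro negligible_Union) auto
  hence "\<not> ball p e \<subseteq> \<Union>((\<lambda>S. affine hull S) ` {S. S \<subseteq> Q \<and> card S \<le> DIM('a)})"
    using open_not_negligible[of "ball p e"] e negligible_subset by auto
  then obtain x where "x \<in> ball p e" "x \<notin> \<Union>((\<lambda>S. affine hull S) ` {S. S \<subseteq> Q \<and> card S \<le> DIM('a)})" by blast
  thus thesis by (intro that[of x]) (auto simp: dist_commute)
qed

text \<open>The set \<open>Q\<close> stays fixed. With \<open>Q = {0}\<close> the perturbed points
  become generic as vectors too, see \<open>affinely_generic_imp_independent\<close>.\<close>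

lemma generic_perturbation:
  fixes P :: "'i \<Rightarrow> 'a::euclidean_space"
  assumes "finite I" "finite Q" "affinely_generic Q" "e > 0"
  shows "\<exists>P'. (\<forall>i\<in>I. dist (P' i) (P i) < e) \<and> inj_on P' I \<and> P' ` I \<inter> Q = {} \<and> affinely_generic (Q \<union> P' ` I)"
  using assms(1)
proof induction
  case empty
  show ?case using assms(3) by auto
next
  case (insert i I)
  then obtain P' where P': "\<forall>i\<in>I. dist (P' i) (P i) < e" "inj_on P' I" "P' ` I \<inter> Q = {}" "affinely_generic (Q \<union> P' ` I)"
    by blast
  obtain x where x: "dist x (P i) < e" "\<And>S. S \<subseteq> Q \<union> P' ` I \<Longrightarrow> card S \<le> DIM('a) \<Longrightarrow> x \<notin> affine hull S"
    using near_point_avoiding_hulls[of "Q \<union> P' ` I" e "P i"] assms insert.hyps by blast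
  have x_new: "x \<notin> Q \<union> P' ` I"
  proof
    assume "x \<in> Q \<union> P' ` I"
    thus False using x(2)[of "{x}"] by simp
  qed
  have im: "(P'(i := x)) ` I = P' ` I" using insert.hyps by auto
  have "affinely_generic (insert x (Q \<union> P' ` I))"
    using affinely_generic_insert[OF P'(4)] x(2) by blast
  moreover have "inj_on (P'(i := x)) (insert i I)"
    using P'(2) insert.hyps x_new by (auto simp: inj_on_def)
  moreover have "\<forall>j\<in>insert i I. dist ((P'(i := x)) j) (P j) < e" using P'(1) x(1) by auto
  moreover have "(P'(i := x)) ` insert i I = insert x (P' ` I)" by (simp only: image_insert im fun_upd_same)
  moreover have "insert x (P' ` I) \<inter> Q = {}" "Q \<union> insert x (P' ` I) = insert x (Q \<union> P' ` I)"
    using P'(3) x_new by auto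
  ultimately show ?case by (intro exI[of _ "P'(i := x)"] conjI) (simp_all only:)
qed

lemma affinely_generic_imp_general_position:
  fixes Q :: "'a::euclidean_space set"
  assumes "affinely_generic Q"
  shows "general_position Q"
  unfolding general_position_def
proof (intro allI impI notI)
  fix S assume S: "S \<subseteq> Q \<and> card S = DIM('a) + 1" and "\<exists>H. hyperplane H \<and> S \<subseteq> H"
  then obtain a b where ab: "a \<noteq> 0" "S \<subseteq> {x. a \<bullet> x = b}" unfolding hyperplane_def by blast
  have "finite S" using S card.infinite by fastforce
  hence "\<not> affine_dependent S" using assms S unfolding affinely_generic_def by auto
  hence "aff_dim S = int DIM('a)" using aff_dim_affine_independent S by fastforce
  thus False using aff_dim_subset[OF ab(2)] aff_dim_hyperplane[OF ab(1)] by simp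
qed

lemma affinely_generic_imp_independent:
  fixes Q :: "'a::euclidean_space set"
  assumes "affinely_generic (insert 0 Q)" "S \<subseteq> Q" "finite S" "card S \<le> DIM('a)" "0 \<notin> Q"
  shows "independent S"
proof -
  have "0 \<notin> S" using assms by auto
  hence "\<not> affine_dependent (insert 0 S)"
    using assms unfolding affinely_generic_def by (simp add: subset_insertI2 insert_mono)
  thus ?thesis using affine_dependent_iff_dependent[OF \<open>0 \<notin> S\<close>] by simp
qed

text \<open>The last clause makes the hyperplane through the points of \<open>S\<close> unique.
  Stated for equations, it can be checked directly for the explicit hyperplanes below and fits the
  compactness argument of \<open>halving_stable\<close>.\<close>

definition strict_halving :: "'i set \<Rightarrow> ('i \<Rightarrow> 'a::euclidean_space) \<Rightarrow> 'i set \<Rightarrow> bool" where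
  "strict_halving I P S \<longleftrightarrow> S \<subseteq> I \<and> card S = DIM('a) \<and>
     (\<exists>a c. a \<noteq> 0 \<and> (\<forall>i\<in>S. a \<bullet> P i = c) \<and> (\<forall>i\<in>I - S. a \<bullet> P i \<noteq> c) \<and> (\<Sum>i\<in>I. sgn (a \<bullet> P i - c)) = 0 \<and>
        (\<forall>a' c'. (\<forall>i\<in>S. a' \<bullet> P i = c') \<longrightarrow> (\<exists>k. a' = k *\<^sub>R a \<and> c' = k * c)))"

lemma unit_normal_through:
  fixes P :: "'i \<Rightarrow> 'a::euclidean_space"
  assumes S: "finite S" "card S = DIM('a)"
  obtains a c where "norm a = 1" "\<forall>i\<in>S. a \<bullet> P i = c"
proof -
  have "card (P ` S) \<le> DIM('a)" using card_image_le[OF S(1)] S(2) by metis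
  hence "aff_dim (P ` S) < int DIM('a)" using aff_dim_le_card[of "P ` S"] S by simp
  then obtain a b where ab: "a \<noteq> 0" "P ` S \<subseteq> {x. a \<bullet> x = b}" by (rule aff_lowdim_subset_hyperplane)
  show thesis by (rule that[of "a /\<^sub>R norm a" "b / norm a"]) (use ab in \<open>auto simp: field_simps\<close>)
qed

text \<open>Otherwise there is a sequence of ever smaller bad perturbations. Unit normals of
  hyperplanes through the perturbed \<open>S\<close> have a convergent subsequence, whose limit is
  by uniqueness a multiple of \<open>a\<close>; strict inequalities at the limit then hold along the
  subsequence.\<close>

lemma halving_stable:
  fixes P :: "'i \<Rightarrow> 'a::euclidean_space"
  assumes I: "finite I" and S: "S \<subseteq> I" "card S = DIM('a)"
    and a: "a \<noteq> 0" "\<forall>i\<in>S. a \<bullet> P i = c" "\<forall>i\<in>I - S. a \<bullet> P i \<noteq> c"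
    and uniq: "\<And>a' c'. (\<forall>i\<in>S. a' \<bullet> P i = c') \<Longrightarrow> \<exists>k. a' = k *\<^sub>R a \<and> c' = k * c"
  shows "\<exists>e>0. \<forall>P'. (\<forall>i\<in>I. dist (P' i) (P i) < e) \<longrightarrow>
    (\<exists>a' c'. a' \<noteq> 0 \<and> (\<forall>i\<in>S. a' \<bullet> P' i = c') \<and> (\<forall>i\<in>I - S. sgn (a' \<bullet> P' i - c') = sgn (a \<bullet> P i - c)))"
proof (rule ccontr)
  let ?good = "\<lambda>P'. \<exists>a' c'. a' \<noteq> 0 \<and> (\<forall>i\<in>S. a' \<bullet> P' i = c') \<and> (\<forall>i\<in>I - S. sgn (a' \<bullet> P' i - c') = sgn (a \<bullet> P i - c))"
  assume "\<not> ?thesis"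
  hence neg: "\<exists>P'. (\<forall>i\<in>I. dist (P' i) (P i) < e) \<and> \<not> ?good P'" if "e > 0" for e using that by blast
  have "\<forall>n::nat. \<exists>P'. (\<forall>i\<in>I. dist (P' i) (P i) < 1 / real (Suc n)) \<and> \<not> ?good P'"
    using neg by simp
  then obtain Q :: "nat \<Rightarrow> 'i \<Rightarrow> 'a" where Q: "\<And>n i. i \<in> I \<Longrightarrow> dist (Q n i) (P i) < 1 / real (Suc n)" "\<And>n. \<not> ?good (Q n)"
    by metis
  have finS: "finite S" using I S finite_subset by blast
  have Qlim: "(\<lambda>n. Q n i) \<longlonglongrightarrow> P i" if "i \<in> I" for i
  proof (rule metric_tendsto_imp_tendsto[OF LIMSEQ_Suc[OF lim_1_over_n]])
    show "\<forall>\<^sub>F n in sequentially. dist (Q n i) (P i) \<le> dist (1 / real (Suc n)) 0"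
      using Q(1)[OF that] by (intro always_eventually allI) (simp add: less_imp_le)
  qed
  have "\<forall>n. \<exists>u c. norm u = 1 \<and> (\<forall>i\<in>S. u \<bullet> Q n i = c)"
    using unit_normal_through[OF finS S(2)] by metis
  then obtain u k where u: "\<And>n. norm (u n) = 1" "\<And>n i. i \<in> S \<Longrightarrow> u n \<bullet> Q n i = k n" by metis
  have "u n \<in> sphere 0 1" for n using u by simp
  then obtain u0 f where u0: "u0 \<in> sphere 0 1" and f: "strict_mono (f :: nat \<Rightarrow> nat)" and ul: "(u \<circ> f) \<longlonglongrightarrow> u0"
    using compact_sphere[of "0 :: 'a" 1] unfolding compact_def by metis
  have lim: "(\<lambda>n. u (f n) \<bullet> Q (f n) i) \<longlonglongrightarrow> u0 \<bullet> P i" if "i \<in> I" for i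
    using ul LIMSEQ_subseq_LIMSEQ[OF Qlim[OF that] f] unfolding o_def by (intro tendsto_inner)
  obtain i0 where i0: "i0 \<in> S" using S finS by fastforce
  define k0 where "k0 = u0 \<bullet> P i0"
  have klim: "(\<lambda>n. k (f n)) \<longlonglongrightarrow> k0" using lim[of i0] i0 S u(2)[OF i0] unfolding k0_def by auto
  have "\<forall>i\<in>S. u0 \<bullet> P i = k0"
  proof
    fix i assume i: "i \<in> S"
    have "(\<lambda>n. k (f n)) \<longlonglongrightarrow> u0 \<bullet> P i" using lim[of i] i S u(2)[OF i] by auto
    thus "u0 \<bullet> P i = k0" using klim LIMSEQ_unique by blast
  qed
  from uniq[OF this] obtain t where t: "u0 = t *\<^sub>R a" "k0 = t * c" by blast
  \<comment> \<open>\<open>t\<close> may be negative, the limit having the opposite orientation;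
    dividing by \<open>t\<close> restores the signs.\<close>
  have t0: "t \<noteq> 0" using t u0 by auto
  have "\<forall>\<^sub>F n in sequentially. sgn ((u (f n) \<bullet> Q (f n) i - k (f n)) / t) = sgn (a \<bullet> P i - c)" if i: "i \<in> I - S" for i
  proof -
    have "(\<lambda>n. (u (f n) \<bullet> Q (f n) i - k (f n)) / t) \<longlonglongrightarrow> (u0 \<bullet> P i - k0) / t"
      using i t0 by (intro tendsto_divide tendsto_diff lim klim tendsto_const) auto
    also have "(u0 \<bullet> P i - k0) / t = a \<bullet> P i - c" using t t0 by (simp add: field_simps)
    finally have L: "(\<lambda>n. (u (f n) \<bullet> Q (f n) i - k (f n)) / t) \<longlonglongrightarrow> a \<bullet> P i - c" .
    have "a \<bullet> P i - c \<noteq> 0" using a(3) i by auto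
    then consider "a \<bullet> P i - c > 0" | "a \<bullet> P i - c < 0" by linarith
    thus ?thesis
    proof cases
      case 1 from order_tendstoD(1)[OF L 1] show ?thesis by eventually_elim (use 1 in \<open>simp only: sgn_pos\<close>)
    next
      case 2 from order_tendstoD(2)[OF L 2] show ?thesis by eventually_elim (use 2 in \<open>simp only: sgn_neg\<close>)
    qed
  qed
  hence "\<forall>\<^sub>F n in sequentially. \<forall>i\<in>I - S. sgn ((u (f n) \<bullet> Q (f n) i - k (f n)) / t) = sgn (a \<bullet> P i - c)"
    using I by (intro eventually_ball_finite) auto
  then obtain n where n: "\<forall>i\<in>I - S. sgn ((u (f n) \<bullet> Q (f n) i - k (f n)) / t) = sgn (a \<bullet> P i - c)"
    using eventually_happens'[OF sequentially_bot] by blast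
  have "?good (Q (f n))"
  proof (intro exI conjI)
    show "u (f n) /\<^sub>R t \<noteq> 0" using u(1)[of "f n"] t0 by auto
    show "\<forall>i\<in>S. (u (f n) /\<^sub>R t) \<bullet> Q (f n) i = k (f n) / t" using u(2) by (simp add: field_simps)
    show "\<forall>i\<in>I - S. sgn ((u (f n) /\<^sub>R t) \<bullet> Q (f n) i - k (f n) / t) = sgn (a \<bullet> P i - c)"
    proof
      fix i assume i: "i \<in> I - S"
      have "(u (f n) /\<^sub>R t) \<bullet> Q (f n) i - k (f n) / t = (u (f n) \<bullet> Q (f n) i - k (f n)) / t"
        using t0 by (simp add: field_simps)
      thus "sgn ((u (f n) /\<^sub>R t) \<bullet> Q (f n) i - k (f n) / t) = sgn (a \<bullet> P i - c)" using n i by (simp only:)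
    qed
  qed
  thus False using Q(2) by blast
qed

lemma sum_sgn_eq_card:
  fixes f :: "'i \<Rightarrow> real"
  assumes "finite I"
  shows "(\<Sum>i\<in>I. sgn (f i)) = real (card {i\<in>I. f i > 0}) - real (card {i\<in>I. f i < 0})"
proof -
  have "(\<Sum>i\<in>I. sgn (f i)) = (\<Sum>i\<in>I. (if f i > 0 then 1 else 0) - (if f i < 0 then 1 else 0))"
    by (intro sum.cong) (auto simp: sgn_if)
  also have "\<dots> = real (card {i\<in>I. f i > 0}) - real (card {i\<in>I. f i < 0})"
    using assms by (simp add: sum_subtractf sum.If_cases Int_def)
  finally show ?thesis .
qed

text \<open>Finitely many strictly halving sets survive a common small perturbation into general
  position. They yield different hyperplanes, because each hyperplane meets the perturbed set
  exactly in the image of its \<open>S\<close>.\<close>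

lemma perturbed_halving:
  fixes P :: "'i \<Rightarrow> 'a::euclidean_space" and \<S> :: "'i set set"
  assumes I: "finite I" and \<S>: "\<And>S. S \<in> \<S> \<Longrightarrow> strict_halving I P S" and e: "e > 0"
  obtains P' where "inj_on P' I" "\<forall>i\<in>I. dist (P' i) (P i) < e" "general_position (P' ` I)"
    "card \<S> \<le> card {H. halving_hyperplane (P' ` I) H}"
proof -
  define good where "good P' S \<longleftrightarrow> (\<exists>a c. a \<noteq> 0 \<and> (\<forall>i\<in>S. a \<bullet> P' i = c) \<and> (\<forall>i\<in>I - S. a \<bullet> P' i \<noteq> c) \<and> (\<Sum>i\<in>I. sgn (a \<bullet> P' i - c)) = 0)"
    for P' :: "'i \<Rightarrow> 'a" and S
  have stable: "\<exists>e>0. \<forall>P'. (\<forall>i\<in>I. dist (P' i) (P i) < e) \<longrightarrow> good P' S" if SS: "S \<in> \<S>" for S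
  proof -
    from \<S>[OF SS] obtain a c where S: "S \<subseteq> I" "card S = DIM('a)" and a: "a \<noteq> 0" "\<forall>i\<in>S. a \<bullet> P i = c" "\<forall>i\<in>I - S. a \<bullet> P i \<noteq> c"
      and s0: "(\<Sum>i\<in>I. sgn (a \<bullet> P i - c)) = 0"
      and uniq: "\<And>a' c'. (\<forall>i\<in>S. a' \<bullet> P i = c') \<Longrightarrow> \<exists>k. a' = k *\<^sub>R a \<and> c' = k * c"
      unfolding strict_halving_def by blast
    from halving_stable[OF I S a uniq] obtain e where e: "e > 0" and st: "\<And>P'. (\<forall>i\<in>I. dist (P' i) (P i) < e) \<Longrightarrow>
      (\<exists>a' c'. a' \<noteq> 0 \<and> (\<forall>i\<in>S. a' \<bullet> P' i = c') \<and> (\<forall>i\<in>I - S. sgn (a' \<bullet> P' i - c') = sgn (a \<bullet> P i - c)))" by blast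
    show ?thesis
    proof (intro exI[of _ e] conjI e allI impI)
      fix P' assume "\<forall>i\<in>I. dist (P' i) (P i) < e"
      from st[OF this] obtain a' c' where a': "a' \<noteq> 0" "\<forall>i\<in>S. a' \<bullet> P' i = c'"
        "\<forall>i\<in>I - S. sgn (a' \<bullet> P' i - c') = sgn (a \<bullet> P i - c)" by blast
      have "sgn (a' \<bullet> P' i - c') = sgn (a \<bullet> P i - c)" if "i \<in> I" for i using that a' a by (cases "i \<in> S") auto
      hence "(\<Sum>i\<in>I. sgn (a' \<bullet> P' i - c')) = 0" using s0 by simp
      moreover have "\<forall>i\<in>I - S. a' \<bullet> P' i \<noteq> c'"
      proof
        fix i assume i: "i \<in> I - S"
        hence "sgn (a' \<bullet> P' i - c') \<noteq> 0" using a'(3) a(3) by (simp add: sgn_zero_iff)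
        thus "a' \<bullet> P' i \<noteq> c'" by auto
      qed
      ultimately show "good P' S" unfolding good_def using a' by blast
    qed
  qed
  have "\<exists>es. \<forall>S\<in>\<S>. es S > 0 \<and> (\<forall>P'. (\<forall>i\<in>I. dist (P' i) (P i) < es S) \<longrightarrow> good P' S)"
    using stable by (intro bchoice) blast
  then obtain es where es0: "\<forall>S\<in>\<S>. es S > 0 \<and> (\<forall>P'. (\<forall>i\<in>I. dist (P' i) (P i) < es S) \<longrightarrow> good P' S)" by blast
  have es: "\<And>S. S \<in> \<S> \<Longrightarrow> es S > 0" using es0 by blast
  have esg: "\<And>S P'. S \<in> \<S> \<Longrightarrow> (\<forall>i\<in>I. dist (P' i) (P i) < es S) \<Longrightarrow> good P' S" using es0 by blast
  have fin\<S>: "finite \<S>" using \<S> I unfolding strict_halving_def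
    by (intro finite_subset[of \<S> "Pow I"]) blast+
  define e' where "e' = Min (insert e (es ` \<S>))"
  have e'0: "e' > 0" and e'e: "e' \<le> e" and e's: "\<And>S. S \<in> \<S> \<Longrightarrow> e' \<le> es S"
    using fin\<S> es e unfolding e'_def by (auto simp: Min_gr_iff)
  have "affinely_generic ({} :: 'a set)" unfolding affinely_generic_def by (auto simp: affine_dependent_def)
  from generic_perturbation[OF I finite.emptyI this e'0] obtain P' where P': "\<forall>i\<in>I. dist (P' i) (P i) < e'" "inj_on P' I"
    "affinely_generic (P' ` I)" by auto
  define Q where "Q = P' ` I"
  have gen: "\<exists>H. halving_hyperplane Q H \<and> H \<inter> Q = P' ` S" if SS: "S \<in> \<S>" for S
  proof -
    have S: "S \<subseteq> I" "card S = DIM('a)" using \<S>[OF SS] unfolding strict_halving_def by auto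
    have finS: "finite S" using S I finite_subset by blast
    have "\<forall>i\<in>I. dist (P' i) (P i) < es S" using P'(1) e's[OF SS] by force
    from esg[OF SS this] obtain a c where a: "a \<noteq> 0" "\<forall>i\<in>S. a \<bullet> P' i = c" "\<forall>i\<in>I - S. a \<bullet> P' i \<noteq> c"
      and s0: "(\<Sum>i\<in>I. sgn (a \<bullet> P' i - c)) = 0" unfolding good_def by blast
    define H where "H = {x. a \<bullet> x = c}"
    have injS: "inj_on P' S" using P'(2) S inj_on_subset by blast
    have cS: "card (P' ` S) = DIM('a)" using card_image[OF injS] S by simp
    have "P' ` S \<subseteq> P' ` I" "finite (P' ` S)" "card (P' ` S) \<le> DIM('a) + 1" using S finS cS by auto
    hence ind: "\<not> affine_dependent (P' ` S)" using P'(3) unfolding affinely_generic_def by blast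
    have sub: "P' ` S \<subseteq> H" using a by (auto simp: H_def)
    have hull: "affine hull (P' ` S) = H"
    proof (rule affine_dim_equal)
      show "affine (affine hull (P' ` S))" "affine H" by (auto simp: H_def affine_hyperplane)
      show "affine hull (P' ` S) \<noteq> {}" using cS by auto
      show "affine hull (P' ` S) \<subseteq> H" using sub by (simp add: H_def affine_hyperplane hull_minimal)
      show "aff_dim (affine hull (P' ` S)) = aff_dim H"
        using aff_dim_affine_independent[OF ind] cS a(1) by (simp add: H_def)
    qed
    have det: "determined_hyperplane Q H" unfolding determined_hyperplane_def Q_def
      using S cS ind hull by (intro exI[of _ "P' ` S"]) auto
    have cQ: "card Q = card I" unfolding Q_def using P'(2) by (rule card_image)
    have lt: "card {x \<in> Q. a \<bullet> x < c} = card {i \<in> I. a \<bullet> P' i - c < 0}"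
      by (rule bij_betw_same_card[symmetric, of P']) (use P'(2) in \<open>auto simp: bij_betw_def inj_on_def Q_def\<close>)
    have gt: "card {x \<in> Q. a \<bullet> x > c} = card {i \<in> I. a \<bullet> P' i - c > 0}"
      by (rule bij_betw_same_card[symmetric, of P']) (use P'(2) in \<open>auto simp: bij_betw_def inj_on_def Q_def\<close>)
    have eq: "card {i \<in> I. a \<bullet> P' i - c < 0} = card {i \<in> I. a \<bullet> P' i - c > 0}"
      using s0 sum_sgn_eq_card[OF I, of "\<lambda>i. a \<bullet> P' i - c"] by linarith
    have "I = S \<union> ({i \<in> I. a \<bullet> P' i - c < 0} \<union> {i \<in> I. a \<bullet> P' i - c > 0})"
      using a S by (auto simp: not_less_iff_gr_or_eq)
    moreover have "S \<inter> ({i \<in> I. a \<bullet> P' i - c < 0} \<union> {i \<in> I. a \<bullet> P' i - c > 0}) = {}" using a by auto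
    ultimately have "card I = card S + card ({i \<in> I. a \<bullet> P' i - c < 0} \<union> {i \<in> I. a \<bullet> P' i - c > 0})"
      using finS I by (metis (no_types, lifting) card_Un_disjoint finite_Un)
    also have "\<dots> = card S + (card {i \<in> I. a \<bullet> P' i - c < 0} + card {i \<in> I. a \<bullet> P' i - c > 0})"
      using I by (subst card_Un_disjoint) auto
    finally have "card I = DIM('a) + 2 * card {i \<in> I. a \<bullet> P' i - c < 0}" using eq S by simp
    hence "halving_hyperplane Q H" unfolding halving_hyperplane_def using det a(1) lt gt eq cQ
      by (intro conjI det exI[of _ a] exI[of _ c]) (auto simp: H_def)
    moreover have "H \<inter> Q = P' ` S" using a S by (auto simp: H_def Q_def)
    ultimately show ?thesis by blast
  qed
  have "\<exists>h. \<forall>S\<in>\<S>. halving_hyperplane Q (h S) \<and> h S \<inter> Q = P' ` S" using gen by (intro bchoice) blast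
  then obtain h where h: "\<And>S. S \<in> \<S> \<Longrightarrow> halving_hyperplane Q (h S) \<and> h S \<inter> Q = P' ` S" by blast
  have "inj_on h \<S>"
  proof (rule inj_onI)
    fix S T assume ST: "S \<in> \<S>" "T \<in> \<S>" "h S = h T"
    hence "P' ` S = P' ` T" using h by metis
    moreover have "S \<subseteq> I" "T \<subseteq> I" using \<S> ST unfolding strict_halving_def by auto
    ultimately show "S = T" using P'(2) inj_on_image_eq_iff by metis
  qed
  \<comment> \<open>The cardinality of an infinite set would be 0, so this is essential for the
    lower bound.\<close>
  moreover have "finite {H. halving_hyperplane Q H}"
  proof (rule finite_subset)
    show "{H. halving_hyperplane Q H} \<subseteq> (\<lambda>S. affine hull S) ` Pow Q"
      unfolding halving_hyperplane_def determined_hyperplane_def by auto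
    show "finite ((\<lambda>S. affine hull S) ` Pow Q)" using I by (simp add: Q_def)
  qed
  moreover have "h ` \<S> \<subseteq> {H. halving_hyperplane Q H}" using h by auto
  ultimately have "card \<S> \<le> card {H. halving_hyperplane Q H}" using card_inj_on_le by blast
  thus thesis using that[of P'] P' e'e affinely_generic_imp_general_position unfolding Q_def by force
qed

section \<open>From planar rows to halving hyperplanes\<close>

lemma inner_interpolation:
  fixes B :: "'a::euclidean_space set"
  assumes "independent B"
  obtains \<nu> where "\<And>x. x \<in> B \<Longrightarrow> \<nu> \<bullet> x = f x"
proof -
  obtain g where g: "linear g" "\<And>x. x \<in> B \<Longrightarrow> g x = f x"
    using linear_independent_extend[OF assms, of f] by blast
  interpret linear g by fact
  have "(\<Sum>b\<in>Basis. g b *\<^sub>R b) \<bullet> x = g x" for x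
  proof -
    have "g x = g (\<Sum>b\<in>Basis. (x \<bullet> b) *\<^sub>R b)" by (simp add: euclidean_representation)
    also have "\<dots> = (\<Sum>b\<in>Basis. g b *\<^sub>R b) \<bullet> x"
      by (simp add: sum scale inner_sum_left inner_commute[of x] mult.commute)
    finally show ?thesis ..
  qed
  thus thesis using that g by metis
qed

lemma orthogonal_to_independent_eq_0:
  fixes B :: "'a::euclidean_space set"
  assumes B: "independent B" "card B = DIM('a)" and x: "\<And>y. y \<in> B \<Longrightarrow> x \<bullet> y = 0"
  shows "x = 0"
proof -
  have "finite B" using B independent_bound by blast
  hence "span B = UNIV" using B card_ge_dim_independent[of B UNIV] by auto
  hence "x \<in> span B" by simp
  hence "orthogonal x x" using x by (intro orthogonal_to_span[of x B x]) (auto simp: orthogonal_def)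
  thus ?thesis by (simp add: orthogonal_self)
qed

lemma eventually_sgn_linear:
  fixes A C :: real
  assumes "A \<noteq> 0"
  shows "\<forall>\<^sub>F \<delta> in at_right 0. sgn (A + \<delta> * C) = sgn A"
proof -
  have L: "((\<lambda>\<delta>. A + \<delta> * C) \<longlongrightarrow> A + 0 * C) (at_right 0)" by (intro tendsto_intros)
  from assms consider "A > 0" | "A < 0" by linarith
  thus ?thesis
  proof cases
    case 1
    hence "\<forall>\<^sub>F \<delta> in at_right 0. 0 < A + \<delta> * C" using order_tendstoD(1)[OF L, of 0] by simp
    thus ?thesis by eventually_elim (use 1 in \<open>simp only: sgn_pos\<close>)
  next
    case 2
    hence "\<forall>\<^sub>F \<delta> in at_right 0. A + \<delta> * C < 0" using order_tendstoD(2)[OF L, of 0] by simp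
    thus ?thesis by eventually_elim (use 2 in \<open>simp only: sgn_neg\<close>)
  qed
qed

lemma sum_alternating_even: "even n \<Longrightarrow> (\<Sum>l<n. (-1) ^ l :: real) = 0"
proof -
  assume "even n"
  then obtain k where "n = 2 * k" by blast
  moreover have "(\<Sum>l<2 * k. (-1) ^ l :: real) = 0" by (induction k) auto
  ultimately show ?thesis by simp
qed

text \<open>The range of \<beta> gives \<open>4 - 2 * \<beta>\<close> and
  \<open>0 - 2 * \<beta>\<close> opposite signs, which controls the near-antipodes. The bound
  \<open>H\<close> exceeds the height of every relevant line over the whole row, which controls the
  balancing points.\<close>

definition nice_pair :: "nat \<Rightarrow> (nat \<Rightarrow> real) \<Rightarrow> (nat \<Rightarrow> real) \<Rightarrow> real \<Rightarrow> nat \<Rightarrow> nat \<Rightarrow> bool" where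
  "nice_pair n X Y H i j \<longleftrightarrow> X i \<noteq> X j \<and> (\<exists>\<alpha> \<beta>. 0 < \<beta> \<and> \<beta> < 2 \<and>
     Y i = \<alpha> * X i + \<beta> \<and> Y j = \<alpha> * X j + \<beta> \<and>
     (\<forall>l<n. l \<noteq> i \<longrightarrow> l \<noteq> j \<longrightarrow> Y l \<noteq> \<alpha> * X l + \<beta>) \<and>
     (\<Sum>l<n. sgn (Y l - (\<alpha> * X l + \<beta>))) = 0 \<and> (\<forall>l<n. \<bar>\<alpha> * X l\<bar> + \<bar>\<beta>\<bar> < H))"

text \<open>
  \<open>Pos\<close> is a point of a row, \<open>Neg\<close> a balancing point on the opposite ray, \<open>Bp s\<close> and \<open>Bm s\<close> are a point
  and its near-antipode, and \<open>Orig\<close> (present in odd dimensions only) makes the parity right.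
\<close>

datatype 'r pt = Pos 'r nat | Neg 'r nat | Bp nat | Bm nat | Orig

text \<open>In the plane spanned by \<open>u \<rho>\<close> and \<open>v\<close>, a row is its
  planar set with ordinates flattened into the direction \<open>v\<close>. By \<open>indep\<close>,
  a limit hyperplane through the origin that is transversal to \<open>v\<close> and spanned by
  \<open>u \<rho>\<close> and some points \<open>b s\<close> contains no other direction.\<close>

locale assembly =
  fixes Rw :: "'r set" and u :: "'r \<Rightarrow> 'a::euclidean_space" and n :: nat and X Y :: "'r \<Rightarrow> nat \<Rightarrow> real"
    and F :: "(nat \<times> nat) set" and NB :: nat and b :: "nat \<Rightarrow> 'a" and v :: 'a and H :: real
  assumes finRw: "finite Rw" and FF: "F \<subseteq> {..<n} \<times> {..<n}" and Fasym: "\<And>i j. (i, j) \<in> F \<Longrightarrow> i \<noteq> j \<and> (j, i) \<notin> F"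
    and neven: "even n" and Xpos: "\<And>\<rho> l. \<rho> \<in> Rw \<Longrightarrow> l < n \<Longrightarrow> X \<rho> l > 0" and d3: "DIM('a) \<ge> 3"
    and lines: "\<And>\<rho> i j. \<rho> \<in> Rw \<Longrightarrow> (i, j) \<in> F \<Longrightarrow> nice_pair n (X \<rho>) (Y \<rho>) H i j"
    and indep: "\<And>S. S \<subseteq> insert v (u ` Rw \<union> b ` {..<NB}) \<Longrightarrow> card S = DIM('a) \<Longrightarrow> independent S"
    and uinj: "inj_on u Rw" and binj: "inj_on b {..<NB}" and ub: "u ` Rw \<inter> b ` {..<NB} = {}"
    and v: "v \<notin> u ` Rw" "v \<notin> b ` {..<NB}"
begin

definition dd where "dd = DIM('a) - 2"

text \<open>
  On a hyperplane through \<open>b s\<close>, the near-antipode lies on the upper side if \<open>\<tau> s = 4\<close> and on the lower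
  side if \<open>\<tau> s = 0\<close>. A hyperplane uses one point of each residue class modulo \<open>dd\<close>, so the
  near-antipodes (together with \<open>Orig\<close>) cancel.
\<close>

definition \<tau> :: "nat \<Rightarrow> real" where "\<tau> s = (if s mod dd < (dd + 1) div 2 then 4 else 0)"

definition I :: "'r pt set" where
  "I = (\<lambda>(\<rho>, l). Pos \<rho> l) ` (Rw \<times> {..<n}) \<union> (\<lambda>(\<rho>, l). Neg \<rho> l) ` (Rw \<times> {..<n}) \<union>
     Bp ` {..<NB} \<union> Bm ` {..<NB} \<union> (if odd dd then {Orig} else {})"

text \<open>Balancing points sit alternately at heights \<open>\<delta> * H\<close> and
  \<open>- \<delta> * H\<close>; as \<open>n\<close> is even, a halving hyperplane of their row has
  equally many on each side. At \<open>\<delta> = 0\<close> only the rays and the points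
  \<open>b\<close> and \<open>- b\<close> remain, which is all that matters for distances.\<close>

primrec P :: "real \<Rightarrow> 'r pt \<Rightarrow> 'a" where
  "P \<delta> (Pos \<rho> l) = X \<rho> l *\<^sub>R u \<rho> + (\<delta> * Y \<rho> l) *\<^sub>R v"
| "P \<delta> (Neg \<rho> l) = - (X \<rho> l *\<^sub>R u \<rho>) + (\<delta> * (H * (-1) ^ l)) *\<^sub>R v"
| "P \<delta> (Bp s) = b s"
| "P \<delta> (Bm s) = - b s + (\<delta> * \<tau> s) *\<^sub>R v"
| "P \<delta> Orig = 0"

definition tset :: "'r \<times> (nat \<times> nat) \<times> (nat \<Rightarrow> nat) \<Rightarrow> 'r pt set" where
  "tset = (\<lambda>(\<rho>, (i, j), J). {Pos \<rho> i, Pos \<rho> j} \<union> (\<lambda>r. Bp (r + dd * J r)) ` {..<dd})"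

definition tuples where "tuples w = Rw \<times> F \<times> ({..<dd} \<rightarrow>\<^sub>E {..<w})"

lemma dd1: "dd \<ge> 1" "DIM('a) = dd + 2" using d3 by (auto simp: dd_def)

lemma finI: "finite I" using finRw by (auto simp: I_def)

lemma sum_I: "sum f I = (\<Sum>\<rho>\<in>Rw. \<Sum>l<n. f (Pos \<rho> l) + f (Neg \<rho> l)) + (\<Sum>s<NB. f (Bp s) + f (Bm s))
    + (if odd dd then f Orig else 0)" for f :: "'r pt \<Rightarrow> real"
proof -
  have "sum f I = sum f ((\<lambda>(\<rho>, l). Pos \<rho> l) ` (Rw \<times> {..<n})) + sum f ((\<lambda>(\<rho>, l). Neg \<rho> l) ` (Rw \<times> {..<n}))
      + sum f (Bp ` {..<NB}) + sum f (Bm ` {..<NB}) + sum f (if odd dd then {Orig} else {})"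
    unfolding I_def using finRw by (subst sum.union_disjoint, force, force, force)+ simp
  also have "sum f ((\<lambda>(\<rho>, l). Pos \<rho> l) ` (Rw \<times> {..<n})) = (\<Sum>\<rho>\<in>Rw. \<Sum>l<n. f (Pos \<rho> l))"
    by (subst sum.reindex) (auto simp: inj_on_def sum.cartesian_product case_prod_unfold)
  also have "sum f ((\<lambda>(\<rho>, l). Neg \<rho> l) ` (Rw \<times> {..<n})) = (\<Sum>\<rho>\<in>Rw. \<Sum>l<n. f (Neg \<rho> l))"
    by (subst sum.reindex) (auto simp: inj_on_def sum.cartesian_product case_prod_unfold)
  also have "sum f (Bp ` {..<NB}) = (\<Sum>s<NB. f (Bp s))"
    by (subst sum.reindex) (auto simp: inj_on_def)
  also have "sum f (Bm ` {..<NB}) = (\<Sum>s<NB. f (Bm s))"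
    by (subst sum.reindex) (auto simp: inj_on_def)
  finally show ?thesis by (simp add: sum.distrib)
qed

lemma card_I: "card I = 2 * (card Rw * n) + 2 * NB + (if odd dd then 1 else 0)"
proof -
  have "real (card I) = sum (\<lambda>_. 1) I" by simp
  also have "\<dots> = real (2 * (card Rw * n) + 2 * NB + (if odd dd then 1 else 0))"
    unfolding sum_I by simp
  finally show ?thesis using of_nat_eq_iff by blast
qed

lemma index_bound: "r < dd \<Longrightarrow> k < w \<Longrightarrow> dd * w \<le> NB \<Longrightarrow> r + dd * k < NB"
proof -
  assume "r < dd" "k < w" "dd * w \<le> NB"
  moreover from this have "dd * (k + 1) \<le> dd * w" by (intro mult_left_mono) auto
  ultimately show ?thesis by simp
qed

text \<open>The points \<open>Pos\<close> reveal the row and the pair, whose order is determined as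
  \<open>F\<close> contains no reversed pair; the residue classes modulo \<open>dd\<close> reveal
  the arguments of \<open>J\<close>.\<close>

lemma inj_tset:
  assumes w: "dd * w \<le> NB"
  shows "inj_on tset (tuples w)"
proof (rule inj_onI)
  fix A A' assume A: "A \<in> tuples w" "A' \<in> tuples w" "tset A = tset A'"
  obtain \<rho> i j J \<rho>' i' j' J' where AA: "A = (\<rho>, (i, j), J)" "A' = (\<rho>', (i', j'), J')"
    by (metis prod.exhaust)
  note T = A(1,2)[unfolded AA] and eq = A(3)[unfolded AA]
  have eqP: "{Pos \<rho> i, Pos \<rho> j} = {Pos \<rho>' i', Pos \<rho>' j'}"
  proof -
    have "{p \<in> tset (\<rho>, (i, j), J). \<exists>a l. p = Pos a l} = {Pos \<rho> i, Pos \<rho> j}" for \<rho> i j J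
      by (auto simp: tset_def)
    thus ?thesis using arg_cong[OF eq, of "\<lambda>S. {p \<in> S. \<exists>a l. p = Pos a l}"] by (simp only:)
  qed
  hence "\<rho> = \<rho>'" "(i = i' \<and> j = j') \<or> (i = j' \<and> j = i')" by (auto simp: doubleton_eq_iff)
  moreover have "\<not> (i = j' \<and> j = i')" using T Fasym by (auto simp: tuples_def)
  moreover have "J = J'"
  proof (rule PiE_ext)
    show "J \<in> {..<dd} \<rightarrow>\<^sub>E {..<w}" "J' \<in> {..<dd} \<rightarrow>\<^sub>E {..<w}" using T by (auto simp: tuples_def)
    fix r assume r: "r \<in> {..<dd}"
    have "Bp (r + dd * J r) \<in> tset (\<rho>', (i', j'), J')" using r unfolding eq[symmetric] by (auto simp: tset_def)
    then obtain r' where r': "r' < dd" "r + dd * J r = r' + dd * J' r'" by (auto simp: tset_def)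
    have "r = r'" using arg_cong[OF r'(2), of "\<lambda>s. s mod dd"] r r'(1) by simp
    thus "J r = J' r" using r' dd1 by simp
  qed
  ultimately show "A = A'" unfolding AA by auto
qed

lemma card_tuples: "card (tuples w) = card Rw * card F * w ^ dd"
  unfolding tuples_def by (simp add: card_cartesian_product card_PiE)

text \<open>For small \<delta>, signs away from the chosen row and the chosen \<open>b s\<close> are
  decided by the limit hyperplane through the origin, so points and their near-antipodes cancel. The
  rest lies on the limit hyperplane, and there the terms of first order in \<delta> decide.\<close>

lemma strict_halving_tset:
  assumes T: "(\<rho>, (i, j), J) \<in> tuples w" and w: "dd * w \<le> NB"
  shows "\<forall>\<^sub>F \<delta> in at_right 0. strict_halving I (P \<delta>) (tset (\<rho>, (i, j), J))"
proof -
  have \<rho>: "\<rho> \<in> Rw" and ij: "(i, j) \<in> F" "i < n" "j < n" "i \<noteq> j" and J: "\<And>r. r < dd \<Longrightarrow> J r < w"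
    using T FF Fasym by (auto simp: tuples_def)
  define sx where "sx r = r + dd * J r" for r
  have sx: "sx r < NB" if "r < dd" for r unfolding sx_def using index_bound J w that by auto
  have sxmod: "sx r mod dd = r" if "r < dd" for r using that by (simp add: sx_def)
  have sxinj: "inj_on sx {..<dd}" by (rule inj_on_inverseI[of _ "\<lambda>s. s mod dd"]) (simp add: sxmod)
  define K where "K = sx ` {..<dd}"
  have K: "K \<subseteq> {..<NB}" using sx by (auto simp: K_def)
  have cK: "card K = dd" using card_image[OF sxinj] by (simp add: K_def)
  define S where "S = tset (\<rho>, (i, j), J)"
  have S: "S = {Pos \<rho> i, Pos \<rho> j} \<union> Bp ` K" by (auto simp: S_def tset_def K_def sx_def)
  have SI: "S \<subseteq> I" using \<rho> ij K by (auto simp: S I_def)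
  have cS: "card S = DIM('a)"
  proof -
    have "finite K" using K finite_subset by blast
    hence "card S = card {Pos \<rho> i, Pos \<rho> j} + card (Bp ` K :: 'r pt set)" unfolding S by (intro card_Un_disjoint) auto
    also have "card (Bp ` K :: 'r pt set) = dd" using cK by (subst card_image) (auto simp: inj_on_def)
    finally show ?thesis using ij dd1 by simp
  qed
  from lines[OF \<rho> ij(1)] obtain \<alpha> \<beta> where Xij: "X \<rho> i \<noteq> X \<rho> j" and \<beta>: "0 < \<beta>" "\<beta> < 2"
    and Yi: "Y \<rho> i = \<alpha> * X \<rho> i + \<beta>" "Y \<rho> j = \<alpha> * X \<rho> j + \<beta>"
    and Yl: "\<And>l. l < n \<Longrightarrow> l \<noteq> i \<Longrightarrow> l \<noteq> j \<Longrightarrow> Y \<rho> l \<noteq> \<alpha> * X \<rho> l + \<beta>"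
    and Ysum: "(\<Sum>l<n. sgn (Y \<rho> l - (\<alpha> * X \<rho> l + \<beta>))) = 0" and HH: "\<And>l. l < n \<Longrightarrow> \<bar>\<alpha> * X \<rho> l\<bar> + \<bar>\<beta>\<bar> < H"
    unfolding nice_pair_def by blast
  define G where "G = insert (u \<rho>) (b ` K)"
  define B where "B = insert v G"
  have bK: "b ` K \<subseteq> b ` {..<NB}" using K by auto
  have finK: "finite K" using K finite_subset by blast
  have cbK: "card (b ` K) = dd" using cK card_image[OF inj_on_subset[OF binj K]] by simp
  have uK: "u \<rho> \<notin> b ` K" using ub \<rho> bK by blast
  have cG: "card G = dd + 1" unfolding G_def using finK uK cbK by simp
  have vG: "v \<notin> G" using v \<rho> bK by (auto simp: G_def)
  have finG: "finite G" using finK by (simp add: G_def)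
  have cB: "card B = DIM('a)" unfolding B_def using vG finG cG dd1 by simp
  have GU: "G \<subseteq> u ` Rw \<union> b ` {..<NB}" using \<rho> bK by (auto simp: G_def)
  have indB: "independent B" using indep[OF _ cB] GU by (auto simp: B_def)
  \<comment> \<open>\<open>\<nu>0\<close> is the normal of the limit hyperplane, normalised on
    \<open>v\<close>. \<open>\<nu>1\<close> is the first-order correction: the hyperplane with
    normal \<open>\<nu>0 + \<delta> *\<^sub>R \<nu>1\<close> and right-hand side
    \<open>\<delta> * \<beta>\<close> contains the chosen \<open>b s\<close> and traces in the plane
    of the row the planar line with slope \<alpha> and intercept \<beta>.\<close>
  obtain \<nu>0 where \<nu>0: "\<And>x. x \<in> B \<Longrightarrow> \<nu>0 \<bullet> x = (if x = v then 1 else 0)"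
    using inner_interpolation[OF indB, of "\<lambda>x. if x = v then 1 else 0"] by blast
  obtain \<nu>1 where \<nu>1: "\<And>x. x \<in> B \<Longrightarrow> \<nu>1 \<bullet> x = (if x = v then 0 else if x = u \<rho> then - \<alpha> else \<beta>)"
    using inner_interpolation[OF indB, of "\<lambda>x. if x = v then 0 else if x = u \<rho> then - \<alpha> else \<beta>"] by blast
  \<comment> \<open>If another direction were orthogonal to \<open>\<nu>0\<close>, then
    \<open>\<nu>0\<close> would be orthogonal to a basis, against its product 1 with
    \<open>v\<close>.\<close>
  have generic: "\<nu>0 \<bullet> z \<noteq> 0" if z: "z \<in> u ` Rw \<union> b ` {..<NB}" "z \<notin> G" for z
  proof
    assume "\<nu>0 \<bullet> z = 0"
    have "card (insert z G) = DIM('a)" using z finG cG dd1 by simp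
    moreover from this have "independent (insert z G)" using indep[of "insert z G"] z GU by blast
    moreover have "\<nu>0 \<bullet> y = 0" if "y \<in> insert z G" for y
      using that \<open>\<nu>0 \<bullet> z = 0\<close> \<nu>0[of y] vG by (auto simp: B_def)
    ultimately have "\<nu>0 = 0" using orthogonal_to_independent_eq_0 by blast
    thus False using \<nu>0[of v] by (simp add: B_def)
  qed
  define \<nu> where "\<nu> \<delta> = \<nu>0 + \<delta> *\<^sub>R \<nu>1" for \<delta>
  have \<nu>v: "\<nu> \<delta> \<bullet> v = 1" for \<delta> using \<nu>0[of v] \<nu>1[of v] by (simp add: \<nu>_def B_def inner_add_left)
  have \<nu>u: "\<nu> \<delta> \<bullet> u \<rho> = - \<delta> * \<alpha>" for \<delta>
    using \<nu>0[of "u \<rho>"] \<nu>1[of "u \<rho>"] vG by (auto simp: \<nu>_def B_def G_def inner_add_left)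
  have \<nu>b: "\<nu> \<delta> \<bullet> b s = \<delta> * \<beta>" if "s \<in> K" for \<delta> s
  proof -
    have "b s \<in> b ` K" using that by simp
    hence bs: "b s \<in> G" "b s \<noteq> u \<rho>" using uK unfolding G_def by auto
    hence "b s \<in> B" "b s \<noteq> v" using vG unfolding B_def by auto
    with bs(2) show ?thesis using \<nu>0[of "b s"] \<nu>1[of "b s"] by (simp add: \<nu>_def inner_add_left)
  qed
  define f where "f \<delta> p = \<nu> \<delta> \<bullet> P \<delta> p - \<delta> * \<beta>" for \<delta> p
  have f1: "f \<delta> (Pos \<rho> l) = \<delta> * (Y \<rho> l - (\<alpha> * X \<rho> l + \<beta>))" for \<delta> l
    using \<nu>u \<nu>v by (simp add: f_def inner_add_right algebra_simps)
  have f2: "f \<delta> (Neg \<rho> l) = \<delta> * (H * (-1) ^ l + \<alpha> * X \<rho> l - \<beta>)" for \<delta> l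
    using \<nu>u \<nu>v by (simp add: f_def inner_add_right algebra_simps)
  have f3: "f \<delta> (Bp s) = 0" "f \<delta> (Bm s) = \<delta> * (\<tau> s - 2 * \<beta>)" if "s \<in> K" for \<delta> s
    using \<nu>b[OF that] \<nu>v by (simp_all add: f_def inner_add_right algebra_simps)
  have f4: "f \<delta> Orig = \<delta> * (- \<beta>)" for \<delta> by (simp add: f_def)
  define good where "good \<delta> \<longleftrightarrow> (\<forall>\<rho>'\<in>Rw - {\<rho>}. \<forall>l\<in>{..<n}. sgn (f \<delta> (Pos \<rho>' l)) = sgn (\<nu>0 \<bullet> u \<rho>') \<and>
       sgn (f \<delta> (Neg \<rho>' l)) = - sgn (\<nu>0 \<bullet> u \<rho>')) \<and>
      (\<forall>s\<in>{..<NB} - K. sgn (f \<delta> (Bp s)) = sgn (\<nu>0 \<bullet> b s) \<and> sgn (f \<delta> (Bm s)) = - sgn (\<nu>0 \<bullet> b s))" for \<delta>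
  have nzu: "\<nu>0 \<bullet> u \<rho>' \<noteq> 0" if "\<rho>' \<in> Rw - {\<rho>}" for \<rho>'
  proof (rule generic)
    show "u \<rho>' \<in> u ` Rw \<union> b ` {..<NB}" using that by auto
    have "u \<rho>' \<noteq> u \<rho>" using uinj \<rho> that by (auto simp: inj_on_def)
    moreover have "u \<rho>' \<notin> b ` K" using ub bK that by blast
    ultimately show "u \<rho>' \<notin> G" by (simp add: G_def)
  qed
  have nzb: "\<nu>0 \<bullet> b s \<noteq> 0" if "s \<in> {..<NB} - K" for s
  proof (rule generic)
    show "b s \<in> u ` Rw \<union> b ` {..<NB}" using that by auto
    have "b s \<noteq> u \<rho>" using ub \<rho> that by blast
    moreover have "b s \<notin> b ` K" using binj K that by (auto simp: inj_on_def)
    ultimately show "b s \<notin> G" by (simp add: G_def)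
  qed
  have "\<forall>\<^sub>F \<delta> in at_right 0. good \<delta>"
    unfolding good_def
  proof (intro eventually_conj eventually_ball_finite ballI)
    fix \<rho>' l assume r: "\<rho>' \<in> Rw - {\<rho>}" and l: "l \<in> {..<n}"
    have Xp: "X \<rho>' l > 0" using Xpos r l by auto
    have n1: "X \<rho>' l * (\<nu>0 \<bullet> u \<rho>') \<noteq> 0" "- (X \<rho>' l * (\<nu>0 \<bullet> u \<rho>')) \<noteq> 0" using nzu[OF r] Xp by auto
    have "f \<delta> (Pos \<rho>' l) = X \<rho>' l * (\<nu>0 \<bullet> u \<rho>') + \<delta> * (X \<rho>' l * (\<nu>1 \<bullet> u \<rho>') + Y \<rho>' l - \<beta>)" for \<delta>
      using \<nu>v[of \<delta>] by (simp add: f_def inner_add_right) (simp add: \<nu>_def inner_add_left algebra_simps)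
    with eventually_sgn_linear[OF n1(1)] show "\<forall>\<^sub>F \<delta> in at_right 0. sgn (f \<delta> (Pos \<rho>' l)) = sgn (\<nu>0 \<bullet> u \<rho>')"
      using Xp by (simp add: sgn_mult)
    have "f \<delta> (Neg \<rho>' l) = - (X \<rho>' l * (\<nu>0 \<bullet> u \<rho>')) + \<delta> * (- X \<rho>' l * (\<nu>1 \<bullet> u \<rho>') + H * (-1) ^ l - \<beta>)" for \<delta>
      using \<nu>v[of \<delta>] by (simp add: f_def inner_add_right) (simp add: \<nu>_def inner_add_left algebra_simps)
    with eventually_sgn_linear[OF n1(2)] show "\<forall>\<^sub>F \<delta> in at_right 0. sgn (f \<delta> (Neg \<rho>' l)) = - sgn (\<nu>0 \<bullet> u \<rho>')"
      using Xp by (simp add: sgn_mult sgn_minus)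
  next
    fix s assume s: "s \<in> {..<NB} - K"
    have n1: "\<nu>0 \<bullet> b s \<noteq> 0" "- (\<nu>0 \<bullet> b s) \<noteq> 0" using nzb[OF s] by auto
    have "f \<delta> (Bp s) = \<nu>0 \<bullet> b s + \<delta> * (\<nu>1 \<bullet> b s - \<beta>)" for \<delta>
      by (simp add: f_def \<nu>_def inner_add_left algebra_simps)
    with eventually_sgn_linear[OF n1(1)] show "\<forall>\<^sub>F \<delta> in at_right 0. sgn (f \<delta> (Bp s)) = sgn (\<nu>0 \<bullet> b s)" by simp
    have "f \<delta> (Bm s) = - (\<nu>0 \<bullet> b s) + \<delta> * (- (\<nu>1 \<bullet> b s) + \<tau> s - \<beta>)" for \<delta>
      using \<nu>v[of \<delta>] by (simp add: f_def inner_add_right) (simp add: \<nu>_def inner_add_left algebra_simps)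
    with eventually_sgn_linear[OF n1(2)] show "\<forall>\<^sub>F \<delta> in at_right 0. sgn (f \<delta> (Bm s)) = - sgn (\<nu>0 \<bullet> b s)"
      by (simp add: sgn_minus)
  qed (use finRw in auto)
  moreover have "\<forall>\<^sub>F \<delta> in at_right 0. \<delta> > (0 :: real)" by (rule eventually_at_right_less)
  ultimately show ?thesis
  proof eventually_elim
    case (elim \<delta>)
    have \<delta>: "\<delta> > 0" by fact
    have gu: "sgn (f \<delta> (Pos \<rho>' l)) = sgn (\<nu>0 \<bullet> u \<rho>')" "sgn (f \<delta> (Neg \<rho>' l)) = - sgn (\<nu>0 \<bullet> u \<rho>')"
      if "\<rho>' \<in> Rw - {\<rho>}" "l < n" for \<rho>' l using elim(1) that unfolding good_def by auto
    have gb: "sgn (f \<delta> (Bp s)) = sgn (\<nu>0 \<bullet> b s)" "sgn (f \<delta> (Bm s)) = - sgn (\<nu>0 \<bullet> b s)"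
      if "s \<in> {..<NB} - K" for s using elim(1) that unfolding good_def by auto
    have sN: "sgn (f \<delta> (Neg \<rho> l)) = (-1) ^ l" if "l < n" for l
    proof -
      have "sgn (H * (-1) ^ l + \<alpha> * X \<rho> l - \<beta>) = (-1) ^ l"
      proof (cases "even l")
        case True
        hence "H * (-1) ^ l + \<alpha> * X \<rho> l - \<beta> > 0" using HH[OF that] by simp
        thus ?thesis using True by (simp only: sgn_pos) simp
      next
        case False
        hence "H * (-1) ^ l + \<alpha> * X \<rho> l - \<beta> < 0" using HH[OF that] by simp
        thus ?thesis using False by (simp only: sgn_neg) simp
      qed
      thus ?thesis unfolding f2 sgn_mult using \<delta> by simp
    qed
    have sB: "sgn (f \<delta> (Bm (sx r))) = (if r < (dd + 1) div 2 then 1 else -1)" if "r < dd" for r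
    proof -
      have "sx r \<in> K" using that by (auto simp: K_def)
      hence "sgn (f \<delta> (Bm (sx r))) = sgn (\<tau> (sx r) - 2 * \<beta>)" using f3(2) \<delta> by (simp add: sgn_mult)
      also have "\<tau> (sx r) = (if r < (dd + 1) div 2 then 4 else 0)" by (simp only: \<tau>_def sxmod[OF that])
      also have "sgn (\<dots> - 2 * \<beta>) = (if r < (dd + 1) div 2 then 1 else -1)" using \<beta> by auto
      finally show ?thesis .
    qed
    have nonzero: "f \<delta> p \<noteq> 0" if p: "p \<in> I - S" for p
    proof -
      have H1: "sgn (f \<delta> p) \<noteq> 0 \<Longrightarrow> f \<delta> p \<noteq> 0" by auto
      consider (1) \<rho>' l where "\<rho>' \<in> Rw - {\<rho>}" "l < n" "p = Pos \<rho>' l \<or> p = Neg \<rho>' l"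
        | (2) l where "l < n" "p = Pos \<rho> l" "l \<noteq> i" "l \<noteq> j" | (3) l where "l < n" "p = Neg \<rho> l"
        | (4) s where "s \<in> {..<NB} - K" "p = Bp s \<or> p = Bm s" | (5) s where "s \<in> K" "p = Bm s" | (6) "p = Orig"
        using p unfolding I_def S by (auto split: if_splits, blast+)
      thus ?thesis
      proof cases
        case 1 thus ?thesis using gu[OF 1(1,2)] nzu[OF 1(1)] by (intro H1) (auto simp: sgn_zero_iff)
      next
        case 2 thus ?thesis using f1 Yl[OF 2(1,3,4)] \<delta> by auto
      next
        case 3 thus ?thesis using sN[OF 3(1)] by (intro H1) auto
      next
        case 4 thus ?thesis using gb[OF 4(1)] nzb[OF 4(1)] by (intro H1) (auto simp: sgn_zero_iff)
      next
        case 5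
        then obtain r where "r < dd" "s = sx r" by (auto simp: K_def)
        thus ?thesis using sB[of r] 5 by (intro H1) auto
      next
        case 6 thus ?thesis using f4 \<beta> \<delta> by auto
      qed
    qed
    have total: "(\<Sum>p\<in>I. sgn (f \<delta> p)) = 0"
    proof -
      have "(\<Sum>\<rho>'\<in>Rw. \<Sum>l<n. sgn (f \<delta> (Pos \<rho>' l)) + sgn (f \<delta> (Neg \<rho>' l))) = (\<Sum>\<rho>'\<in>Rw. 0)"
      proof (intro sum.cong refl)
        fix \<rho>' assume r: "\<rho>' \<in> Rw"
        show "(\<Sum>l<n. sgn (f \<delta> (Pos \<rho>' l)) + sgn (f \<delta> (Neg \<rho>' l))) = 0"
        proof (cases "\<rho>' = \<rho>")
          case False
          thus ?thesis using gu r by (intro sum.neutral) auto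
        next
          case True
          have "(\<Sum>l<n. sgn (f \<delta> (Pos \<rho> l)) + sgn (f \<delta> (Neg \<rho> l))) =
              (\<Sum>l<n. sgn (Y \<rho> l - (\<alpha> * X \<rho> l + \<beta>)) + (-1) ^ l)"
            using sN f1 \<delta> by (intro sum.cong) (auto simp: sgn_mult)
          thus ?thesis using True Ysum sum_alternating_even[OF neven] by (simp add: sum.distrib)
        qed
      qed
      moreover have "(\<Sum>s<NB. sgn (f \<delta> (Bp s)) + sgn (f \<delta> (Bm s))) = (if odd dd then 1 else 0)"
      proof -
        have "(\<Sum>s<NB. sgn (f \<delta> (Bp s)) + sgn (f \<delta> (Bm s))) = (\<Sum>s\<in>K. sgn (f \<delta> (Bp s)) + sgn (f \<delta> (Bm s)))"
          using K gb by (intro sum.mono_neutral_right) auto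
        also have "\<dots> = (\<Sum>r<dd. sgn (f \<delta> (Bp (sx r))) + sgn (f \<delta> (Bm (sx r))))"
          unfolding K_def using sxinj by (subst sum.reindex) auto
        also have "\<dots> = (\<Sum>r<dd. - (if r < (dd + 1) div 2 then -1 else 1))"
          using sB f3(1) by (intro sum.cong refl) (auto simp: K_def)
        also have "\<dots> = - (real dd - 2 * real ((dd + 1) div 2))"
          unfolding sum_negf by (subst sum_step_sign) auto
        also have "\<dots> = (if odd dd then 1 else 0)" by (auto elim!: evenE oddE)
        finally show ?thesis .
      qed
      moreover have "sgn (f \<delta> Orig) = -1" using f4 \<beta> \<delta> by (simp add: sgn_mult)
      ultimately show ?thesis unfolding sum_I by simp
    qed
    \<comment> \<open>Two row points with different abscissas express the value of \<open>a'\<close>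
      on \<open>u \<rho>\<close> and the constant \<open>c'\<close> through
      \<open>a' \<bullet> v\<close>. So \<open>a'\<close> agrees with a multiple of
      \<open>\<nu> \<delta>\<close> on the basis \<open>B\<close>.\<close>
    have uniq: "\<exists>k. a' = k *\<^sub>R \<nu> \<delta> \<and> c' = k * (\<delta> * \<beta>)" if h: "\<forall>p\<in>S. a' \<bullet> P \<delta> p = c'" for a' c'
    proof -
      define t where "t = a' \<bullet> v"
      define q where "q = a' \<bullet> u \<rho>"
      have e1: "X \<rho> i * q + \<delta> * Y \<rho> i * t = c'" and e2: "X \<rho> j * q + \<delta> * Y \<rho> j * t = c'"
        using h by (auto simp: S t_def q_def inner_add_right)
      have "(X \<rho> i - X \<rho> j) * (q + \<delta> * \<alpha> * t) = 0" using e1 e2 unfolding Yi by (simp add: algebra_simps)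
      hence q: "q = - \<delta> * \<alpha> * t" using Xij by simp
      have c': "c' = \<delta> * \<beta> * t" using e1 unfolding q Yi by (simp add: algebra_simps)
      have "(a' - t *\<^sub>R \<nu> \<delta>) \<bullet> y = 0" if y: "y \<in> B" for y
      proof -
        consider "y = v" | "y = u \<rho>" | s where "s \<in> K" "y = b s" using y by (auto simp: B_def G_def)
        thus ?thesis
        proof cases
          case 1 thus ?thesis using \<nu>v by (simp add: inner_diff_left t_def)
        next
          case 2 thus ?thesis using \<nu>u q by (simp add: inner_diff_left q_def)
        next
          case 3
          hence "a' \<bullet> b s = c'" using h by (auto simp: S)
          thus ?thesis using 3 \<nu>b c' by (simp add: inner_diff_left)
        qed
      qed
      hence "a' - t *\<^sub>R \<nu> \<delta> = 0" using orthogonal_to_independent_eq_0[OF indB cB] by blast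
      thus ?thesis using c' by (intro exI[of _ t]) simp
    qed
    have zero: "\<nu> \<delta> \<bullet> P \<delta> p = \<delta> * \<beta>" if "p \<in> S" for p
    proof -
      have "f \<delta> p = 0" using that f1 f3(1) Yi unfolding S by auto
      thus ?thesis by (simp add: f_def)
    qed
    have "\<nu> \<delta> \<noteq> 0" using \<nu>v[of \<delta>] by auto
    thus ?case unfolding strict_halving_def S_def[symmetric]
      using SI cS zero nonzero total uniq unfolding f_def by (intro conjI exI[of _ "\<nu> \<delta>"] exI[of _ "\<delta> * \<beta>"]) auto
  qed
qed

lemma P_close: "e > 0 \<Longrightarrow> \<forall>\<^sub>F \<delta> in at_right 0. \<forall>p\<in>I. dist (P \<delta> p) (P 0 p) < e"
proof (intro eventually_ball_finite finI ballI)
  fix p assume e: "e > 0"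
  have "((\<lambda>\<delta>. P \<delta> p) \<longlongrightarrow> P 0 p) (at_right 0)"
    by (cases p) (auto intro!: tendsto_eq_intros)
  thus "\<forall>\<^sub>F \<delta> in at_right 0. dist (P \<delta> p) (P 0 p) < e" using e by (rule tendstoD)
qed

text \<open>All choices of row, pair and points \<open>b\<close> are finitely many, so a single
  \<delta> serves them all; then one perturbation gives general position.\<close>

lemma many_halving_hyperplanes:
  assumes w: "dd * w \<le> NB" and e: "e > 0"
  obtains P' where "inj_on P' I" "\<forall>p\<in>I. dist (P' p) (P 0 p) < e" "general_position (P' ` I)"
    "card Rw * card F * w ^ dd \<le> card {H. halving_hyperplane (P' ` I) H}"
proof -
  have "finite (tuples w)" unfolding tuples_def using finRw FF finite_subset
    by (intro finite_cartesian_product finite_PiE) auto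
  hence "\<forall>\<^sub>F \<delta> in at_right 0. \<forall>T\<in>tuples w. strict_halving I (P \<delta>) (tset T)"
    using strict_halving_tset[OF _ w] by (intro eventually_ball_finite) auto
  hence "\<forall>\<^sub>F \<delta> in at_right 0. (\<forall>T\<in>tuples w. strict_halving I (P \<delta>) (tset T)) \<and> (\<forall>p\<in>I. dist (P \<delta> p) (P 0 p) < e / 2)"
    using P_close[of "e / 2"] e by (simp add: eventually_conj)
  then obtain \<delta> where \<delta>: "\<forall>T\<in>tuples w. strict_halving I (P \<delta>) (tset T)" "\<forall>p\<in>I. dist (P \<delta> p) (P 0 p) < e / 2"
    using eventually_happens'[OF trivial_limit_at_right_real] by blast
  obtain P' where P': "inj_on P' I" "\<forall>p\<in>I. dist (P' p) (P \<delta> p) < e / 2" "general_position (P' ` I)"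
    "card (tset ` tuples w) \<le> card {H. halving_hyperplane (P' ` I) H}"
    using perturbed_halving[of I "tset ` tuples w" "P \<delta>" "e / 2"] finI \<delta>(1) e by auto
  have "card (tset ` tuples w) = card Rw * card F * w ^ dd"
    using card_image[OF inj_tset[OF w]] card_tuples by simp
  moreover have "\<forall>p\<in>I. dist (P' p) (P 0 p) < e"
  proof
    fix p assume "p \<in> I"
    hence "dist (P' p) (P \<delta> p) < e / 2" "dist (P \<delta> p) (P 0 p) < e / 2" using P'(2) \<delta>(2) by blast+
    thus "dist (P' p) (P 0 p) < e" using dist_triangle[of "P' p" "P 0 p" "P \<delta> p"] by linarith
  qed
  ultimately show thesis using P' by (intro that[of P']) simp_all
qed

end

text \<open>Replacing the ordinate y by 1 + \<eta> y turns an intercept \<beta> into 1 + \<eta>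
  \<beta>, which is between 0 and 2 for small \<eta>. Halving is unaffected, and the abscissas, the
  only ones relevant to distances, stay the same.\<close>

lemma normalise_rows:
  fixes X Y :: "nat \<Rightarrow> nat \<Rightarrow> real"
  assumes F: "finite F" and hp: "\<And>t i j. t < R \<Longrightarrow> (i, j) \<in> F \<Longrightarrow> halving_pair n (X t) (Y t) i j"
  obtains Y' H where "\<And>t i j. t < R \<Longrightarrow> (i, j) \<in> F \<Longrightarrow> nice_pair n (X t) (Y' t) H i j"
proof -
  define line where "line t i j \<alpha> \<beta> \<longleftrightarrow> Y t i = \<alpha> * X t i + \<beta> \<and> Y t j = \<alpha> * X t j + \<beta> \<and>
     (\<forall>l<n. l \<noteq> i \<longrightarrow> l \<noteq> j \<longrightarrow> Y t l \<noteq> \<alpha> * X t l + \<beta>) \<and> (\<Sum>l<n. sgn (Y t l - (\<alpha> * X t l + \<beta>))) = 0"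
    for t i j \<alpha> \<beta>
  define D where "D = {..<R} \<times> F"
  have finD: "finite D" using F by (simp add: D_def)
  have "\<forall>x\<in>D. \<exists>p. line (fst x) (fst (snd x)) (snd (snd x)) (fst p) (snd p)"
  proof
    fix x assume "x \<in> D"
    then obtain t i j where x: "x = (t, i, j)" "t < R" "(i, j) \<in> F" by (auto simp: D_def)
    from hp[OF x(2,3)] obtain \<alpha> \<beta> where "line t i j \<alpha> \<beta>" unfolding halving_pair_def line_def by blast
    thus "\<exists>p. line (fst x) (fst (snd x)) (snd (snd x)) (fst p) (snd p)"
      using x by (intro exI[of _ "(\<alpha>, \<beta>)"]) simp
  qed
  then obtain p where p: "\<forall>x\<in>D. line (fst x) (fst (snd x)) (snd (snd x)) (fst (p x)) (snd (p x))"
    by (metis bchoice)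
  define C where "C = (\<Sum>x\<in>D. \<bar>snd (p x)\<bar>)"
  define \<eta> where "\<eta> = 1 / (2 * (C + 1))"
  have C0: "C \<ge> 0" by (simp add: C_def sum_nonneg)
  have \<eta>0: "\<eta> > 0" using C0 by (simp add: \<eta>_def)
  define H where "H = 1 + (\<Sum>x\<in>D. \<Sum>l<n. \<bar>\<eta> * fst (p x) * X (fst x) l\<bar> + \<bar>1 + \<eta> * snd (p x)\<bar>)"
  show thesis
  proof (rule that[of "\<lambda>t l. 1 + \<eta> * Y t l" H])
    fix t i j assume t: "t < R" and ij: "(i, j) \<in> F"
    define x where "x = (t, i, j)"
    have x: "x \<in> D" using t ij by (auto simp: x_def D_def)
    define a0 where "a0 = fst (p x)"
    define b0 where "b0 = snd (p x)"
    have ln: "line t i j a0 b0" using p x by (auto simp: x_def a0_def b0_def)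
    have "\<bar>b0\<bar> \<le> C" unfolding C_def b0_def using finD x by (intro member_le_sum) auto
    hence "\<bar>\<eta> * b0\<bar> \<le> \<eta> * C" using \<eta>0 by (simp add: abs_mult)
    also have "\<dots> < 1" using C0 by (simp add: \<eta>_def field_simps)
    finally have b: "0 < 1 + \<eta> * b0" "1 + \<eta> * b0 < 2" by linarith+
    have diff: "1 + \<eta> * Y t l - (\<eta> * a0 * X t l + (1 + \<eta> * b0)) = \<eta> * (Y t l - (a0 * X t l + b0))" for l
      by (simp add: algebra_simps)
    have "sgn (1 + \<eta> * Y t l - (\<eta> * a0 * X t l + (1 + \<eta> * b0))) = sgn (Y t l - (a0 * X t l + b0))" for l
      unfolding diff using \<eta>0 by (simp add: sgn_mult)
    hence s: "(\<Sum>l<n. sgn (1 + \<eta> * Y t l - (\<eta> * a0 * X t l + (1 + \<eta> * b0)))) = 0"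
      using ln unfolding line_def by simp
    have HH: "\<bar>\<eta> * a0 * X t l\<bar> + \<bar>1 + \<eta> * b0\<bar> < H" if "l < n" for l
    proof -
      have "\<bar>\<eta> * a0 * X t l\<bar> + \<bar>1 + \<eta> * b0\<bar> \<le> (\<Sum>l<n. \<bar>\<eta> * fst (p x) * X (fst x) l\<bar> + \<bar>1 + \<eta> * snd (p x)\<bar>)"
        using that member_le_sum[of l "{..<n}" "\<lambda>l. \<bar>\<eta> * fst (p x) * X (fst x) l\<bar> + \<bar>1 + \<eta> * snd (p x)\<bar>"]
        by (simp add: a0_def b0_def x_def)
      also have "\<dots> \<le> (\<Sum>x\<in>D. \<Sum>l<n. \<bar>\<eta> * fst (p x) * X (fst x) l\<bar> + \<bar>1 + \<eta> * snd (p x)\<bar>)"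
        using finD x by (intro member_le_sum[of x D "\<lambda>x. \<Sum>l<n. \<bar>\<eta> * fst (p x) * X (fst x) l\<bar> + \<bar>1 + \<eta> * snd (p x)\<bar>"])
          (auto intro: sum_nonneg)
      finally show ?thesis by (simp add: H_def)
    qed
    have on: "Y t l = a0 * X t l + b0 \<longleftrightarrow> 1 + \<eta> * Y t l = \<eta> * a0 * X t l + (1 + \<eta> * b0)" for l
      using diff[of l] \<eta>0 by auto
    have X: "X t i \<noteq> X t j" using hp[OF t ij] by (simp add: halving_pair_def)
    show "nice_pair n (X t) (\<lambda>l. 1 + \<eta> * Y t l) H i j"
      unfolding nice_pair_def
    proof (intro conjI X)
      show "\<exists>\<alpha> \<beta>. 0 < \<beta> \<and> \<beta> < 2 \<and>
        1 + \<eta> * Y t i = \<alpha> * X t i + \<beta> \<and> 1 + \<eta> * Y t j = \<alpha> * X t j + \<beta> \<and>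
        (\<forall>l<n. l \<noteq> i \<longrightarrow> l \<noteq> j \<longrightarrow> 1 + \<eta> * Y t l \<noteq> \<alpha> * X t l + \<beta>) \<and>
        (\<Sum>l<n. sgn (1 + \<eta> * Y t l - (\<alpha> * X t l + \<beta>))) = 0 \<and> (\<forall>l<n. \<bar>\<alpha> * X t l\<bar> + \<bar>\<beta>\<bar> < H)"
        by (rule exI[of _ "\<eta> * a0"], rule exI[of _ "1 + \<eta> * b0"])
           (use b s HH ln on in \<open>simp add: line_def\<close>)
    qed
  qed
qed

section \<open>Distances: laying out rows and filling points on a grid\<close>

lemma gamma_dense_bounds:
  fixes P :: "'a::euclidean_space set"
  assumes fin: "finite P" and lo: "lo > 0" and b: "\<And>x y. x \<in> P \<Longrightarrow> y \<in> P \<Longrightarrow> x \<noteq> y \<Longrightarrow> lo \<le> dist x y \<and> dist x y \<le> hi"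
    and \<gamma>: "hi / lo \<le> \<gamma> * root DIM('a) (real (card P))"
  shows "gamma_dense \<gamma> P"
  unfolding gamma_dense_def
proof (intro conjI fin impI)
  assume "card P \<ge> 2"
  then obtain x y where xy: "x \<in> P" "y \<in> P" "x \<noteq> y"
    by (metis One_nat_def Suc_1 card_le_Suc0_iff_eq fin not_less_eq_eq)
  have fd: "finite (distances P)"
  proof (rule finite_subset)
    show "distances P \<subseteq> (\<lambda>(x, y). dist x y) ` (P \<times> P)" by (auto simp: distances_def)
  qed (use fin in auto)
  have ne: "distances P \<noteq> {}" using xy by (auto simp: distances_def)
  have "Max (distances P) \<le> hi" "lo \<le> Min (distances P)"
    using fd ne b by (auto simp: distances_def)
  moreover have "hi \<ge> 0" using b[OF xy] lo by linarith
  ultimately have "Max (distances P) / Min (distances P) \<le> hi / lo" using lo by (intro frac_le) auto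
  thus "Max (distances P) / Min (distances P) \<le> \<gamma> * root DIM('a) (real (card P))" using \<gamma> by linarith
qed

lemma even_npts: "even (npts m)" by (induction m) auto

text \<open>With \<open>c = 1\<close> this counts the directions of the rows, with \<open>c\<close>
  a multiple of \<open>q\<close> the grid box that receives the points b.\<close>

lemma card_grid:
  fixes e0 :: "'d::finite"
  shows "finite {h :: 'd \<Rightarrow> nat. (\<forall>j. j \<noteq> e0 \<longrightarrow> h j < q) \<and> h e0 < c}"
    "card {h :: 'd \<Rightarrow> nat. (\<forall>j. j \<noteq> e0 \<longrightarrow> h j < q) \<and> h e0 < c} = c * q ^ (CARD('d) - 1)"
proof -
  have eq: "{h :: 'd \<Rightarrow> nat. (\<forall>j. j \<noteq> e0 \<longrightarrow> h j < q) \<and> h e0 < c} = (\<Pi>\<^sub>E j\<in>UNIV. if j = e0 then {..<c} else {..<q})"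
    by (auto simp: PiE_def Pi_def split: if_splits)
  show "finite {h :: 'd \<Rightarrow> nat. (\<forall>j. j \<noteq> e0 \<longrightarrow> h j < q) \<and> h e0 < c}" unfolding eq by (intro finite_PiE) auto
  have "card (\<Pi>\<^sub>E j\<in>(UNIV :: 'd set). if j = e0 then {..<c} else {..<q}) = (\<Prod>j\<in>UNIV. if j = e0 then c else q)"
    by (subst card_PiE) (auto intro!: prod.cong)
  also have "\<dots> = (if e0 = e0 then c else q) * (\<Prod>j\<in>UNIV - {e0}. if j = e0 then c else q)"
    by (rule prod.remove) auto
  also have "(\<Prod>j\<in>UNIV - {e0}. if j = e0 then c else q) = (\<Prod>j\<in>UNIV - {e0}. q)" by (intro prod.cong) auto
  finally show "card {h :: 'd \<Rightarrow> nat. (\<forall>j. j \<noteq> e0 \<longrightarrow> h j < q) \<and> h e0 < c} = c * q ^ (CARD('d) - 1)"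
    unfolding eq by (simp add: card_Diff_singleton)
qed

text \<open>One coordinate keeps the kinds of points apart: its ranges for different kinds have gaps
  of at least 1. Only points of the same kind remain to be compared.\<close>

lemma same_kind:
  fixes z z' :: real
  assumes p: "(\<exists>\<rho> l. p = Pos \<rho> l \<and> A \<rho> l \<and> 1 \<le> z \<and> z \<le> 2) \<or> (\<exists>\<rho> l. p = Neg \<rho> l \<and> A \<rho> l \<and> -2 \<le> z \<and> z \<le> -1) \<or>
      (\<exists>s. p = Bp s \<and> C s \<and> 3 \<le> z) \<or> (\<exists>s. p = Bm s \<and> C s \<and> z \<le> -3) \<or> (p = Orig \<and> z = 0)"
    and p': "(\<exists>\<rho> l. p' = Pos \<rho> l \<and> A \<rho> l \<and> 1 \<le> z' \<and> z' \<le> 2) \<or> (\<exists>\<rho> l. p' = Neg \<rho> l \<and> A \<rho> l \<and> -2 \<le> z' \<and> z' \<le> -1) \<or>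
      (\<exists>s. p' = Bp s \<and> C s \<and> 3 \<le> z') \<or> (\<exists>s. p' = Bm s \<and> C s \<and> z' \<le> -3) \<or> (p' = Orig \<and> z' = 0)"
    and z: "z - z' < 1" "z' - z < 1"
  shows "(\<exists>\<rho> l \<rho>' l'. p = Pos \<rho> l \<and> p' = Pos \<rho>' l' \<and> A \<rho> l \<and> A \<rho>' l') \<or>
     (\<exists>\<rho> l \<rho>' l'. p = Neg \<rho> l \<and> p' = Neg \<rho>' l' \<and> A \<rho> l \<and> A \<rho>' l') \<or>
     (\<exists>s s'. p = Bp s \<and> p' = Bp s' \<and> C s \<and> C s') \<or> (\<exists>s s'. p = Bm s \<and> p' = Bm s' \<and> C s \<and> C s') \<or> (p = Orig \<and> p' = Orig)"
proof (cases p)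
  case (Pos a b)
  thus ?thesis using p p' z by (cases p') simp_all
next
  case (Neg a b)
  thus ?thesis using p p' z by (cases p') simp_all
next
  case (Bp a)
  thus ?thesis using p p' z by (cases p') simp_all
next
  case (Bm a)
  thus ?thesis using p p' z by (cases p') simp_all
next
  case Orig
  thus ?thesis using p p' z by (cases p') simp_all
qed

text \<open>Rays pass through a grid of mesh \<open>1 / q\<close> in a hyperplane at height 1, and a
  row point is its abscissa times the grid point. Points with different copy or index are separated
  in height by \<open>row_packing\<close>; with the same copy and index they lie at equal height at
  least 1 over different grid points. The points b fill a grid box at height 3 and above.\<close>

lemma dense_config:
  fixes m M q NB w C :: nat
  assumes d3: "CARD('d::finite) \<ge> 3" and M: "M \<ge> 1" and q: "M * (2 * nshift m * npts m) \<le> q"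
    and NB: "NB \<le> C * q ^ CARD('d)" and w: "(CARD('d) - 2) * w \<le> NB"
  obtains P :: "(real ^ 'd) set" where "finite P"
    "card P = q ^ (CARD('d) - 1) * (M * (2 * nshift m * npts m)) + 2 * NB + (if odd CARD('d) then 1 else 0)"
    "general_position P"
    "\<forall>x\<in>P. \<forall>y\<in>P. x \<noteq> y \<longrightarrow> 1 / (2 * real q) \<le> dist x y \<and> dist x y \<le> 2 * real CARD('d) * (real C + 3) + 1"
    "q ^ (CARD('d) - 1) * (M * nshift m) * nedges m * w ^ (CARD('d) - 2) \<le> card {H. halving_hyperplane P H}"
proof -
  define n where "n = npts m"
  define R where "R = M * nshift m"
  have n0: "n > 0" using npts_pos by (simp add: n_def)
  have R0: "R > 0" using M by (simp add: R_def nshift_def)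
  have Rq: "2 * R * n \<le> q" using q by (simp add: R_def n_def mult_ac)
  have q0: "q > 0" using Rq R0 n0 by (metis gr0I le_zero_eq mult_is_0 neq0_conv zero_neq_numeral)
  obtain X Y0 F where F: "F \<subseteq> {..<n} \<times> {..<n}" "card F = nedges m" "\<And>i j. (i, j) \<in> F \<Longrightarrow> i \<noteq> j \<and> (j, i) \<notin> F"
    and X12: "\<And>t i. t < R \<Longrightarrow> i < n \<Longrightarrow> 1 \<le> X t i \<and> X t i \<le> 2"
    and Xsep: "\<And>t i t' i'. t < R \<Longrightarrow> i < n \<Longrightarrow> t' < R \<Longrightarrow> i' < n \<Longrightarrow> (t, i) \<noteq> (t', i') \<Longrightarrow>
        1 / real (2 * R * n) \<le> \<bar>X t i - X t' i'\<bar>"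
    and hp: "\<And>t i j. t < R \<Longrightarrow> (i, j) \<in> F \<Longrightarrow> halving_pair n (X t) (Y0 t) i j"
    by (rule row_packing[OF M, of m, folded R_def n_def]) blast
  have finF: "finite F" using F(1) finite_subset by blast
  obtain Y H where lines: "\<And>t i j. t < R \<Longrightarrow> (i, j) \<in> F \<Longrightarrow> nice_pair n (X t) (Y t) H i j"
  proof (rule normalise_rows[of F R n X Y0, OF finF])
    show "halving_pair n (X t) (Y0 t) i j" if "t < R" "(i, j) \<in> F" for t i j using hp that by blast
    show thesis if "\<And>t i j. t < R \<Longrightarrow> (i, j) \<in> F \<Longrightarrow> nice_pair n (X t) (Y' t) H i j" for Y' H
      using \<open>\<And>Y H. (\<And>t i j. t < R \<Longrightarrow> (i, j) \<in> F \<Longrightarrow> nice_pair n (X t) (Y t) H i j) \<Longrightarrow> thesis\<close> that .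
  qed
  have Xq: "1 / real q \<le> \<bar>X t i - X t' i'\<bar>"
    if "t < R" "i < n" "t' < R" "i' < n" "(t, i) \<noteq> (t', i')" for t i t' i'
  proof -
    have "1 / real q \<le> 1 / real (2 * R * n)"
      using Rq R0 n0 by (intro divide_left_mono) (simp_all only: of_nat_le_iff of_nat_0_less_iff mult_pos_pos zero_less_numeral zero_le_one of_nat_0_less_iff q0)
    thus ?thesis using Xsep[OF that] by linarith
  qed
  obtain e0 :: 'd where True by simp
  define Gr where "Gr = {h :: 'd \<Rightarrow> nat. (\<forall>j. j \<noteq> e0 \<longrightarrow> h j < q) \<and> h e0 < 1}"
  define Bg where "Bg = {h :: 'd \<Rightarrow> nat. (\<forall>j. j \<noteq> e0 \<longrightarrow> h j < q) \<and> h e0 < C * q}"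
  have finGr: "finite Gr" and cGr: "card Gr = q ^ (CARD('d) - 1)" unfolding Gr_def using card_grid[of e0 q 1] by auto
  have finBg: "finite Bg" and cBg: "card Bg = C * q ^ CARD('d)"
  proof -
    show "finite Bg" unfolding Bg_def by (rule card_grid)
    have "q * q ^ (CARD('d) - 1) = q ^ CARD('d)" using d3 by (simp add: power_eq_if)
    thus "card Bg = C * q ^ CARD('d)" unfolding Bg_def card_grid(2) by (simp add: mult.assoc)
  qed
  obtain hs where hs: "inj_on hs {..<NB}" "hs ` {..<NB} \<subseteq> Bg"
    using card_le_inj[of "{..<NB}" Bg] finBg cBg NB by auto
  \<comment> \<open>The second component is ignored: all \<open>R\<close> copies belonging to one
    grid point lie near the same ray. Their interleaving abscissas keep them apart, and the generic
    perturbation makes their directions distinct.\<close>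
  define ub :: "('d \<Rightarrow> nat) \<times> nat \<Rightarrow> real ^ 'd" where "ub \<rho> = (\<chi> j. if j = e0 then 1 else real (fst \<rho> j) / real q)" for \<rho>
  define bb :: "nat \<Rightarrow> real ^ 'd" where "bb s = (\<chi> j. if j = e0 then 3 + real (hs s j) / real q else real (hs s j) / real q)" for s
  define Rw where "Rw = Gr \<times> {..<R}"
  have finRw: "finite Rw" using finGr by (simp add: Rw_def)
  \<comment> \<open>\<open>None\<close> is the index of the flattening direction \<open>v\<close>:
    any generic vector will do, so it is taken near 0.\<close>
  define base :: "(('d \<Rightarrow> nat) \<times> nat + nat) option \<Rightarrow> real ^ 'd" where
    "base k = (case k of None \<Rightarrow> 0 | Some (Inl \<rho>) \<Rightarrow> ub \<rho> | Some (Inr s) \<Rightarrow> bb s)" for k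
  define KI where "KI = insert None (Some ` (Inl ` Rw \<union> Inr ` {..<NB}))"
  have finKI: "finite KI" using finRw by (simp add: KI_def)
  \<comment> \<open>A row point moves by at most \<open>2 * \<epsilon>\<close> when its direction is
    perturbed, as abscissas are at most 2, and by \<open>\<epsilon>\<close> in the final
    perturbation. For a pair this is \<open>6 * \<epsilon>\<close>, less than half of the mesh
    \<open>1 / q\<close>.\<close>
  define \<epsilon> where "\<epsilon> = 1 / (16 * real q)"
  have \<epsilon>0: "\<epsilon> > 0" using q0 by (simp add: \<epsilon>_def)
  have gen0: "affinely_generic ({0} :: (real ^ 'd) set)" unfolding affinely_generic_def
    by (auto simp: subset_singleton_iff affine_dependent_def)
  obtain G where G: "\<forall>k\<in>KI. dist (G k) (base k) < \<epsilon>" "inj_on G KI" "G ` KI \<inter> {0} = {}" "affinely_generic ({0} \<union> G ` KI)"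
    using generic_perturbation[OF finKI _ gen0 \<epsilon>0, of base] by auto
  define u where "u \<rho> = G (Some (Inl \<rho>))" for \<rho>
  define b where "b s = G (Some (Inr s))" for s
  define v where "v = G None"
  have GK: "insert v (u ` Rw \<union> b ` {..<NB}) = G ` KI" by (auto simp: u_def b_def v_def KI_def image_image)
  have mem: "None \<in> KI" "\<And>\<rho>. \<rho> \<in> Rw \<Longrightarrow> Some (Inl \<rho>) \<in> KI" "\<And>s. s < NB \<Longrightarrow> Some (Inr s) \<in> KI" by (auto simp: KI_def)
  interpret A: assembly Rw u n "\<lambda>\<rho>. X (snd \<rho>)" "\<lambda>\<rho>. Y (snd \<rho>)" F NB b v H
  proof
    show "finite Rw" "F \<subseteq> {..<n} \<times> {..<n}" "even n" by (fact finRw, fact F(1), simp add: n_def even_npts)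
    show "i \<noteq> j \<and> (j, i) \<notin> F" if "(i, j) \<in> F" for i j using F(3)[OF that] .
    show "X (snd \<rho>) l > 0" if "\<rho> \<in> Rw" "l < n" for \<rho> l using X12[of "snd \<rho>" l] that by (auto simp: Rw_def)
    show "3 \<le> DIM(real ^ 'd)" using d3 by simp
    show "nice_pair n (X (snd \<rho>)) (Y (snd \<rho>)) H i j" if "\<rho> \<in> Rw" "(i, j) \<in> F" for \<rho> i j
      using lines[of "snd \<rho>" i j] that by (auto simp: Rw_def)
    show "independent S" if "S \<subseteq> insert v (u ` Rw \<union> b ` {..<NB})" "card S = DIM(real ^ 'd)" for S
      using that G(3,4) card_ge_0_finite[of S] unfolding GK
      by (intro affinely_generic_imp_independent[of "G ` KI"]) auto
    show "inj_on u Rw" "inj_on b {..<NB}" "u ` Rw \<inter> b ` {..<NB} = {}" "v \<notin> u ` Rw" "v \<notin> b ` {..<NB}"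
      using G(2) mem unfolding u_def b_def v_def inj_on_def by blast+
  qed
  have dd: "A.dd = CARD('d) - 2" unfolding A.dd_def by simp
  have oddd: "odd A.dd = odd CARD('d)" unfolding dd using d3 by simp
  obtain P' where P': "inj_on P' A.I" "\<forall>p\<in>A.I. dist (P' p) (A.P 0 p) < \<epsilon>" "general_position (P' ` A.I)"
    "card Rw * card F * w ^ A.dd \<le> card {H. halving_hyperplane (P' ` A.I) H}"
    using A.many_halving_hyperplanes[of w \<epsilon>] w \<epsilon>0 unfolding dd by metis
  define Z :: "(('d \<Rightarrow> nat) \<times> nat) pt \<Rightarrow> real ^ 'd" where "Z p = (case p of
      Pos \<rho> l \<Rightarrow> X (snd \<rho>) l *\<^sub>R ub \<rho> | Neg \<rho> l \<Rightarrow> - (X (snd \<rho>) l *\<^sub>R ub \<rho>) | Bp s \<Rightarrow> bb s | Bm s \<Rightarrow> - bb s | Orig \<Rightarrow> 0)" for p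
  have Gu: "dist (u \<rho>) (ub \<rho>) < \<epsilon>" if "\<rho> \<in> Rw" for \<rho> using G(1) mem(2)[OF that] by (force simp: u_def base_def)
  have Gb: "dist (b s) (bb s) < \<epsilon>" if "s < NB" for s using G(1) mem(3)[OF that] by (force simp: b_def base_def)
  have near0: "dist (A.P 0 p) (Z p) \<le> 2 * \<epsilon>" if p: "p \<in> A.I" for p
  proof -
    have S: "dist (X (snd \<rho>) l *\<^sub>R u \<rho>) (X (snd \<rho>) l *\<^sub>R ub \<rho>) \<le> 2 * \<epsilon>" if "\<rho> \<in> Rw" "l < n" for \<rho> l
    proof -
      have x: "1 \<le> X (snd \<rho>) l" "X (snd \<rho>) l \<le> 2" using X12[of "snd \<rho>" l] that by (auto simp: Rw_def)
      have "dist (X (snd \<rho>) l *\<^sub>R u \<rho>) (X (snd \<rho>) l *\<^sub>R ub \<rho>) = X (snd \<rho>) l * dist (u \<rho>) (ub \<rho>)"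
        using x by (simp add: dist_norm scaleR_diff_right[symmetric])
      also have "\<dots> \<le> 2 * \<epsilon>" using x Gu[OF that(1)] by (intro mult_mono) auto
      finally show ?thesis .
    qed
    have N: "dist (- x) (- y) = dist x y" for x y :: "real ^ 'd" by (simp add: dist_norm norm_minus_commute)
    show ?thesis using p S Gb \<epsilon>0 unfolding A.I_def
      by (fastforce simp: Z_def N split: if_splits)
  qed
  have near: "dist (P' p) (Z p) \<le> 3 * \<epsilon>" if p: "p \<in> A.I" for p
    using near0[OF p] P'(2) p dist_triangle[of "P' p" "Z p" "A.P 0 p"] by force
  have distN: "dist (- x) (- y) = dist x y" for x y :: "real ^ 'd" by (simp add: dist_norm norm_minus_commute)
  have cdist: "c \<le> dist x y" if "c \<le> \<bar>x $ j - y $ j\<bar>" for c j and x y :: "real ^ 'd"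
    using that dist_vec_nth_le[of x j y] by (simp add: dist_real_def)
  have natdiff: "1 / real q \<le> \<bar>real i / real q - real j / real q\<bar>" if "i \<noteq> j" for i j :: nat
  proof -
    have "1 \<le> \<bar>real i - real j\<bar>" using that by linarith
    hence "1 / real q \<le> \<bar>real i - real j\<bar> / real q" by (intro divide_right_mono) auto
    thus ?thesis by (simp add: diff_divide_distrib[symmetric])
  qed
  have PP: "1 / real q \<le> dist (X (snd \<rho>) l *\<^sub>R ub \<rho>) (X (snd \<rho>') l' *\<^sub>R ub \<rho>')"
    if r: "\<rho> \<in> Rw" "l < n" "\<rho>' \<in> Rw" "l' < n" "(\<rho>, l) \<noteq> (\<rho>', l')" for \<rho> l \<rho>' l'
  proof (cases "(snd \<rho>, l) = (snd \<rho>', l')")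
    case False
    have "1 / real q \<le> \<bar>X (snd \<rho>) l - X (snd \<rho>') l'\<bar>" using Xq[OF _ r(2) _ r(4) False] r by (auto simp: Rw_def)
    thus ?thesis by (intro cdist[of _ _ e0]) (simp add: ub_def)
  next
    case True
    hence "fst \<rho> \<noteq> fst \<rho>'" using r(5) by (auto simp: prod_eq_iff)
    then obtain j where j: "fst \<rho> j \<noteq> fst \<rho>' j" by blast
    have "fst \<rho> e0 = 0" "fst \<rho>' e0 = 0" using r by (auto simp: Rw_def Gr_def)
    hence je: "j \<noteq> e0" using j by auto
    have x: "1 \<le> X (snd \<rho>) l" using X12[of "snd \<rho>" l] r by (auto simp: Rw_def)
    have "1 / real q \<le> 1 * \<bar>real (fst \<rho> j) / real q - real (fst \<rho>' j) / real q\<bar>" using natdiff[OF j] by simp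
    also have "\<dots> \<le> X (snd \<rho>) l * \<bar>real (fst \<rho> j) / real q - real (fst \<rho>' j) / real q\<bar>"
      using x by (intro mult_right_mono) auto
    also have "\<dots> = \<bar>X (snd \<rho>) l * (real (fst \<rho> j) / real q) - X (snd \<rho>) l * (real (fst \<rho>' j) / real q)\<bar>"
      unfolding right_diff_distrib[symmetric] abs_mult using x by simp
    finally show ?thesis using True je by (intro cdist[of _ _ j]) (simp add: ub_def)
  qed
  have BB: "1 / real q \<le> dist (bb s) (bb s')" if s: "s < NB" "s' < NB" "s \<noteq> s'" for s s'
  proof -
    have "hs s \<noteq> hs s'" using hs(1) s by (auto simp: inj_on_def)
    then obtain j where "hs s j \<noteq> hs s' j" by blast
    thus ?thesis using natdiff[of "hs s j" "hs s' j"] by (intro cdist[of _ _ j]) (auto simp: bb_def)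
  qed
  have Icases: "(\<exists>\<rho> l. p = Pos \<rho> l \<and> (\<rho> \<in> Rw \<and> l < n) \<and> 1 \<le> Z p $ e0 \<and> Z p $ e0 \<le> 2) \<or>
     (\<exists>\<rho> l. p = Neg \<rho> l \<and> (\<rho> \<in> Rw \<and> l < n) \<and> -2 \<le> Z p $ e0 \<and> Z p $ e0 \<le> -1) \<or>
     (\<exists>s. p = Bp s \<and> s < NB \<and> 3 \<le> Z p $ e0) \<or> (\<exists>s. p = Bm s \<and> s < NB \<and> Z p $ e0 \<le> -3) \<or> (p = Orig \<and> Z p $ e0 = 0)"
    if "p \<in> A.I" for p
    using that X12 unfolding A.I_def by (auto simp: Z_def ub_def bb_def Rw_def split: if_splits)
  have Zbd: "norm (Z p) \<le> real CARD('d) * (real C + 3)" if p: "p \<in> A.I" for p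
  proof -
    have gq: "real (fst \<rho> j) / real q \<le> 1" if "\<rho> \<in> Rw" for \<rho> j
    proof (cases "j = e0")
      case True thus ?thesis using that by (auto simp: Rw_def Gr_def)
    next
      case False
      hence "fst \<rho> j < q" using that by (auto simp: Rw_def Gr_def)
      thus ?thesis by (simp add: divide_le_eq)
    qed
    have ubj: "0 \<le> ub \<rho> $ j \<and> ub \<rho> $ j \<le> 1" if "\<rho> \<in> Rw" for \<rho> j using gq[OF that] by (simp add: ub_def)
    have row: "\<bar>X (snd \<rho>) l * ub \<rho> $ j\<bar> \<le> real C + 3" if "\<rho> \<in> Rw" "l < n" for \<rho> l j
    proof -
      have "0 \<le> X (snd \<rho>) l" "X (snd \<rho>) l \<le> 2" using X12[of "snd \<rho>" l] that by (auto simp: Rw_def)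
      hence "\<bar>X (snd \<rho>) l\<bar> * \<bar>ub \<rho> $ j\<bar> \<le> 2 * 1" using ubj[OF that(1)] by (intro mult_mono) auto
      thus ?thesis by (simp add: abs_mult)
    qed
    have bbj: "0 \<le> bb s $ j \<and> bb s $ j \<le> real C + 3" if "s < NB" for s j
    proof (cases "j = e0")
      case True
      have "hs s e0 < C * q" using hs(2) that by (auto simp: Bg_def)
      hence "real (hs s e0) \<le> real C * real q" by (metis less_imp_le of_nat_le_iff of_nat_mult)
      thus ?thesis using True q0 by (simp add: bb_def divide_le_eq)
    next
      case False
      hence "hs s j < q" using hs(2) that by (auto simp: Bg_def)
      hence "real (hs s j) / real q \<le> 1" by (simp add: divide_le_eq)
      thus ?thesis using False by (simp add: bb_def)
    qed
    have "\<bar>Z p $ j\<bar> \<le> real C + 3" for j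
      using Icases[OF p]
    proof (elim disjE exE conjE)
      fix \<rho> l assume "p = Pos \<rho> l" "\<rho> \<in> Rw" "l < n"
      thus ?thesis using row[of \<rho> l j] by (simp add: Z_def)
    next
      fix \<rho> l assume "p = Neg \<rho> l" "\<rho> \<in> Rw" "l < n"
      thus ?thesis using row[of \<rho> l j] by (simp add: Z_def)
    next
      fix s assume "p = Bp s" "s < NB"
      thus ?thesis using bbj[of s j] by (simp add: Z_def)
    next
      fix s assume "p = Bm s" "s < NB"
      thus ?thesis using bbj[of s j] by (simp add: Z_def)
    next
      assume "p = Orig"
      thus ?thesis by (simp add: Z_def)
    qed
    hence "(\<Sum>j\<in>UNIV. \<bar>Z p $ j\<bar>) \<le> (\<Sum>j\<in>(UNIV :: 'd set). real C + 3)" by (intro sum_mono) auto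
    thus ?thesis using norm_le_l1_cart[of "Z p"] by simp
  qed
  show thesis
  proof (rule that[of "P' ` A.I"])
    show "finite (P' ` A.I)" using A.finI by simp
    have "card (P' ` A.I) = card A.I" using P'(1) by (rule card_image)
    also have "\<dots> = 2 * (card Rw * n) + 2 * NB + (if odd CARD('d) then 1 else 0)" unfolding A.card_I oddd ..
    finally show "card (P' ` A.I) = q ^ (CARD('d) - 1) * (M * (2 * nshift m * npts m)) + 2 * NB + (if odd CARD('d) then 1 else 0)"
      using cGr by (simp add: Rw_def R_def n_def card_cartesian_product mult_ac)
    show "general_position (P' ` A.I)" by fact
    show "q ^ (CARD('d) - 1) * (M * nshift m) * nedges m * w ^ (CARD('d) - 2) \<le> card {H. halving_hyperplane (P' ` A.I) H}"
      using P'(4) cGr F(2) unfolding dd by (simp add: Rw_def R_def card_cartesian_product mult_ac)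
    show "\<forall>x\<in>P' ` A.I. \<forall>y\<in>P' ` A.I. x \<noteq> y \<longrightarrow>
        1 / (2 * real q) \<le> dist x y \<and> dist x y \<le> 2 * real CARD('d) * (real C + 3) + 1"
    proof (intro ballI impI)
      fix x y assume "x \<in> P' ` A.I" "y \<in> P' ` A.I" "x \<noteq> y"
      then obtain p p' where p: "p \<in> A.I" "p' \<in> A.I" "p \<noteq> p'" "x = P' p" "y = P' p'" by blast
      have comp: "\<bar>Z p $ j - Z p' $ j\<bar> \<le> dist (Z p) (Z p')" for j
        using dist_vec_nth_le[of "Z p" j "Z p'"] by (simp add: dist_real_def)
      have q1: "1 / real q \<le> 1" using q0 by simp
      have Zsep: "1 / real q \<le> dist (Z p) (Z p')"
      proof (cases "1 \<le> \<bar>Z p $ e0 - Z p' $ e0\<bar>")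
        case True
        thus ?thesis using comp[of e0] q1 by linarith
      next
        case False
        hence near: "Z p $ e0 - Z p' $ e0 < 1" "Z p' $ e0 - Z p $ e0 < 1" by linarith+
        from same_kind[OF Icases[OF p(1)] Icases[OF p(2)] near] show ?thesis
        proof (elim disjE exE conjE)
          fix \<rho> l \<rho>' l' assume a: "p = Pos \<rho> l" "p' = Pos \<rho>' l'" "\<rho> \<in> Rw" "l < n" "\<rho>' \<in> Rw" "l' < n"
          hence "(\<rho>, l) \<noteq> (\<rho>', l')" using p(3) by auto
          from PP[OF a(3-6) this] show ?thesis using a(1,2) by (simp only: Z_def pt.case)
        next
          fix \<rho> l \<rho>' l' assume a: "p = Neg \<rho> l" "p' = Neg \<rho>' l'" "\<rho> \<in> Rw" "l < n" "\<rho>' \<in> Rw" "l' < n"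
          hence "(\<rho>, l) \<noteq> (\<rho>', l')" using p(3) by auto
          from PP[OF a(3-6) this] show ?thesis using a(1,2) by (simp only: Z_def pt.case distN)
        next
          fix s s' assume a: "p = Bp s" "p' = Bp s'" "s < NB" "s' < NB"
          hence "s \<noteq> s'" using p(3) by auto
          from BB[OF a(3,4) this] show ?thesis using a(1,2) by (simp only: Z_def pt.case)
        next
          fix s s' assume a: "p = Bm s" "p' = Bm s'" "s < NB" "s' < NB"
          hence "s \<noteq> s'" using p(3) by auto
          from BB[OF a(3,4) this] show ?thesis using a(1,2) by (simp only: Z_def pt.case distN)
        qed (use p(3) in simp)
      qed
      have "dist (Z p) (Z p') \<le> 2 * real CARD('d) * (real C + 3)"
        using Zbd[OF p(1)] Zbd[OF p(2)] norm_triangle_ineq4[of "Z p" "Z p'"] by (simp add: dist_norm)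
      moreover have "\<bar>dist x y - dist (Z p) (Z p')\<bar> \<le> 6 * \<epsilon>"
      proof -
        have "dist x (Z p) \<le> 3 * \<epsilon>" "dist y (Z p') \<le> 3 * \<epsilon>" using near p by auto
        moreover have "dist (Z p') y = dist y (Z p')" "dist (Z p) x = dist x (Z p)" by (simp_all add: dist_commute)
        ultimately show ?thesis
          using dist_triangle[of x y "Z p"] dist_triangle[of "Z p" y "Z p'"]
            dist_triangle[of "Z p" "Z p'" x] dist_triangle[of x "Z p'" y] by linarith
      qed
      moreover have "6 * \<epsilon> \<le> 1" "1 / real q - 6 * \<epsilon> \<ge> 1 / (2 * real q)" using q0 by (auto simp: \<epsilon>_def field_simps)
      ultimately show "1 / (2 * real q) \<le> dist x y \<and> dist x y \<le> 2 * real CARD('d) * (real C + 3) + 1"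
        using Zsep by linarith
    qed
  qed
qed


section \<open>Growth of the parameters and their choice for given n\<close>

definition row_slots :: "nat \<Rightarrow> nat" where "row_slots m = 2 * nshift m * npts m"

text \<open>Each step multiplies edges per point by 8/6; the initial segment has one edge on two
  points.\<close>

lemma nedges_eq: "real (nedges m) = real (npts m) * (4/3) ^ m / 2"
  by (induction m) (simp_all add: field_simps)

text \<open>The exponent \<open>(m + 1)\<^sup>2\<close> absorbs a factor exponential in m, since (m
  + 1) + (m + 1)^2 is at most (m + 2)^2. The same induction bounds \<open>1 / rad m\<close>.\<close>

lemma npts_le: "npts m \<le> 64 ^ (m + 1)\<^sup>2"
proof (induction m)
  case (Suc m)
  have "npts (Suc m) = (6 * 8 ^ m) * npts m" by simp
  also have "\<dots> \<le> 64 ^ (m + 1) * 64 ^ (m + 1)\<^sup>2"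
  proof (intro mult_mono Suc)
    have "6 * 8 ^ m \<le> 64 * (64 :: nat) ^ m" by (intro mult_mono power_mono) auto
    thus "6 * 8 ^ m \<le> (64 :: nat) ^ (m + 1)" by simp
  qed auto
  also have "\<dots> = 64 ^ (m + 1 + (m + 1)\<^sup>2)" by (simp add: power_add)
  also have "\<dots> \<le> 64 ^ (Suc m + 1)\<^sup>2" by (intro power_increasing) (auto simp: power2_eq_square)
  finally show ?case .
qed simp

text \<open>The base is 1600000 * 64, so that one step costs at most its (m + 1)-st power.\<close>

lemma inverse_rad_le: "1 / rad m \<le> 102400000 ^ (m + 1)\<^sup>2"
proof (induction m)
  case (Suc m)
  have "1 / rad (Suc m) = (1600000 * 64 ^ m) * (1 / rad m)" by simp
  also have "\<dots> \<le> 102400000 ^ (m + 1) * 102400000 ^ (m + 1)\<^sup>2"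
  proof (intro mult_mono Suc)
    have "1600000 * 64 ^ m \<le> 102400000 * (102400000 :: real) ^ m" by (intro mult_mono power_mono) auto
    thus "1600000 * 64 ^ m \<le> (102400000 :: real) ^ (m + 1)" by simp
  qed (use rad_pos[of m] in auto)
  also have "\<dots> = 102400000 ^ (m + 1 + (m + 1)\<^sup>2)" by (simp add: power_add)
  also have "\<dots> \<le> 102400000 ^ (Suc m + 1)\<^sup>2" by (intro power_increasing) (auto simp: power2_eq_square)
  finally show ?case .
qed simp

lemma rad_le: "rad m \<le> 1/4"
proof (induction m)
  case (Suc m)
  have "(1 :: real) \<le> 1600000 * 64 ^ m" using one_le_power[of "64 :: real" m] by linarith
  hence "rad m / (1600000 * 64 ^ m) \<le> rad m / 1"
    using rad_pos[of m] by (intro divide_left_mono) auto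
  thus ?case using Suc unfolding rad.simps by linarith
qed simp

text \<open>The base is 10 * 102400000 * 64; the 10 is the 2 in \<open>row_slots\<close> times the 5
  that bounds \<open>nshift m\<close> by \<open>5 / rad m\<close>.\<close>

lemma row_slots_le: "real (row_slots m) \<le> 65536000000 ^ (m + 1)\<^sup>2"
proof -
  have r: "rad m > 0" "1 / rad m \<ge> 1" using rad_pos[of m] rad_le[of m] by auto
  have "real (nshift m) \<le> 4 / rad m + 1" using r unfolding nshift_def by (simp add: of_nat_nat)
  also have "\<dots> \<le> 5 * (1 / rad m)" using r by (simp add: field_simps)
  finally have "real (nshift m) \<le> 5 * 102400000 ^ (m + 1)\<^sup>2" using inverse_rad_le[of m] by linarith
  moreover have "real (npts m) \<le> real (64 ^ (m + 1)\<^sup>2)" using npts_le[of m] by (simp only: of_nat_le_iff)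
  ultimately have "real (row_slots m) \<le> 2 * (5 * 102400000 ^ (m + 1)\<^sup>2) * 64 ^ (m + 1)\<^sup>2"
    unfolding row_slots_def of_nat_mult by (intro mult_mono) simp_all
  also have "\<dots> = 10 * (102400000 * 64) ^ (m + 1)\<^sup>2" by (simp only: power_mult_distrib)
  also have "\<dots> \<le> 10 ^ (m + 1)\<^sup>2 * (102400000 * 64) ^ (m + 1)\<^sup>2"
    using power_increasing[of 1 "(m + 1)\<^sup>2" "10 :: real"] by (intro mult_right_mono) auto
  also have "\<dots> = 65536000000 ^ (m + 1)\<^sup>2" by (simp add: power_mult_distrib[symmetric])
  finally show ?thesis .
qed

lemma npts_ge: "2 ^ m \<le> npts m"
proof (induction m)
  case (Suc m)
  have "2 * 2 ^ m \<le> (6 * 8 ^ m) * npts m" using Suc by (intro mult_mono) auto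
  thus ?case by simp
qed simp

lemma less_row_slots: "m < row_slots m"
proof -
  have "m < 2 ^ m" by simp
  also have "\<dots> \<le> npts m" by (rule npts_ge)
  also have "\<dots> \<le> row_slots m" by (simp add: row_slots_def nshift_def)
  finally show ?thesis .
qed

lemma greatest_nat_below:
  fixes f :: "nat \<Rightarrow> nat"
  assumes "f k \<le> n" and "\<And>i. i \<le> f i"
  obtains j where "k \<le> j" "f j \<le> n" "n < f (Suc j)"
proof -
  have "{j. f j \<le> n} \<subseteq> {..n}"
  proof
    fix j assume "j \<in> {j. f j \<le> n}"
    thus "j \<in> {..n}" using assms(2)[of j] by simp
  qed
  hence fin: "finite {j. f j \<le> n}" by (rule finite_subset) simp
  define j where "j = Max {j. f j \<le> n}"
  have "j \<in> {j. f j \<le> n}" unfolding j_def using fin assms(1) by (intro Max_in) auto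
  moreover have "k \<le> j" unfolding j_def using fin assms(1) by (intro Max_ge) auto
  moreover have "\<not> f (Suc j) \<le> n"
  proof
    assume "f (Suc j) \<le> n"
    hence "Suc j \<le> j" unfolding j_def using fin by (intro Max_ge) auto
    thus False by simp
  qed
  ultimately show thesis using that by auto
qed

text \<open>The mesh is about n^(-1/d), and the planar level m is the largest one whose slots fit
  into q. The rows use at most a quarter of the points, so the filling points b are still numerous
  enough to contribute a factor of order n^(d-2).\<close>

lemma large_dense_sets:
  assumes d3: "CARD('d::finite) \<ge> 3"
  shows "\<exists>(\<gamma>::real) (c::real) n1. \<gamma> > 0 \<and> c > 0 \<and> (\<forall>n\<ge>n1. even (n + CARD('d)) \<longrightarrow>
     (\<exists>P :: (real ^ 'd) set. finite P \<and> card P = n \<and> gamma_dense \<gamma> P \<and> general_position P \<and>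
        real (card {H. halving_hyperplane P H}) \<ge> real n ^ (CARD('d) - 1) * exp (c * sqrt (ln (real n)))))"
proof -
  define d where "d = CARD('d)"
  define e where "e = d - 2"
  \<comment> \<open>At most n / 2 points b are needed, and n is below 4 (2 q)^d.\<close>
  define C :: nat where "C = 2 ^ (d + 1)"
  define hi where "hi = 2 * real d * (real C + 3) + 1"
  define K :: real where "K = 65536000000"
  define S where "S = sqrt (real d * ln (8 * K))"
  \<comment> \<open>Since \<open>sqrt (ln n)\<close> is at most \<open>(m + 2) * S\<close>, the
    exponent uses only half of the gain (4/3)^m; the other half swallows the constant
    \<open>c1\<close>, from \<open>m0\<close> on.\<close>
  define c where "c = ln (4/3) / (2 * S)"
  \<comment> \<open>The product of three losses: 4 * 2^d from n against q^d, 8 from rounding in the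
    number of rows and edges, and 8 e for each choice of a point b.\<close>
  define c1 where "c1 = 1 / (32 * 2 ^ d * (8 * real e) ^ e)"
  have d: "d \<ge> 3" "e \<ge> 1" "d = e + 2" using d3 by (auto simp: d_def e_def)
  have hi0: "hi > 0" by (simp add: hi_def add_nonneg_pos)
  have S0: "S > 0" using d by (auto simp: S_def K_def)
  have l43: "ln (4/3 :: real) > 0" by simp
  have c0: "c > 0" using S0 l43 by (simp add: c_def)
  have c10: "c1 > 0" using d by (simp add: c1_def)
  obtain m0 :: nat where m0: "real m0 \<ge> (ln (4/3) - ln c1) / (ln (4/3) / 2)" using real_arch_simple by blast
  have gain: "exp (c * (real (m + 2) * S)) \<le> c1 * (4/3) ^ m" if "m \<ge> m0" for m
  proof -
    have "(ln (4/3) - ln c1) / (ln (4/3) / 2) \<le> real m" using m0 that by linarith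
    hence "ln (4/3) - ln c1 \<le> real m * (ln (4/3) / 2)" using l43 by (simp only: pos_divide_le_eq half_gt_zero)
    moreover have "c * (real (m + 2) * S) = real m * (ln (4/3) / 2) + ln (4/3)"
      using S0 by (simp add: c_def field_simps)
    moreover have "ln (c1 * (4/3) ^ m) = ln c1 + real m * ln (4/3)" using c10 by (simp add: ln_mult ln_realpow)
    ultimately have "c * (real (m + 2) * S) \<le> ln (c1 * (4/3) ^ m)" by linarith
    thus ?thesis using c10 by (simp add: ln_ge_iff)
  qed
  \<comment> \<open>The first summand forces \<open>q \<ge> row_slots m0\<close>, hence
    \<open>m \<ge> m0\<close>; the rest covers rounding in the number of points b.\<close>
  define n1 where "n1 = 4 * row_slots m0 ^ d + 8 * d + 8"
  show ?thesis
  proof (rule exI[of _ "2 * hi"], rule exI[of _ c], rule exI[of _ n1], intro conjI allI impI)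
    show "2 * hi > 0" "c > 0" using hi0 c0 by auto
    fix n assume n: "n \<ge> n1" and ev: "even (n + CARD('d))"
    have n8: "n \<ge> 8 * d + 8" using n by (simp add: n1_def)
    have mono: "i \<le> 4 * i ^ d" for i :: nat
    proof -
      have "i \<le> i ^ d" using d by (cases "i = 0") (auto intro: self_le_power)
      thus ?thesis by simp
    qed
    obtain q where q: "row_slots m0 \<le> q" "4 * q ^ d \<le> n" "n < 4 * Suc q ^ d"
      using greatest_nat_below[of "\<lambda>q. 4 * q ^ d" "row_slots m0" n] mono n unfolding n1_def by auto
    obtain m where m: "m0 \<le> m" "row_slots m \<le> q" "q < row_slots (Suc m)"
      using greatest_nat_below[of row_slots m0 q] less_row_slots q(1) by (metis less_imp_le)
    have s0: "row_slots m > 0" using less_row_slots[of m] by simp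
    have q0: "q > 0" using m(2) s0 by simp
    define M where "M = q div row_slots m"
    have M1: "M \<ge> 1" unfolding M_def using m(2) s0 by (simp add: div_greater_zero_iff Suc_leI)
    have Mq: "M * row_slots m \<le> q" by (simp add: M_def)
    have qM: "q < 2 * (M * row_slots m)"
    proof -
      have "q < (M + 1) * row_slots m" unfolding M_def using s0 by (simp add: dividend_less_div_times)
      also have "\<dots> \<le> (2 * M) * row_slots m" using M1 by (intro mult_right_mono) auto
      finally show ?thesis by simp
    qed
    \<comment> \<open>\<open>A\<close> counts the points of rows and balancing sets. It is even, so
      the parity of \<open>n\<close> and \<open>d\<close> lets \<open>n - A\<close> be filled by
      pairs b, -b and, for odd \<open>d\<close>, the single point near the origin.\<close>
    define A where "A = q ^ (d - 1) * (M * row_slots m)"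
    have "A \<le> q ^ (d - 1) * q" unfolding A_def using Mq by (intro mult_left_mono) auto
    also have "\<dots> = q ^ d" using d by (simp add: power_eq_if mult.commute)
    finally have A4: "4 * A \<le> n" using q(2) by linarith
    have evA: "even A" by (simp add: A_def row_slots_def)
    define o1 :: nat where "o1 = (if odd d then 1 else 0)"
    have "even (n - o1)" "o1 \<le> 1" using ev n8 unfolding o1_def d_def by auto
    hence "even (n - A - o1)" using evA A4 n8 by (simp add: diff_commute even_diff_nat)
    then obtain NB where NB: "n - A - o1 = 2 * NB" by blast
    have o1: "o1 \<le> 1" by (simp add: o1_def)
    have nsum: "A + 2 * NB + o1 = n" using NB A4 n8 o1 by linarith
    have q2: "4 * Suc q ^ d \<le> 4 * 2 ^ d * q ^ d"
    proof -
      have "Suc q ^ d \<le> (2 * q) ^ d" using q0 by (intro power_mono) auto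
      thus ?thesis by (simp add: power_mult_distrib)
    qed
    have NBC: "NB \<le> C * q ^ d"
    proof -
      have "2 * NB \<le> n" using nsum by linarith
      moreover have "2 * (C * q ^ d) = 4 * 2 ^ d * q ^ d" by (simp add: C_def)
      ultimately have "2 * NB \<le> 2 * (C * q ^ d)" using q(3) q2 by linarith
      thus ?thesis by simp
    qed
    define w where "w = NB div e"
    have ew: "e * w \<le> NB" by (simp add: w_def)
    obtain P :: "(real ^ 'd) set" where P: "finite P"
      "card P = q ^ (CARD('d) - 1) * (M * (2 * nshift m * npts m)) + 2 * NB + (if odd CARD('d) then 1 else 0)"
      "general_position P"
      "\<forall>x\<in>P. \<forall>y\<in>P. x \<noteq> y \<longrightarrow> 1 / (2 * real q) \<le> dist x y \<and> dist x y \<le> 2 * real CARD('d) * (real C + 3) + 1"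
      "q ^ (CARD('d) - 1) * (M * nshift m) * nedges m * w ^ (CARD('d) - 2) \<le> card {H. halving_hyperplane P H}"
      by (rule dense_config[OF d3 M1 Mq[unfolded row_slots_def] NBC[unfolded d_def] ew[unfolded e_def d_def]])
    have cP: "card P = n" using P(2) nsum by (simp add: A_def row_slots_def o1_def d_def)
    have dense: "gamma_dense (2 * hi) P"
    proof (rule gamma_dense_bounds[OF P(1)])
      show "1 / (2 * real q) > 0" using q0 by simp
      show "1 / (2 * real q) \<le> dist x y \<and> dist x y \<le> hi" if "x \<in> P" "y \<in> P" "x \<noteq> y" for x y
        using P(4) that by (simp add: hi_def d_def)
      have "real q ^ d \<le> real n" using q(2) by (metis le_trans of_nat_le_iff of_nat_power mult_le_mono1 nat_mult_1 one_le_numeral)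
      hence "root d (real q ^ d) \<le> root d (real n)" using d by (intro real_root_le_mono) auto
      hence "real q \<le> root d (real n)" using real_root_power_cancel[of d "real q"] d(1) by simp
      hence "2 * hi * real q \<le> 2 * hi * root d (real n)" using hi0 by (intro mult_left_mono) auto
      thus "hi / (1 / (2 * real q)) \<le> 2 * hi * root DIM(real ^ 'd) (real (card P))" using q0 cP by (simp add: d_def mult_ac)
    qed
    have n0: "real n > 0" using n8 by simp
    have sqrt_n: "sqrt (ln (real n)) \<le> real (m + 2) * S"
    proof -
      have "real q \<le> K ^ (m + 2)\<^sup>2"
        using m(3) row_slots_le[of "Suc m"] by (simp add: K_def)
      hence "real q ^ d \<le> (K ^ (m + 2)\<^sup>2) ^ d" by (intro power_mono) auto
      also have "\<dots> = K ^ (d * (m + 2)\<^sup>2)" by (simp only: power_mult[symmetric] mult.commute)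
      finally have qK: "real q ^ d \<le> K ^ (d * (m + 2)\<^sup>2)" .
      have "n \<le> 4 * 2 ^ d * q ^ d" using q(3) q2 by linarith
      hence "real n \<le> real (4 * 2 ^ d * q ^ d)" by (simp only: of_nat_le_iff)
      hence nq: "real n \<le> (4 * 2 ^ d) * real q ^ d" by simp
      have "4 * 2 ^ d \<le> (4 :: real) ^ d * 2 ^ d" using power_increasing[of 1 d "4 :: real"] d by (intro mult_right_mono) auto
      also have "\<dots> = 8 ^ d" by (simp add: power_mult_distrib[symmetric])
      also have "\<dots> \<le> 8 ^ (d * (m + 2)\<^sup>2)" by (intro power_increasing) auto
      finally have "(4 * 2 ^ d) * real q ^ d \<le> 8 ^ (d * (m + 2)\<^sup>2) * K ^ (d * (m + 2)\<^sup>2)"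
        using qK by (intro mult_mono) auto
      with nq have "real n \<le> 8 ^ (d * (m + 2)\<^sup>2) * K ^ (d * (m + 2)\<^sup>2)" by linarith
      also have "\<dots> = (8 * K) ^ (d * (m + 2)\<^sup>2)" by (simp add: power_mult_distrib)
      finally have "ln (real n) \<le> ln ((8 * K) ^ (d * (m + 2)\<^sup>2))" using n0 by (simp add: K_def)
      also have "\<dots> = (real (m + 2))\<^sup>2 * (real d * ln (8 * K))" by (subst ln_realpow) (auto simp: K_def)
      finally have "sqrt (ln (real n)) \<le> sqrt ((real (m + 2))\<^sup>2 * (real d * ln (8 * K)))" by simp
      also have "\<dots> = real (m + 2) * S" unfolding S_def real_sqrt_mult by simp
      finally show ?thesis .
    qed
    have wge: "real w \<ge> real n / (8 * real e)"
    proof -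
      have "NB < e * (w + 1)" using d dividend_less_times_div[of e NB] unfolding w_def by simp
      hence "NB + 1 \<le> e * w + e" by simp
      hence 1: "real NB + 1 \<le> real e * real w + real e" by (metis of_nat_1 of_nat_add of_nat_le_iff of_nat_mult)
      have "real A + 2 * real NB + real o1 = real n" "4 * real A \<le> real n" "real o1 \<le> 1" "8 * real e + 8 \<le> real n"
        using nsum A4 o1 n8 d by linarith+
      hence "real n \<le> 8 * (real e * real w)" using 1 by linarith
      thus ?thesis using d by (simp add: divide_le_eq mult_ac)
    qed
    have edges: "real q * (4/3) ^ m / 8 \<le> real (M * nshift m * nedges m)"
    proof -
      have "real (M * nshift m * nedges m) = real (M * row_slots m) * (4/3) ^ m / 4"
        by (simp add: nedges_eq row_slots_def)
      moreover have "real q \<le> 2 * real (M * row_slots m)" using qM by linarith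
      hence "real q * (4/3) ^ m \<le> (2 * real (M * row_slots m)) * (4/3) ^ m" by (intro mult_right_mono) auto
      ultimately show ?thesis by linarith
    qed
    have qd: "real n / (4 * 2 ^ d) \<le> real q ^ d"
    proof -
      have "n \<le> 4 * 2 ^ d * q ^ d" using q(3) q2 by linarith
      hence "real n \<le> real (4 * 2 ^ d * q ^ d)" by (simp only: of_nat_le_iff)
      thus ?thesis by (simp add: divide_le_eq mult_ac)
    qed
    have nd: "real n ^ (d - 1) = real n * real n ^ e" using d(3) by simp
    have "N * Ne * (1 / (32 * D * E) * T) = (N / (4 * D)) * (T / 8) * (Ne / E)" for N Ne D E T :: real by simp
    hence "real n ^ (d - 1) * (c1 * (4/3) ^ m) = (real n / (4 * 2 ^ d)) * ((4/3) ^ m / 8) * (real n / (8 * real e)) ^ e"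
      unfolding nd c1_def power_divide[of "real n"] by blast
    also have "\<dots> \<le> real q ^ d * ((4/3) ^ m / 8) * real w ^ e"
      using qd wge by (intro mult_mono power_mono) auto
    also have "real q ^ d = real q ^ (d - 1) * real q" using d by (simp add: power_eq_if)
    also have "real q ^ (d - 1) * real q * ((4/3) ^ m / 8) * real w ^ e = real q ^ (d - 1) * (real q * (4/3) ^ m / 8) * real w ^ e"
      by simp
    also have "\<dots> \<le> real q ^ (d - 1) * real (M * nshift m * nedges m) * real w ^ e"
      using edges by (intro mult_mono mult_nonneg_nonneg) auto
    also have "\<dots> = real (q ^ (CARD('d) - 1) * (M * nshift m) * nedges m * w ^ (CARD('d) - 2))"
      by (simp add: d_def e_def)
    also have "\<dots> \<le> real (card {H. halving_hyperplane P H})" using P(5) by (simp only: of_nat_le_iff)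
    finally have cnt: "real n ^ (d - 1) * (c1 * (4/3) ^ m) \<le> real (card {H. halving_hyperplane P H})" .
    have "exp (c * sqrt (ln (real n))) \<le> exp (c * (real (m + 2) * S))" using sqrt_n c0 by simp
    also have "\<dots> \<le> c1 * (4/3) ^ m" using gain m(1) by simp
    finally have "real n ^ (d - 1) * exp (c * sqrt (ln (real n))) \<le> real n ^ (d - 1) * (c1 * (4/3) ^ m)"
      by (intro mult_left_mono) auto
    hence "real n ^ (CARD('d) - 1) * exp (c * sqrt (ln (real n))) \<le> real (card {H. halving_hyperplane P H})"
      using cnt by (simp add: d_def)
    thus "\<exists>P :: (real ^ 'd) set. finite P \<and> card P = n \<and> gamma_dense (2 * hi) P \<and> general_position P \<and>
        real (card {H. halving_hyperplane P H}) \<ge> real n ^ (CARD('d) - 1) * exp (c * sqrt (ln (real n)))"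
      using P(1,3) cP dense by blast
  qed
qed

section \<open>Small n and the conclusion\<close>

lemma gamma_dense_mono:
  fixes P :: "'a::euclidean_space set"
  shows "gamma_dense \<gamma> P \<Longrightarrow> \<gamma> \<le> \<gamma>' \<Longrightarrow> gamma_dense \<gamma>' P"
  unfolding gamma_dense_def
proof (elim conjE, intro conjI impI)
  assume "\<gamma> \<le> \<gamma>'" and 2: "2 \<le> card P"
    and d: "2 \<le> card P \<longrightarrow> Max (distances P) / Min (distances P) \<le> \<gamma> * root DIM('a) (real (card P))"
  hence "\<gamma> * root DIM('a) (real (card P)) \<le> \<gamma>' * root DIM('a) (real (card P))" by (intro mult_right_mono) auto
  thus "Max (distances P) / Min (distances P) \<le> \<gamma>' * root DIM('a) (real (card P))" using d 2 by linarith
qed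

text \<open>Below the threshold no halving hyperplanes are required, so any set in general position
  will do, with whatever ratio of distances it has.\<close>

lemma general_position_set_exists:
  assumes "n > 0"
  shows "\<exists>(P :: 'a::euclidean_space set) \<gamma>. finite P \<and> card P = n \<and> general_position P \<and> gamma_dense \<gamma> P"
proof -
  have "affinely_generic ({} :: 'a set)" unfolding affinely_generic_def by (auto simp: affine_dependent_def)
  from generic_perturbation[of "{..<n}" "{}" 1 "\<lambda>_. 0 :: 'a", OF _ _ this] obtain f :: "nat \<Rightarrow> 'a"
    where f: "inj_on f {..<n}" "affinely_generic (f ` {..<n})" by auto
  define P where "P = f ` {..<n}"
  have cP: "card P = n" unfolding P_def using card_image[OF f(1)] by simp
  have "root DIM('a) (real n) > 0" using assms by simp
  hence "gamma_dense (Max (distances P) / Min (distances P) / root DIM('a) (real n)) P"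
    unfolding gamma_dense_def cP by (simp add: P_def)
  thus ?thesis using cP affinely_generic_imp_general_position[OF f(2)] unfolding P_def by blast
qed

theorem theorem2:
  assumes "CARD('d::finite) \<ge> 3"
  shows "\<exists>\<gamma>::real. \<exists>c::real. \<exists>n\<^sub>0::nat. \<gamma> > 0 \<and> c > 0 \<and>
    (\<forall>n::nat. n > 0 \<and> even (n + CARD('d)) \<longrightarrow>
      (\<exists>P :: (real ^ 'd) set.
         finite P \<and> card P = n \<and> gamma_dense \<gamma> P \<and> general_position P \<and>
         (n \<ge> n\<^sub>0 \<longrightarrow>
            real (card {H. halving_hyperplane P H})
              \<ge> real n ^ (CARD('d) - 1) * exp (c * sqrt (ln (real n))))))"
proof -
  obtain \<gamma> c :: real and n1 where \<gamma>: "\<gamma> > 0" "c > 0" and large: "\<And>n. n \<ge> n1 \<Longrightarrow> even (n + CARD('d)) \<Longrightarrow>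
     (\<exists>P :: (real ^ 'd) set. finite P \<and> card P = n \<and> gamma_dense \<gamma> P \<and> general_position P \<and>
        real (card {H. halving_hyperplane P H}) \<ge> real n ^ (CARD('d) - 1) * exp (c * sqrt (ln (real n))))"
    using large_dense_sets[OF assms] by blast
  have "\<forall>n. \<exists>\<gamma>'. n > 0 \<longrightarrow> (\<exists>P :: (real ^ 'd) set. finite P \<and> card P = n \<and> general_position P \<and> gamma_dense \<gamma>' P)"
    using general_position_set_exists by blast
  then obtain f where f: "\<And>n. n > 0 \<Longrightarrow> \<exists>P :: (real ^ 'd) set. finite P \<and> card P = n \<and> general_position P \<and> gamma_dense (f n) P"
    by metis
  \<comment> \<open>The sum dominates each of the finitely many constants needed below
    \<open>n1\<close>.\<close>
  define \<gamma>0 where "\<gamma>0 = \<gamma> + (\<Sum>n<n1. \<bar>f n\<bar>)"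
  have le: "\<gamma> \<le> \<gamma>0" by (simp add: \<gamma>0_def sum_nonneg)
  have lef: "f n \<le> \<gamma>0" if "n < n1" for n
    using member_le_sum[of n "{..<n1}" "\<lambda>n. \<bar>f n\<bar>"] that \<gamma>(1) by (simp add: \<gamma>0_def)
  show ?thesis
  proof (rule exI[of _ \<gamma>0], rule exI[of _ c], rule exI[of _ n1], intro conjI allI impI)
    show "\<gamma>0 > 0" "c > 0" using \<gamma> le by auto
    fix n assume n: "n > 0 \<and> even (n + CARD('d))"
    show "\<exists>P :: (real ^ 'd) set.
         finite P \<and> card P = n \<and> gamma_dense \<gamma>0 P \<and> general_position P \<and>
         (n \<ge> n1 \<longrightarrow>
            real (card {H. halving_hyperplane P H})
              \<ge> real n ^ (CARD('d) - 1) * exp (c * sqrt (ln (real n))))"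
    proof (cases "n \<ge> n1")
      case True
      thus ?thesis using large[OF True] n gamma_dense_mono[OF _ le] by blast
    next
      case False
      thus ?thesis using f[of n] n gamma_dense_mono[OF _ lef[of n]] by (meson not_le)
    qed
  qed
qed

end
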